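(* Let $g\ge 1$ and let $u=u(t_1,t_3,\dots,t_{2g+1})$, $t_1=x$, be a solution of the PI hierarchy, with associated matrices $V(\lambda)$ and $U_n(\lambda)$ (see context), so that the matrix Lax equations $$\partial_{2n+1}V(\lambda)=[U_n(\lambda),V(\lambda)]+U_n'(\lambda),\qquad n=0,1,\dots,g,$$ hold, where $U_n'(\lambda)=\partial_\lambda U_n(\lambda)$. Then, except for the $t_{2g+1}$-flow, these equations can be cast into the Hamiltonian form $$\partial_{2n+1}V(\lambda)=\{V(\lambda),H_{n+1}\}+U_n'(\lambda),\qquad n=0,1,\dots,g-1,$$ i.e. $[U_n(\lambda),V(\lambda)]=\{V(\lambda),H_{n+1}\}$ for $n=0,\dots,g-1$. Here $\{\ ,\ \}$ is the Poisson bracket described in the context, and $H_1,\dots,H_g$ are defined by the triangular linear equations $$I_1=H_1,\qquad I_{n+1}=H_{n+1}+c_1(t)H_n+\cdots+c_n(t)H_1,\quad n=1,\dots,g-1,$$ where $I_n$ is the coefficient of $\lambda^{g-n}$ in $h(\lambda)=\alpha(\lambda)^2+\beta(\lambda)\gamma(\lambda)$.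
   Context: **PI hierarchy.** Fix $g\ge1$. The independent variables are $t_1=x,t_3,\dots,t_{2g+1}$, with $\partial_{2n+1}=\partial/\partial t_{2n+1}$; a subscript $x$ means $\partial_x$. The Gelfand–Dickey polynomials $R_n$ are the differential polynomials in $u$ defined as follows: $R_{n+1}$ is the coefficient of $\partial_x^{-1}$ in the pseudo-differential operator $Q^{n+1/2}$, $Q=\partial_x^2+u$, and $R_0=1$. Thus $R_1=\frac u2$, $R_2=\frac18u_{xx}+\frac38u^2$, and they satisfy $R_{n+1,x}=\frac14R_{n,xxx}+uR_{n,x}+\frac12u_xR_n$. Put $R_n(\lambda)=\lambda^n+R_1\lambda^{n-1}+\cdots+R_n$. Put $c_0(t)=1$ and $c_n(t)=\frac{2(g-n)+3}{2}\,t_{2(g-n)+3}$ for $n=1,\dots,g$. A solution of the PI hierarchy is a smooth (or holomorphic) function $u$ on an open domain satisfying $$2R_{g+1}+2c_1(t)R_g+\cdots+2c_g(t)R_1+x=0,\qquad \partial_{2n+1}u=2R_{n+1,x}\quad (n=1,\dots,g).$$ **Matrices.** $$U_n(\lambda)=\begin{pmatrix}\mathrm A_n(\lambda)&\mathrm B_n(\lambda)\\ \Gamma_n(\lambda)&-\mathrm A_n(\lambda)\end{pmatrix},\quad \mathrm B_n(\lambda)=R_n(\lambda),\quad \mathrm A_n(\lambda)=-\tfrac12R_n(\lambda)_x,\quad \Gamma_n(\lambda)=-\tfrac12R_n(\lambda)_{xx}+(\lambda-u)R_n(\lambda),$$ $$V(\lambda)=\begin{pmatrix}\alpha(\lambda)&\beta(\lambda)\\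 \gamma(\lambda)&-\alpha(\lambda)\end{pmatrix}=U_g(\lambda)+c_1(t)U_{g-1}(\lambda)+\cdots+c_g(t)U_0(\lambda).$$ The hierarchy in matrix form is the system of Lax equations $\partial_{2n+1}V=[U_n,V]+U_n'$, $n=0,\dots,g$, satisfied by every solution. **Poisson structure.** The phase space is the $(3g+1)$-dimensional space of matrices $V(\lambda)=\begin{pmatrix}\alpha&\beta\\ \gamma&-\alpha\end{pmatrix}$ with $\alpha(\lambda)=\alpha_1\lambda^{g-1}+\cdots+\alpha_g$, $\beta(\lambda)=\lambda^g+\beta_1\lambda^{g-1}+\cdots+\beta_g$, $\gamma(\lambda)=\lambda^{g+1}+\gamma_1\lambda^g+\cdots+\gamma_{g+1}$, with coordinates $\alpha_j,\beta_j,\gamma_j$. The bracket is $$\{V(\lambda)\overset{\otimes}{,}V(\mu)\}=\Bigl[V(\lambda)\otimes I+I\otimes V(\mu),\tfrac{P}{\lambda-\mu}\Bigr]+[V(\lambda)\otimes I-I\otimes V(\mu),E_{21}\otimes E_{21}],$$ where $P=\sum_{a,b=1,2}E_{ab}\otimes E_{ba}$, $\{V(\lambda)\overset{\otimes}{,}V(\mu)\}=\sum_{a,b,c,d}\{V_{ab}(\lambda),V_{cd}(\mu)\}E_{ab}\otimes E_{cd}$ and $E_{ab}$ are the matrix units. In components: $\{\alpha(\lambda),\alpha(\mu)\}=\{\beta(\lambda),\beta(\mu)\}=0$, $\{\alpha(\lambda),\beta(\mu)\}=\frac{\beta(\lambda)-\beta(\mu)}{\lambda-\mu}$, $\{\alpha(\lambda),\gamma(\mu)\}=-\frac{\gamma(\lambda)-\gamma(\mu)}{\lambda-\mu}+\beta(\lambda)$,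 $\{\beta(\lambda),\gamma(\mu)\}=2\frac{\alpha(\lambda)-\alpha(\mu)}{\lambda-\mu}$, $\{\gamma(\lambda),\gamma(\mu)\}=-2\alpha(\lambda)+2\alpha(\mu)$. The $I_n$ and $H_n$ are functions on the phase space; in the bracket the quantities $c_i(t)$ are treated as constants, $\{V(\lambda),H\}$ is the matrix of brackets of the entries of $V(\lambda)$ with $H$, and the result is evaluated at the matrix $V(\lambda)$ attached to $u$. *)

theory Defs
  imports "HOL-Analysis.Analysis" "HOL-Library.Poly_Mapping" "HOL-Computational_Algebra.Polynomial"
begin

section \<open>Differential polynomials in one indeterminate\<close>

text \<open>
  The indeterminate of index \<open>k\<close> stands for the \<open>k\<close>-th \<open>x\<close>-derivative of \<open>u\<close>. A monomial is its
  finitely supported exponent function.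
\<close>

type_synonym 'a dpoly = "(nat \<Rightarrow>\<^sub>0 nat) \<Rightarrow>\<^sub>0 'a"

definition dp_const :: "'a::comm_ring_1 \<Rightarrow> 'a dpoly" where
  "dp_const c = Poly_Mapping.single 0 c"

definition dp_u :: "nat \<Rightarrow> 'a::comm_ring_1 dpoly" where
  "dp_u k = Poly_Mapping.single (Poly_Mapping.single k 1) 1"

text \<open>The derivation with \<open>dp_u k \<mapsto> dp_u (k + 1)\<close> that kills the constants.\<close>

definition dp_deriv :: "'a::comm_ring_1 dpoly \<Rightarrow> 'a dpoly" where
  "dp_deriv p =
     (\<Sum>m\<in>Poly_Mapping.keys p. \<Sum>k\<in>Poly_Mapping.keys m.
        Poly_Mapping.single
          (m - Poly_Mapping.single k 1 + Poly_Mapping.single (Suc k) 1)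
          (Poly_Mapping.lookup p m * of_nat (Poly_Mapping.lookup m k)))"

definition dp_eval :: "(nat \<Rightarrow> 'a::comm_ring_1) \<Rightarrow> 'a dpoly \<Rightarrow> 'a" where
  "dp_eval v p =
     (\<Sum>m\<in>Poly_Mapping.keys p. Poly_Mapping.lookup p m *
        (\<Prod>k\<in>Poly_Mapping.keys m. v k ^ Poly_Mapping.lookup m k))"


section \<open>Pseudo-differential operators and the Gelfand-Dickey polynomials\<close>

text \<open>
  \<open>A :: 'a pdo\<close> represents the formal sum of \<open>A k * \<partial>^k\<close> over all integers \<open>k\<close>, where
  \<open>A k = 0\<close> for all large \<open>k\<close>. The product is determined by
  \<open>\<partial>^i \<circ> b = (\<Sum>k\<ge>0. (i choose k) * b^(k) * \<partial>^(i-k))\<close>; for operators of bounded order the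
  index set in \<open>pdo_mult\<close> is finite.
\<close>

type_synonym 'a pdo = "int \<Rightarrow> 'a dpoly"

definition pdo_mult :: "'a::field_char_0 pdo \<Rightarrow> 'a pdo \<Rightarrow> 'a pdo" where
  "pdo_mult A B = (\<lambda>n.
     \<Sum>(i, j)\<in>{(i, j). A i \<noteq> 0 \<and> B j \<noteq> 0 \<and> n \<le> i + j}.
       dp_const ((of_int i :: 'a) gchoose nat (i + j - n)) * A i
         * (dp_deriv ^^ nat (i + j - n)) (B j))"

definition pdo_one :: "'a::field_char_0 pdo" where
  "pdo_one = (\<lambda>k. if k = 0 then 1 else 0)"

primrec pdo_power :: "'a::field_char_0 pdo \<Rightarrow> nat \<Rightarrow> 'a pdo" where
  "pdo_power A 0 = pdo_one"
| "pdo_power A (Suc n) = pdo_mult A (pdo_power A n)"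

definition pdo_Q :: "'a::field_char_0 pdo" where
  "pdo_Q = (\<lambda>k. if k = 2 then 1 else if k = 0 then dp_u 0 else 0)"

text \<open>The square root of \<open>Q = \<partial>^2 + u\<close> of the form \<open>\<partial> + (lower order terms)\<close>.\<close>

definition pdo_sqrt_Q :: "'a::field_char_0 pdo" where
  "pdo_sqrt_Q = (THE L. L 1 = 1 \<and> (\<forall>k>1. L k = 0) \<and> pdo_mult L L = pdo_Q)"

text \<open>\<open>Q^(n + 1/2)\<close> is the power \<open>2 n + 1\<close> of the square root of \<open>Q\<close>.\<close>

fun gelfand_dickey :: "nat \<Rightarrow> 'a::field_char_0 dpoly" where
  "gelfand_dickey 0 = 1"
| "gelfand_dickey (Suc n) = pdo_power pdo_sqrt_Q (2 * n + 1) (-1)"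


section \<open>Partial derivatives and smooth functions\<close>

text \<open>
  The field \<open>'a\<close> is \<open>real\<close> or \<open>complex\<close>. The independent variables are the components of a
  vector \<open>t\<close>.
\<close>

definition partial :: "'n::finite \<Rightarrow> ('a::real_normed_field ^ 'n \<Rightarrow> 'a) \<Rightarrow> 'a ^ 'n \<Rightarrow> 'a" where
  "partial i f t = deriv (\<lambda>s. f (t + axis i s)) 0"

primrec Ck_on :: "nat \<Rightarrow> ('a::real_normed_field ^ 'n::finite) set \<Rightarrow> ('a ^ 'n \<Rightarrow> 'a) \<Rightarrow> bool" where
  "Ck_on 0 S f \<longleftrightarrow> continuous_on S f"
| "Ck_on (Suc k) S f \<longleftrightarrow> continuous_on S f \<and>
     (\<forall>i. (\<forall>t\<in>S. (\<lambda>s. f (t + axis i s)) field_differentiable (at 0)) \<and> Ck_on k S (partial i f))"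

text \<open>
  All iterated partial derivatives exist and are continuous. On an open set this is
  \<open>C\<^sup>\<infinity>\<close> for \<open>'a = real\<close> and holomorphy for \<open>'a = complex\<close>.
\<close>

definition smooth_fun_on :: "('a::real_normed_field ^ 'n::finite) set \<Rightarrow> ('a ^ 'n \<Rightarrow> 'a) \<Rightarrow> bool" where
  "smooth_fun_on S f \<longleftrightarrow> (\<forall>k. Ck_on k S f)"


section \<open>The PI hierarchy\<close>

text \<open>
  The map \<open>ix\<close> is a bijection from \<open>{0..g}\<close> onto the index type: the variable with odd
  subscript \<open>2 k + 1\<close> is \<open>t $ ix k\<close>. In particular \<open>x = t $ ix 0\<close>.
\<close>

definition PI_c :: "nat \<Rightarrow> (nat \<Rightarrow> 'n::finite) \<Rightarrow> nat \<Rightarrow> 'a::real_normed_field ^ 'n \<Rightarrow> 'a" where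
  "PI_c g ix n t =
     (if n = 0 then 1 else of_nat (2 * (g - n) + 3) / 2 * t $ ix (g - n + 1))"

definition PI_R :: "(nat \<Rightarrow> 'n::finite) \<Rightarrow> ('a::real_normed_field ^ 'n \<Rightarrow> 'a) \<Rightarrow> nat \<Rightarrow> 'a ^ 'n \<Rightarrow> 'a" where
  "PI_R ix u n t = dp_eval (\<lambda>k. (partial (ix 0) ^^ k) u t) (gelfand_dickey n)"

definition PI_solution ::
  "nat \<Rightarrow> (nat \<Rightarrow> 'n::finite) \<Rightarrow> ('a::real_normed_field ^ 'n) set \<Rightarrow> ('a ^ 'n \<Rightarrow> 'a) \<Rightarrow> bool" where
  "PI_solution g ix S u \<longleftrightarrow> open S \<and> smooth_fun_on S u \<and>
     (\<forall>t\<in>S. 2 * PI_R ix u (g + 1) t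
        + (\<Sum>i=1..g. 2 * PI_c g ix i t * PI_R ix u (g + 1 - i) t) + t $ ix 0 = 0) \<and>
     (\<forall>t\<in>S. \<forall>n\<in>{1..g}. partial (ix n) u t = 2 * partial (ix 0) (PI_R ix u (n + 1)) t)"


section \<open>The matrices of the hierarchy\<close>

text \<open>Entries are polynomials in the spectral parameter \<open>\<lambda>\<close>.\<close>

definition mat2 :: "'b::zero \<Rightarrow> 'b \<Rightarrow> 'b \<Rightarrow> 'b \<Rightarrow> 'b ^ 2 ^ 2" where
  "mat2 a b c d = vector [vector [a, b], vector [c, d]]"

definition commutator :: "'b::ring_1 ^ 'n ^ 'n \<Rightarrow> 'b ^ 'n ^ 'n \<Rightarrow> 'b ^ 'n ^ 'n" where
  "commutator A B = A ** B - B ** A"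

definition PI_B :: "(nat \<Rightarrow> 'n::finite) \<Rightarrow> ('a::real_normed_field ^ 'n \<Rightarrow> 'a) \<Rightarrow> nat \<Rightarrow> 'a ^ 'n \<Rightarrow> 'a poly" where
  "PI_B ix u n t = (\<Sum>k\<le>n. monom (PI_R ix u k t) (n - k))"

definition PI_A :: "(nat \<Rightarrow> 'n::finite) \<Rightarrow> ('a::real_normed_field ^ 'n \<Rightarrow> 'a) \<Rightarrow> nat \<Rightarrow> 'a ^ 'n \<Rightarrow> 'a poly" where
  "PI_A ix u n t = smult (- 1 / 2) (\<Sum>k\<le>n. monom (partial (ix 0) (PI_R ix u k) t) (n - k))"

definition PI_Gamma :: "(nat \<Rightarrow> 'n::finite) \<Rightarrow> ('a::real_normed_field ^ 'n \<Rightarrow> 'a) \<Rightarrow> nat \<Rightarrow> 'a ^ 'n \<Rightarrow> 'a poly" where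
  "PI_Gamma ix u n t =
     smult (- 1 / 2) (\<Sum>k\<le>n. monom (partial (ix 0) (partial (ix 0) (PI_R ix u k)) t) (n - k))
     + [:- u t, 1:] * PI_B ix u n t"

definition PI_U :: "(nat \<Rightarrow> 'n::finite) \<Rightarrow> ('a::real_normed_field ^ 'n \<Rightarrow> 'a) \<Rightarrow> nat \<Rightarrow> 'a ^ 'n \<Rightarrow> 'a poly ^ 2 ^ 2" where
  "PI_U ix u n t = mat2 (PI_A ix u n t) (PI_B ix u n t) (PI_Gamma ix u n t) (- PI_A ix u n t)"

definition PI_V :: "nat \<Rightarrow> (nat \<Rightarrow> 'n::finite) \<Rightarrow> ('a::real_normed_field ^ 'n \<Rightarrow> 'a) \<Rightarrow> 'a ^ 'n \<Rightarrow> 'a poly ^ 2 ^ 2" where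
  "PI_V g ix u t = (\<chi> a b. \<Sum>i\<le>g. smult (PI_c g ix i t) (PI_U ix u (g - i) t $ a $ b))"


section \<open>The phase space and its Poisson bracket\<close>

text \<open>
  A point of the phase space is given by its \<open>3 g + 1\<close> coordinates; the values of a point
  outside \<open>coords g\<close> are irrelevant.
\<close>

datatype coord = Alpha nat | Beta nat | Gamma nat

type_synonym 'a phase = "coord \<Rightarrow> 'a"

definition coords :: "nat \<Rightarrow> coord set" where
  "coords g = Alpha ` {1..g} \<union> Beta ` {1..g} \<union> Gamma ` {1..g + 1}"

definition alpha_poly :: "nat \<Rightarrow> 'a::comm_ring_1 phase \<Rightarrow> 'a poly" where
  "alpha_poly g z = (\<Sum>j=1..g. monom (z (Alpha j)) (g - j))"

definition beta_poly :: "nat \<Rightarrow> 'a::comm_ring_1 phase \<Rightarrow> 'a poly" where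
  "beta_poly g z = monom 1 g + (\<Sum>j=1..g. monom (z (Beta j)) (g - j))"

definition gamma_poly :: "nat \<Rightarrow> 'a::comm_ring_1 phase \<Rightarrow> 'a poly" where
  "gamma_poly g z = monom 1 (g + 1) + (\<Sum>j=1..g + 1. monom (z (Gamma j)) (g + 1 - j))"

definition phase_matrix :: "nat \<Rightarrow> 'a::comm_ring_1 phase \<Rightarrow> 'a poly ^ 2 ^ 2" where
  "phase_matrix g z = mat2 (alpha_poly g z) (beta_poly g z) (gamma_poly g z) (- alpha_poly g z)"

fun phase_point :: "nat \<Rightarrow> 'a::comm_ring_1 poly ^ 2 ^ 2 \<Rightarrow> 'a phase" where
  "phase_point g M (Alpha j) = coeff (M $ 1 $ 1) (g - j)"
| "phase_point g M (Beta j) = coeff (M $ 1 $ 2) (g - j)"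
| "phase_point g M (Gamma j) = coeff (M $ 2 $ 1) (g + 1 - j)"

text \<open>
  The brackets of the coordinates: the coefficients of \<open>\<lambda>^i * \<mu>^j\<close> in the component form of
  the bracket, where the coefficient of \<open>\<lambda>^i * \<mu>^j\<close> in \<open>(p(\<lambda>) - p(\<mu>)) / (\<lambda> - \<mu>)\<close> is the
  coefficient of \<open>p\<close> of index \<open>i + j + 1\<close>. The bracket of two functions is then given by the
  Leibniz rule. The theorem \<open>bracket_r_matrix\<close> below recovers the \<open>r\<close>-matrix form.
\<close>

fun coord_bracket :: "nat \<Rightarrow> 'a::comm_ring_1 phase \<Rightarrow> coord \<Rightarrow> coord \<Rightarrow> 'a" where
  "coord_bracket g z (Alpha i) (Alpha j) = 0"
| "coord_bracket g z (Beta i) (Beta j) = 0"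
| "coord_bracket g z (Alpha i) (Beta j) = coeff (beta_poly g z) ((g - i) + (g - j) + 1)"
| "coord_bracket g z (Beta i) (Alpha j) = - coeff (beta_poly g z) ((g - j) + (g - i) + 1)"
| "coord_bracket g z (Alpha i) (Gamma j) =
     - coeff (gamma_poly g z) ((g - i) + (g + 1 - j) + 1)
     + (if g + 1 - j = 0 then coeff (beta_poly g z) (g - i) else 0)"
| "coord_bracket g z (Gamma i) (Alpha j) =
     coeff (gamma_poly g z) ((g - j) + (g + 1 - i) + 1)
     - (if g + 1 - i = 0 then coeff (beta_poly g z) (g - j) else 0)"
| "coord_bracket g z (Beta i) (Gamma j) = 2 * coeff (alpha_poly g z) ((g - i) + (g + 1 - j) + 1)"
| "coord_bracket g z (Gamma i) (Beta j) = - 2 * coeff (alpha_poly g z) ((g - j) + (g + 1 - i) + 1)"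
| "coord_bracket g z (Gamma i) (Gamma j) =
     - 2 * (if g + 1 - j = 0 then coeff (alpha_poly g z) (g + 1 - i) else 0)
     + 2 * (if g + 1 - i = 0 then coeff (alpha_poly g z) (g + 1 - j) else 0)"

definition coord_partial :: "coord \<Rightarrow> ('a::real_normed_field phase \<Rightarrow> 'a) \<Rightarrow> 'a phase \<Rightarrow> 'a" where
  "coord_partial p F z = deriv (\<lambda>s. F (z(p := s))) (z p)"

definition bracket ::
  "nat \<Rightarrow> ('a::real_normed_field phase \<Rightarrow> 'a) \<Rightarrow> ('a phase \<Rightarrow> 'a) \<Rightarrow> 'a phase \<Rightarrow> 'a" where
  "bracket g F G z = (\<Sum>p\<in>coords g. \<Sum>q\<in>coords g.
     coord_bracket g z p q * coord_partial p F z * coord_partial q G z)"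

text \<open>The entries of the matrix of brackets of \<open>V(\<lambda>)\<close> with \<open>F\<close>.\<close>

definition matrix_bracket ::
  "nat \<Rightarrow> 'a::real_normed_field \<Rightarrow> ('a phase \<Rightarrow> 'a) \<Rightarrow> 'a phase \<Rightarrow> 'a ^ 2 ^ 2" where
  "matrix_bracket g l F z = (\<chi> a b. bracket g (\<lambda>w. poly (phase_matrix g w $ a $ b) l) F z)"

definition PI_I :: "nat \<Rightarrow> nat \<Rightarrow> 'a::comm_ring_1 phase \<Rightarrow> 'a" where
  "PI_I g n z = coeff (alpha_poly g z ^ 2 + beta_poly g z * gamma_poly g z) (g - n)"

definition eval_mat :: "'a::comm_ring_1 poly ^ 'm ^ 'n \<Rightarrow> 'a \<Rightarrow> 'a ^ 'm ^ 'n" where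
  "eval_mat M l = (\<chi> a b. poly (M $ a $ b) l)"


subsection \<open>Component form and \<open>r\<close>-matrix form of the bracket\<close>

lemma sum_coords:
  "(\<Sum>p\<in>coords g. f p) =
     (\<Sum>j=1..g. f (Alpha j)) + (\<Sum>j=1..g. f (Beta j)) + (\<Sum>j=1..g + 1. f (Gamma j))"
proof -
  have "(\<Sum>p\<in>coords g. f p) = (\<Sum>p\<in>Alpha ` {1..g} \<union> Beta ` {1..g}. f p) + (\<Sum>p\<in>Gamma ` {1..g + 1}. f p)"
    unfolding coords_def by (rule sum.union_disjoint) auto
  also have "(\<Sum>p\<in>Alpha ` {1..g} \<union> Beta ` {1..g}. f p) = (\<Sum>p\<in>Alpha ` {1..g}. f p) + (\<Sum>p\<in>Beta ` {1..g}. f p)"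
    by (rule sum.union_disjoint) auto
  finally show ?thesis by (simp add: sum.reindex inj_on_def)
qed

lemma finite_coords [simp]: "finite (coords g)"
  by (simp add: coords_def)

lemma coord_partial_affine:
  fixes F :: "'a::real_normed_field phase \<Rightarrow> 'a"
  assumes F: "\<And>z. F z = k + (\<Sum>p\<in>coords g. w p * z p)" and p: "p \<in> coords g"
  shows "coord_partial p F z = w p"
proof -
  have eq: "(\<lambda>s. F (z(p := s))) = (\<lambda>s. k + (w p * s + (\<Sum>q\<in>coords g - {p}. w q * z q)))"
  proof
    fix s
    have "(\<Sum>q\<in>coords g. w q * (z(p := s)) q) = w p * s + (\<Sum>q\<in>coords g - {p}. w q * (z(p := s)) q)"
      using p by (subst sum.remove[of _ p]) auto
    also have "(\<Sum>q\<in>coords g - {p}. w q * (z(p := s)) q) = (\<Sum>q\<in>coords g - {p}. w q * z q)"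
      by (rule sum.cong) auto
    finally show "F (z(p := s)) = k + (w p * s + (\<Sum>q\<in>coords g - {p}. w q * z q))"
      by (simp add: F)
  qed
  show ?thesis unfolding coord_partial_def eq
    by (rule DERIV_imp_deriv) (auto intro!: derivative_eq_intros)
qed

lemma bracket_affine:
  fixes F G :: "'a::real_normed_field phase \<Rightarrow> 'a"
  assumes "\<And>z. F z = k + (\<Sum>p\<in>coords g. w p * z p)"
    and "\<And>z. G z = k' + (\<Sum>p\<in>coords g. w' p * z p)"
  shows "bracket g F G z = (\<Sum>p\<in>coords g. \<Sum>q\<in>coords g. coord_bracket g z p q * w p * w' q)"
  unfolding bracket_def
  by (intro sum.cong refl)
    (simp add: coord_partial_affine[OF assms(1)] coord_partial_affine[OF assms(2)])

primrec alpha_wt :: "nat \<Rightarrow> 'a::comm_ring_1 \<Rightarrow> coord \<Rightarrow> 'a" where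
  "alpha_wt g l (Alpha j) = l ^ (g - j)" | "alpha_wt g l (Beta j) = 0" | "alpha_wt g l (Gamma j) = 0"
primrec beta_wt :: "nat \<Rightarrow> 'a::comm_ring_1 \<Rightarrow> coord \<Rightarrow> 'a" where
  "beta_wt g l (Alpha j) = 0" | "beta_wt g l (Beta j) = l ^ (g - j)" | "beta_wt g l (Gamma j) = 0"
primrec gamma_wt :: "nat \<Rightarrow> 'a::comm_ring_1 \<Rightarrow> coord \<Rightarrow> 'a" where
  "gamma_wt g l (Alpha j) = 0" | "gamma_wt g l (Beta j) = 0" | "gamma_wt g l (Gamma j) = l ^ (g + 1 - j)"

lemma poly_alpha: "poly (alpha_poly g z) l = 0 + (\<Sum>p\<in>coords g. alpha_wt g l p * z p)"
  by (simp add: alpha_poly_def sum_coords poly_sum poly_monom mult.commute)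

lemma poly_alpha_neg: "poly (- alpha_poly g z) l = 0 + (\<Sum>p\<in>coords g. (- alpha_wt g l p) * z p)"
  by (simp add: poly_alpha sum_negf)

lemma poly_beta: "poly (beta_poly g z) l = l ^ g + (\<Sum>p\<in>coords g. beta_wt g l p * z p)"
  by (simp add: beta_poly_def sum_coords poly_sum poly_monom mult.commute)

lemma poly_gamma: "poly (gamma_poly g z) l = l ^ (g + 1) + (\<Sum>p\<in>coords g. gamma_wt g l p * z p)"
  by (simp add: gamma_poly_def sum_coords poly_sum poly_monom mult.commute)

lemma sum_flip: "(\<Sum>j=1..N. f (N - j)) = (\<Sum>i<N. f i)" for N :: nat
  by (rule sum.reindex_bij_witness[where i = "\<lambda>i. N - i" and j = "\<lambda>j. N - j"]) auto

lemma coeff_alpha: "coeff (alpha_poly g z) i = (if i < g then z (Alpha (g - i)) else 0)"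
proof -
  have "coeff (alpha_poly g z) i = (\<Sum>j=1..g. if g - j = i then z (Alpha j) else 0)"
    by (simp add: alpha_poly_def coeff_sum)
  also have "\<dots> = (\<Sum>j\<in>{1..g}. if j = g - i then (if i < g then z (Alpha (g - i)) else 0) else 0)"
    by (rule sum.cong) auto
  finally show ?thesis by auto
qed

lemma coeff_beta:
  "coeff (beta_poly g z) i = (if i < g then z (Beta (g - i)) else if i = g then 1 else 0)"
proof -
  have "coeff (\<Sum>j=1..g. monom (z (Beta j)) (g - j)) i = (\<Sum>j=1..g. if g - j = i then z (Beta j) else 0)"
    by (simp add: coeff_sum)
  also have "\<dots> = (\<Sum>j\<in>{1..g}. if j = g - i then (if i < g then z (Beta (g - i)) else 0) else 0)"
    by (rule sum.cong) auto
  finally show ?thesis by (auto simp: beta_poly_def)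
qed

lemma coeff_gamma:
  "coeff (gamma_poly g z) i =
     (if i < g + 1 then z (Gamma (g + 1 - i)) else if i = g + 1 then 1 else 0)"
proof -
  have "coeff (\<Sum>j=1..g + 1. monom (z (Gamma j)) (g + 1 - j)) i
      = (\<Sum>j=1..g + 1. if g + 1 - j = i then z (Gamma j) else 0)"
    by (simp add: coeff_sum)
  also have "\<dots> = (\<Sum>j\<in>{1..g + 1}. if j = g + 1 - i then (if i < g + 1 then z (Gamma (g + 1 - i)) else 0) else 0)"
    by (rule sum.cong) auto
  finally show ?thesis by (auto simp: gamma_poly_def)
qed

lemma poly_lessThan:
  fixes p :: "'a::comm_ring_1 poly"
  assumes "\<And>i. i \<ge> N \<Longrightarrow> coeff p i = 0"
  shows "poly p l = (\<Sum>i<N. coeff p i * l ^ i)"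
proof (cases "p = 0")
  case False
  then have "degree p < N" using assms by (metis leading_coeff_0_iff not_le)
  then have "(\<Sum>i<N. coeff p i * l ^ i) = (\<Sum>i\<le>degree p. coeff p i * l ^ i)"
    by (intro sum.mono_neutral_right) (auto simp: coeff_eq_0)
  then show ?thesis by (simp add: poly_altdef)
qed simp

lemma divided_difference:
  fixes l m :: "'a::comm_ring_1"
  assumes c: "\<And>i. i > N \<Longrightarrow> coeff p i = 0"
  shows "(l - m) * (\<Sum>i<N. \<Sum>j<N. coeff p (i + j + 1) * l ^ i * m ^ j) = poly p l - poly p m"
proof -
  define T where "T i j = coeff p (i + j) * l ^ i * m ^ j" for i j
  have T1: "T (Suc i) N = 0" and T2: "T N (Suc i) = 0" for i
    by (simp_all add: T_def c)
  have ev: "poly p x = (\<Sum>i<Suc N. coeff p i * x ^ i)" for x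
    by (rule poly_lessThan) (simp add: c)
  have "l * (\<Sum>i<N. \<Sum>j<N. coeff p (i + j + 1) * l ^ i * m ^ j) = (\<Sum>i<N. \<Sum>j<N. T (Suc i) j)"
    by (simp add: T_def sum_distrib_left mult_ac)
  also have "\<dots> = (\<Sum>i<N. \<Sum>j<Suc N. T (Suc i) j)" by (simp add: T1)
  also have "\<dots> = (\<Sum>i<Suc N. \<Sum>j<Suc N. T i j) - (\<Sum>j<Suc N. T 0 j)"
    by (simp only: sum.lessThan_Suc_shift[of "\<lambda>i. \<Sum>j<Suc N. T i j"]) simp
  also have "(\<Sum>j<Suc N. T 0 j) = poly p m" by (simp only: ev T_def) simp
  finally have 1: "l * (\<Sum>i<N. \<Sum>j<N. coeff p (i + j + 1) * l ^ i * m ^ j)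
      = (\<Sum>i<Suc N. \<Sum>j<Suc N. T i j) - poly p m" .
  have "m * (\<Sum>i<N. \<Sum>j<N. coeff p (i + j + 1) * l ^ i * m ^ j) = (\<Sum>i<N. \<Sum>j<N. T i (Suc j))"
    by (simp add: T_def sum_distrib_left mult_ac)
  also have "\<dots> = (\<Sum>j<N. \<Sum>i<N. T i (Suc j))" by (rule sum.swap)
  also have "\<dots> = (\<Sum>j<N. \<Sum>i<Suc N. T i (Suc j))" by (simp add: T2)
  also have "\<dots> = (\<Sum>j<Suc N. \<Sum>i<Suc N. T i j) - (\<Sum>i<Suc N. T i 0)"
    by (simp only: sum.lessThan_Suc_shift[of "\<lambda>j. \<Sum>i<Suc N. T i j"]) simp
  also have "(\<Sum>i<Suc N. T i 0) = poly p l" by (simp only: ev T_def) simp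
  also have "(\<Sum>j<Suc N. \<Sum>i<Suc N. T i j) = (\<Sum>i<Suc N. \<Sum>j<Suc N. T i j)" by (rule sum.swap)
  finally have 2: "m * (\<Sum>i<N. \<Sum>j<N. coeff p (i + j + 1) * l ^ i * m ^ j)
      = (\<Sum>i<Suc N. \<Sum>j<Suc N. T i j) - poly p l" .
  show ?thesis by (simp only: left_diff_distrib 1 2) simp
qed

lemma coord_bracket_antisym: "coord_bracket g z p q = - coord_bracket g z q p"
  by (cases p; cases q) (simp_all add: add.commute)

lemma bracket_antisym: "bracket g F G z = - bracket g G F z"
proof -
  have "bracket g F G z = (\<Sum>q\<in>coords g. \<Sum>p\<in>coords g.
     coord_bracket g z p q * coord_partial p F z * coord_partial q G z)"
    unfolding bracket_def by (rule sum.swap)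
  also have "\<dots> = (\<Sum>q\<in>coords g. \<Sum>p\<in>coords g.
     - (coord_bracket g z q p * coord_partial q G z * coord_partial p F z))"
    by (intro sum.cong refl, subst coord_bracket_antisym) (simp add: mult_ac)
  finally show ?thesis by (simp add: bracket_def sum_negf)
qed

lemma bracket_alpha_alpha: "bracket g (\<lambda>z. poly (alpha_poly g z) l) (\<lambda>z. poly (alpha_poly g z) m) z = 0"
  by (simp add: bracket_affine[OF poly_alpha poly_alpha] sum_coords)

lemma bracket_beta_beta: "bracket g (\<lambda>z. poly (beta_poly g z) l) (\<lambda>z. poly (beta_poly g z) m) z = 0"
  by (simp add: bracket_affine[OF poly_beta poly_beta] sum_coords)

lemma bracket_alpha_beta:
  assumes "l \<noteq> m"
  shows "bracket g (\<lambda>z. poly (alpha_poly g z) l) (\<lambda>z. poly (beta_poly g z) m) z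
    = (poly (beta_poly g z) l - poly (beta_poly g z) m) / (l - m)"
proof -
  let ?c = "coeff (beta_poly g z)"
  have "bracket g (\<lambda>z. poly (alpha_poly g z) l) (\<lambda>z. poly (beta_poly g z) m) z
     = (\<Sum>i=1..g. \<Sum>j=1..g. ?c ((g - i) + (g - j) + 1) * l ^ (g - i) * m ^ (g - j))"
    by (simp add: bracket_affine[OF poly_alpha poly_beta] sum_coords)
  also have "\<dots> = (\<Sum>i<g. \<Sum>j<g. ?c (i + j + 1) * l ^ i * m ^ j)"
    by (simp only: sum_flip[of "\<lambda>j. ?c (_ + j + 1) * _ * m ^ j"]
        sum_flip[of "\<lambda>i. \<Sum>j<g. ?c (i + j + 1) * l ^ i * m ^ j"])
  finally show ?thesis
    using divided_difference[of g "beta_poly g z" l m] assms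
    by (simp add: coeff_beta eq_divide_eq mult.commute)
qed

lemma bracket_beta_gamma:
  assumes "l \<noteq> m"
  shows "bracket g (\<lambda>z. poly (beta_poly g z) l) (\<lambda>z. poly (gamma_poly g z) m) z
    = 2 * ((poly (alpha_poly g z) l - poly (alpha_poly g z) m) / (l - m))"
proof -
  let ?c = "coeff (alpha_poly g z)"
  have "bracket g (\<lambda>z. poly (beta_poly g z) l) (\<lambda>z. poly (gamma_poly g z) m) z
     = (\<Sum>i=1..g. \<Sum>j=1..g + 1. 2 * ?c ((g - i) + (g + 1 - j) + 1) * l ^ (g - i) * m ^ (g + 1 - j))"
    by (simp only: bracket_affine[OF poly_beta poly_gamma] sum_coords) simp
  also have "\<dots> = (\<Sum>i<g. \<Sum>j<g + 1. 2 * ?c (i + j + 1) * l ^ i * m ^ j)"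
    by (simp only: sum_flip[of "\<lambda>j. 2 * ?c (_ + j + 1) * _ * m ^ j"]
        sum_flip[of "\<lambda>i. \<Sum>j<g + 1. 2 * ?c (i + j + 1) * l ^ i * m ^ j"])
  also have "\<dots> = 2 * (\<Sum>i<g. \<Sum>j<g. ?c (i + j + 1) * l ^ i * m ^ j)"
    by (simp add: coeff_alpha sum_distrib_left mult.assoc)
  also have "(\<Sum>i<g. \<Sum>j<g. ?c (i + j + 1) * l ^ i * m ^ j)
      = (poly (alpha_poly g z) l - poly (alpha_poly g z) m) / (l - m)"
    using divided_difference[of g "alpha_poly g z" l m] assms
    by (simp add: coeff_alpha eq_divide_eq mult.commute)
  finally show ?thesis .
qed

lemma bracket_alpha_gamma:
  assumes "l \<noteq> m"
  shows "bracket g (\<lambda>z. poly (alpha_poly g z) l) (\<lambda>z. poly (gamma_poly g z) m) z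
    = - ((poly (gamma_poly g z) l - poly (gamma_poly g z) m) / (l - m)) + poly (beta_poly g z) l"
proof -
  let ?c = "coeff (gamma_poly g z)" and ?b = "coeff (beta_poly g z)"
  let ?f = "\<lambda>i j. (- ?c (i + j + 1) + (if j = 0 then ?b i else 0)) * l ^ i * m ^ j"
  have "bracket g (\<lambda>z. poly (alpha_poly g z) l) (\<lambda>z. poly (gamma_poly g z) m) z
     = (\<Sum>i=1..g. \<Sum>j=1..g + 1. ?f (g - i) (g + 1 - j))"
    by (simp only: bracket_affine[OF poly_alpha poly_gamma] sum_coords) simp
  also have "\<dots> = (\<Sum>i<g. \<Sum>j<g + 1. ?f i j)"
    by (simp only: sum_flip[of "?f _"] sum_flip[of "\<lambda>i. \<Sum>j<g + 1. ?f i j"])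
  also have "\<dots> = (\<Sum>i<g + 1. \<Sum>j<g + 1. ?f i j)"
  proof -
    have "?f g j = 0" for j by (simp add: coeff_gamma coeff_beta)
    then have "(\<Sum>j<g + 1. ?f g j) = 0" by (rule sum.neutral[OF ballI])
    then show ?thesis by (simp only: Suc_eq_plus1[symmetric] sum.lessThan_Suc[of _ g] add_0_right)
  qed
  also have "\<dots> = - (\<Sum>i<g + 1. \<Sum>j<g + 1. ?c (i + j + 1) * l ^ i * m ^ j)
      + (\<Sum>i<g + 1. \<Sum>j<g + 1. if j = 0 then ?b i * l ^ i else 0)"
    unfolding sum_negf[symmetric] sum.distrib[symmetric]
    by (intro sum.cong refl) (simp add: algebra_simps)
  also have "(\<Sum>i<g + 1. \<Sum>j<g + 1. if j = 0 then ?b i * l ^ i else 0) = (\<Sum>i<g + 1. ?b i * l ^ i)"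
    by (simp del: sum.lessThan_Suc)
  also have "\<dots> = poly (beta_poly g z) l"
    by (rule poly_lessThan[symmetric]) (simp add: coeff_beta)
  also have "(\<Sum>i<g + 1. \<Sum>j<g + 1. ?c (i + j + 1) * l ^ i * m ^ j)
      = (poly (gamma_poly g z) l - poly (gamma_poly g z) m) / (l - m)"
    using divided_difference[of "g + 1" "gamma_poly g z" l m] assms
    by (simp add: coeff_gamma eq_divide_eq mult.commute del: sum.lessThan_Suc)
  finally show ?thesis .
qed

lemma bracket_gamma_gamma:
  "bracket g (\<lambda>z. poly (gamma_poly g z) l) (\<lambda>z. poly (gamma_poly g z) m) z
    = - 2 * poly (alpha_poly g z) l + 2 * poly (alpha_poly g z) m"
proof -
  let ?a = "coeff (alpha_poly g z)"
  let ?f = "\<lambda>i j. (- 2 * (if j = 0 then ?a i else 0) + 2 * (if i = 0 then ?a j else 0)) * l ^ i * m ^ j"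
  have "bracket g (\<lambda>z. poly (gamma_poly g z) l) (\<lambda>z. poly (gamma_poly g z) m) z
     = (\<Sum>i=1..g + 1. \<Sum>j=1..g + 1. ?f (g + 1 - i) (g + 1 - j))"
    by (simp only: bracket_affine[OF poly_gamma poly_gamma] sum_coords) simp
  also have "\<dots> = (\<Sum>i<g + 1. \<Sum>j<g + 1. ?f i j)"
    by (simp only: sum_flip[of "?f _"] sum_flip[of "\<lambda>i. \<Sum>j<g + 1. ?f i j"])
  also have "\<dots> = - 2 * (\<Sum>i<g + 1. \<Sum>j<g + 1. if j = 0 then ?a i * l ^ i else 0)
      + 2 * (\<Sum>i<g + 1. \<Sum>j<g + 1. if i = 0 then ?a j * m ^ j else 0)"
    unfolding sum_distrib_left sum.distrib[symmetric]
    by (intro sum.cong refl) (simp add: algebra_simps)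
  also have "(\<Sum>i<g + 1. \<Sum>j<g + 1. if j = 0 then ?a i * l ^ i else 0) = (\<Sum>i<g + 1. ?a i * l ^ i)"
    by (simp del: sum.lessThan_Suc)
  also have "(\<Sum>i<g + 1. \<Sum>j<g + 1. if i = 0 then ?a j * m ^ j else 0) = (\<Sum>j<g + 1. ?a j * m ^ j)"
    by (subst sum.swap) (simp del: sum.lessThan_Suc)
  also have "(\<Sum>i<g + 1. ?a i * l ^ i) = poly (alpha_poly g z) l"
    by (rule poly_lessThan[symmetric]) (simp add: coeff_alpha)
  also have "(\<Sum>i<g + 1. ?a i * m ^ i) = poly (alpha_poly g z) m"
    by (rule poly_lessThan[symmetric]) (simp add: coeff_alpha)
  finally show ?thesis .
qed

text \<open>The row index of a tensor product is the pair of the row indices of the factors.\<close>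

definition kron :: "'a::comm_ring_1 ^ 2 ^ 2 \<Rightarrow> 'a ^ 2 ^ 2 \<Rightarrow> 'a ^ (2 \<times> 2) ^ (2 \<times> 2)" where
  "kron A B = (\<chi> p q. A $ fst p $ fst q * B $ snd p $ snd q)"

definition E_unit :: "2 \<Rightarrow> 2 \<Rightarrow> 'a::comm_ring_1 ^ 2 ^ 2" where
  "E_unit a b = (\<chi> i j. if i = a \<and> j = b then 1 else 0)"

definition tensor_P :: "'a::comm_ring_1 ^ (2 \<times> 2) ^ (2 \<times> 2)" where
  "tensor_P = (\<Sum>a\<in>UNIV. \<Sum>b\<in>UNIV. kron (E_unit a b) (E_unit b a))"

definition tensor_bracket ::
  "nat \<Rightarrow> 'a::real_normed_field \<Rightarrow> 'a \<Rightarrow> 'a phase \<Rightarrow> 'a ^ (2 \<times> 2) ^ (2 \<times> 2)" where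
  "tensor_bracket g l m z =
     (\<chi> p q. bracket g (\<lambda>w. poly (phase_matrix g w $ fst p $ fst q) l)
                       (\<lambda>w. poly (phase_matrix g w $ snd p $ snd q) m) z)"


lemma bracket_alpha_neg:
  fixes G :: "'a::real_normed_field phase \<Rightarrow> 'a"
  shows "bracket g (\<lambda>z. - poly (alpha_poly g z) l) G z = - bracket g (\<lambda>z. poly (alpha_poly g z) l) G z"
    and "bracket g G (\<lambda>z. - poly (alpha_poly g z) l) z = - bracket g G (\<lambda>z. poly (alpha_poly g z) l) z"
proof -
  have cp: "coord_partial p (\<lambda>z. - poly (alpha_poly g z) l) z = - coord_partial p (\<lambda>z. poly (alpha_poly g z) l) z"
    if "p \<in> coords g" for p
    using coord_partial_affine[OF poly_alpha_neg that, of l z] coord_partial_affine[OF poly_alpha that, of l z]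
    by simp
  have "bracket g (\<lambda>z. - poly (alpha_poly g z) l) G z = (\<Sum>p\<in>coords g. \<Sum>q\<in>coords g.
     - (coord_bracket g z p q * coord_partial p (\<lambda>z. poly (alpha_poly g z) l) z * coord_partial q G z))"
    unfolding bracket_def by (intro sum.cong refl) (simp add: cp)
  then show *: "bracket g (\<lambda>z. - poly (alpha_poly g z) l) G z = - bracket g (\<lambda>z. poly (alpha_poly g z) l) G z"
    by (simp add: bracket_def sum_negf)
  show "bracket g G (\<lambda>z. - poly (alpha_poly g z) l) z = - bracket g G (\<lambda>z. poly (alpha_poly g z) l) z"
    using * bracket_antisym[of g G] by metis
qed

lemma sum_UNIV_22: "(\<Sum>p\<in>(UNIV :: (2 \<times> 2) set). f p) = f (1, 1) + f (1, 2) + f (2, 1) + f (2, 2)"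
  by (simp add: UNIV_Times_UNIV[symmetric] sum.cartesian_product[symmetric] UNIV_2
      del: UNIV_Times_UNIV) (simp add: add.assoc)

theorem bracket_r_matrix:
  fixes l m :: "'a::real_normed_field"
  assumes "l \<noteq> m"
  shows "tensor_bracket g l m z =
     commutator (kron (eval_mat (phase_matrix g z) l) (mat 1) + kron (mat 1) (eval_mat (phase_matrix g z) m))
       (\<chi> p q. tensor_P $ p $ q / (l - m))
     + commutator (kron (eval_mat (phase_matrix g z) l) (mat 1) - kron (mat 1) (eval_mat (phase_matrix g z) m))
         (kron (E_unit 2 1) (E_unit 2 1))"
    (is "?L = ?R")
proof -
  have ne: "l - m \<noteq> 0" "m - l \<noteq> 0" "m \<noteq> l" using assms by auto
  have ba: "bracket g (\<lambda>z. poly (beta_poly g z) l) (\<lambda>z. poly (alpha_poly g z) m) z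
      = - ((poly (beta_poly g z) l - poly (beta_poly g z) m) / (l - m))"
    by (subst bracket_antisym, subst bracket_alpha_beta[OF ne(3)]) (use ne in \<open>simp add: field_simps\<close>)
  have ca: "bracket g (\<lambda>z. poly (gamma_poly g z) l) (\<lambda>z. poly (alpha_poly g z) m) z
      = (poly (gamma_poly g z) l - poly (gamma_poly g z) m) / (l - m) - poly (beta_poly g z) m"
    by (subst bracket_antisym, subst bracket_alpha_gamma[OF ne(3)]) (use ne in \<open>simp add: field_simps\<close>)
  have cb: "bracket g (\<lambda>z. poly (gamma_poly g z) l) (\<lambda>z. poly (beta_poly g z) m) z
      = - (2 * ((poly (alpha_poly g z) l - poly (alpha_poly g z) m) / (l - m)))"
    by (subst bracket_antisym, subst bracket_beta_gamma[OF ne(3)]) (use ne in \<open>simp add: field_simps\<close>)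
  note br = bracket_alpha_alpha bracket_beta_beta bracket_gamma_gamma bracket_alpha_neg
    bracket_alpha_beta[OF assms] bracket_alpha_gamma[OF assms] bracket_beta_gamma[OF assms] ba ca cb
  have "\<forall>a b c d. tensor_P $ (a, b) $ (c, d) = (if a = d \<and> b = c then 1 else (0 :: 'a))"
    unfolding forall_2 tensor_P_def sum_2 by (simp add: kron_def E_unit_def)
  then have P: "tensor_P $ (a, b) $ (c, d) = (if a = d \<and> b = c then 1 else (0 :: 'a))" for a b c d
    by blast
  have ev: "eval_mat (phase_matrix g z) x $ 1 $ 1 = poly (alpha_poly g z) x"
    "eval_mat (phase_matrix g z) x $ 1 $ 2 = poly (beta_poly g z) x"
    "eval_mat (phase_matrix g z) x $ 2 $ 1 = poly (gamma_poly g z) x"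
    "eval_mat (phase_matrix g z) x $ 2 $ 2 = - poly (alpha_poly g z) x" for x
    by (simp_all add: eval_mat_def phase_matrix_def mat2_def)
  have R: "?R $ (a, b) $ (c, d) =
      (\<Sum>e\<in>UNIV. (kron (eval_mat (phase_matrix g z) l) (mat 1) + kron (mat 1) (eval_mat (phase_matrix g z) m)) $ (a, b) $ e
        * (tensor_P $ e $ (c, d) / (l - m)))
      - (\<Sum>e\<in>UNIV. tensor_P $ (a, b) $ e / (l - m) *
        (kron (eval_mat (phase_matrix g z) l) (mat 1) + kron (mat 1) (eval_mat (phase_matrix g z) m)) $ e $ (c, d))
      + (\<Sum>e\<in>UNIV. (kron (eval_mat (phase_matrix g z) l) (mat 1) - kron (mat 1) (eval_mat (phase_matrix g z) m)) $ (a, b) $ e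
        * kron (E_unit 2 1) (E_unit 2 1) $ e $ (c, d))
      - (\<Sum>e\<in>UNIV. kron (E_unit 2 1) (E_unit 2 1) $ (a, b) $ e
        * (kron (eval_mat (phase_matrix g z) l) (mat 1) - kron (mat 1) (eval_mat (phase_matrix g z) m)) $ e $ (c, d))"
    for a b c d
    by (simp add: commutator_def matrix_matrix_mult_def)
  have "\<forall>a b c d. ?L $ (a, b) $ (c, d) = ?R $ (a, b) $ (c, d)"
    unfolding R sum_UNIV_22 forall_2
    apply (simp add: P)
    apply (simp add: kron_def mat_def E_unit_def ev)
    apply (simp add: tensor_bracket_def phase_matrix_def mat2_def br)
    apply (simp add: diff_divide_distrib)
    done
  then show ?thesis by (simp add: vec_eq_iff split_paired_all)
qed


subsection \<open>The matrices attached to a function lie in the phase space\<close>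

lemma coeff_sum_monom: "coeff (\<Sum>k\<le>n. monom (f k) (n - k)) i = (if i \<le> n then f (n - i) else 0)"
proof -
  have "coeff (\<Sum>k\<le>n. monom (f k) (n - k)) i = (\<Sum>k\<le>n. if n - k = i then f k else 0)"
    by (simp add: coeff_sum)
  also have "\<dots> = (\<Sum>k\<in>{..n}. if k = n - i then (if i \<le> n then f (n - i) else 0) else 0)"
    by (rule sum.cong) auto
  finally show ?thesis by auto
qed

lemma PI_R_0: "PI_R ix u 0 = (\<lambda>_. 1)"
  by (rule ext) (simp add: PI_R_def dp_eval_def)

lemma partial_const: "partial i (\<lambda>_. c) = (\<lambda>_. 0)"
  by (rule ext) (simp add: partial_def)

lemma coeff_PI_B: "coeff (PI_B ix u n t) i = (if i \<le> n then PI_R ix u (n - i) t else 0)"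
  by (simp add: PI_B_def coeff_sum_monom)

lemma coeff_PI_A_eq_0: "i \<ge> n \<Longrightarrow> coeff (PI_A ix u n t) i = 0"
  by (auto simp: PI_A_def coeff_sum_monom PI_R_0 partial_const)

lemma coeff_PI_Gamma_top:
  "i \<ge> n + 1 \<Longrightarrow> coeff (PI_Gamma ix u n t) i = (if i = n + 1 then 1 else 0)"
  by (auto simp: PI_Gamma_def coeff_sum_monom coeff_PI_B PI_R_0 partial_const coeff_pCons split: nat.split)

theorem PI_V_in_phase_space:
  "phase_matrix g (phase_point g (PI_V g ix u t)) = PI_V g ix u t"
proof -
  let ?M = "PI_V g ix u t"
  have entries: "?M $ 1 $ 1 = (\<Sum>i\<le>g. smult (PI_c g ix i t) (PI_A ix u (g - i) t))"
    "?M $ 1 $ 2 = (\<Sum>i\<le>g. smult (PI_c g ix i t) (PI_B ix u (g - i) t))"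
    "?M $ 2 $ 1 = (\<Sum>i\<le>g. smult (PI_c g ix i t) (PI_Gamma ix u (g - i) t))"
    "?M $ 2 $ 2 = - ?M $ 1 $ 1"
    by (simp_all add: PI_V_def PI_U_def mat2_def sum_negf)
  have "coeff (?M $ 1 $ 1) i = 0" if "i \<ge> g" for i
    using that by (simp add: entries(1) coeff_sum coeff_PI_A_eq_0)
  then have 1: "alpha_poly g (phase_point g ?M) = ?M $ 1 $ 1"
    by (intro poly_eqI) (auto simp: coeff_alpha)
  have "coeff (?M $ 1 $ 2) i = (if i = g then 1 else 0)" if "i \<ge> g" for i
  proof -
    have "coeff (?M $ 1 $ 2) i = (\<Sum>k\<le>g. if k = 0 then (if i = g then 1 else 0) else 0)"
      unfolding entries(2) coeff_sum using that
      by (intro sum.cong) (auto simp: coeff_PI_B PI_R_0 PI_c_def)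
    then show ?thesis by simp
  qed
  then have 2: "beta_poly g (phase_point g ?M) = ?M $ 1 $ 2"
    by (intro poly_eqI) (auto simp: coeff_beta)
  have "coeff (?M $ 2 $ 1) i = (if i = g + 1 then 1 else 0)" if "i \<ge> g + 1" for i
  proof -
    have "coeff (?M $ 2 $ 1) i = (\<Sum>k\<le>g. if k = 0 then (if i = g + 1 then 1 else 0) else 0)"
      unfolding entries(3) coeff_sum using that
      by (intro sum.cong) (auto simp: coeff_PI_Gamma_top PI_c_def)
    then show ?thesis by simp
  qed
  then have 3: "gamma_poly g (phase_point g ?M) = ?M $ 2 $ 1"
    by (intro poly_eqI) (auto simp: coeff_gamma)
  show ?thesis
    by (simp add: phase_matrix_def 1 2 3 vec_eq_iff forall_2 mat2_def entries(4))
qed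

end

theory Submission
  imports Defs
begin

text \<open>
  Write \<open>z = 1/\<lambda>\<close>, \<open>R = \<Sum>R_n z^n\<close> and let \<open>K\<close> be the polarization of the quadratic first integral of
  \<open>R''' / 4 + (u - \<lambda>) R' + u_x R / 2 = 0\<close>. Since the square root of \<open>Q\<close> commutes with \<open>Q\<close>, the residues
  \<open>R_n\<close> satisfy the Lenard recursion, and as they have no constant terms, the first integral of \<open>R\<close> is
  the constant \<open>- \<lambda>\<close>. The map \<open>F \<mapsto> K(R, F)\<close> is injective on series by its leading coefficient, and the
  Wronskian \<open>R \<rho>' - R' \<rho>\<close> with a solution \<open>\<rho>\<close> of the inhomogeneous equation has an explicit image. Hence
  the flow of \<open>R\<close> is the Wronskian of \<open>R_n(\<lambda>)\<close> and \<open>R\<close>. For the part \<open>\<rho>\<close> of \<open>(\<Sum>c_i \<lambda>^(g-i)) R\<close> of negative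
  degree in \<open>\<lambda>\<close>, the \<open>x\<close>-derivative of the string equation gives the Wronskian \<open>dR/d\<lambda> - R/(2\<lambda>)\<close> modulo
  the differential ideal of the given solution; this is the term \<open>U_n'\<close> of the Lax equation.

  For the Hamiltonian form, \<open>{V(\<lambda>), h(\<mu>)} = [V(\<mu>) / (\<mu> - \<lambda>) - \<beta>(\<mu>) E_21, V(\<lambda>)]\<close>. The coefficient of
  \<open>\<mu>^(g-n-1)\<close> on the right is \<open>[U_n + c_1 U_(n-1) + \<dots> + c_n U_0, V]\<close>, so that the triangular system for
  the \<open>H_k\<close> yields \<open>[U_n, V]\<close>.
\<close>

section \<open>The algebra of differential polynomials\<close>

text \<open>Two obstacles shape the proof. The variation of R under a flow and the truncations of R
  satisfy third-order linear equations, and such an equation fixes a series only up to multiples of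
  R by constant series. The quadratic first integral carries no such ambiguity, which is why
  identities are compared through K(R, _) instead of being integrated. Secondly, the string equation
  holds on the solution and is no identity between differential polynomials. The algebra is
  therefore run modulo an ideal closed under d/dx: the zero ideal for universal identities and, at
  each point t, the ideal of polynomials that vanish there with all their x-derivatives. The times
  inside the c_i stay frozen during that algebra. The explicit derivative of c_(g+1-n) in t_(2n+1),
  which is (2n+1)/2, later cancels the term that arises when d/d\<lambda> is moved past \<lambda>^n.
  The H_k enter as arbitrary functions subject to the triangular system, with no smoothness assumed;
  their differentiability comes out of the same induction as their brackets.\<close>

lemma dp_const_simps [simp]:
  "dp_const 0 = 0" "dp_const 1 = 1"
  by (simp_all add: dp_const_def)

lemma dp_const_add: "dp_const (a + b) = dp_const a + dp_const b"
  by (simp add: dp_const_def single_add)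

lemma dp_const_mult: "dp_const (a * b) = dp_const a * dp_const b"
  by (simp add: dp_const_def mult_single)

lemma dp_const_uminus: "dp_const (- a) = - dp_const a"
  by (simp add: dp_const_def single_uminus)

lemma dp_const_of_nat: "dp_const (of_nat n) = of_nat n"
  by (simp add: dp_const_def)

lemma dp_const_numeral: "dp_const (numeral n) = numeral n"
  by (simp add: dp_const_def)

lemma poly_mapping_induct_single [case_names zero single add]:
  assumes "P 0" and "\<And>k c. P (Poly_Mapping.single k c)"
    and "\<And>p q. P p \<Longrightarrow> P q \<Longrightarrow> P (p + q)"
  shows "P (p :: 'k \<Rightarrow>\<^sub>0 'b::comm_monoid_add)"
proof (induction p rule: update_induct)
  case (update p a b)
  have "Poly_Mapping.update a b p = p + Poly_Mapping.single a b"
    using update(1) by (intro poly_mapping_eqI)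
      (auto simp: lookup_update lookup_add lookup_single when_def in_keys_iff)
  then show ?case using update assms by simp
qed (rule assms)

lemma single_eq_dp_const_mult:
  "Poly_Mapping.single m c = dp_const c * Poly_Mapping.single m 1"
  by (simp add: dp_const_def mult_single)

lemma single_single_eq_dp_u_power:
  "Poly_Mapping.single (Poly_Mapping.single k n) 1 = (dp_u k ^ n :: 'a::comm_ring_1 dpoly)"
proof (induction n)
  case (Suc n)
  have "Poly_Mapping.single (Poly_Mapping.single k (Suc n)) 1 =
      Poly_Mapping.single (Poly_Mapping.single k 1) 1 * (Poly_Mapping.single (Poly_Mapping.single k n) 1 :: 'a dpoly)"
    by (simp add: mult_single single_add[symmetric])
  with Suc show ?case by (simp add: dp_u_def)
qed simp

text \<open>Constants and indeterminates generate the ring, so a property stable under sums and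
  products need only be checked on them. Commutation of derivations and the chain rule along a jet
  are proved this way.\<close>

lemma dpoly_induct [case_names const u add mult]:
  fixes p :: "'a::comm_ring_1 dpoly"
  assumes const: "\<And>c. P (dp_const c)" and u: "\<And>k. P (dp_u k)"
    and add: "\<And>p q. P p \<Longrightarrow> P q \<Longrightarrow> P (p + q)" and mult: "\<And>p q. P p \<Longrightarrow> P q \<Longrightarrow> P (p * q)"
  shows "P p"
proof -
  have pow: "P (dp_u k ^ n)" for k n
    by (induction n) (use const[of 1] mult u in auto)
  have mono: "P (Poly_Mapping.single m 1)" for m
  proof (induction m rule: poly_mapping_induct_single)
    case zero
    then show ?case using const[of 1] by (simp add: dp_const_def)
  next
    case (single k c)
    then show ?case by (simp add: single_single_eq_dp_u_power pow)
  next
    case (add m m')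
    then show ?case using mult[OF add] by (simp add: mult_single)
  qed
  show ?thesis
  proof (induction p rule: poly_mapping_induct_single)
    case zero
    then show ?case using const[of 0] by simp
  next
    case (single m c)
    then show ?case by (subst single_eq_dp_const_mult) (intro mult const mono)
  qed (rule add)
qed

lemma dp_eval_superset:
  assumes "finite A" "Poly_Mapping.keys p \<subseteq> A"
  shows "dp_eval v p = (\<Sum>m\<in>A. Poly_Mapping.lookup p m *
        (\<Prod>k\<in>Poly_Mapping.keys m. v k ^ Poly_Mapping.lookup m k))"
  unfolding dp_eval_def using assms
  by (intro sum.mono_neutral_left) (auto simp: in_keys_iff)

lemma dp_eval_add: "dp_eval v (p + q) = dp_eval v p + dp_eval v q"
  using Poly_Mapping.keys_add[of p q]
  by (simp add: dp_eval_superset[of "Poly_Mapping.keys p \<union> Poly_Mapping.keys q"]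
      lookup_add distrib_right sum.distrib)

lemma dp_eval_single: "dp_eval v (Poly_Mapping.single m c) =
    c * (\<Prod>k\<in>Poly_Mapping.keys m. v k ^ Poly_Mapping.lookup m k)"
  by (simp add: dp_eval_superset[of "{m}"])

lemma dp_eval_mult: "dp_eval v (p * q) = dp_eval v p * dp_eval v q"
proof (induction p rule: poly_mapping_induct_single)
  case zero
  show ?case by (simp add: dp_eval_def)
next
  case (add p p')
  then show ?case by (simp add: distrib_right dp_eval_add)
next
  case (single m c)
  show ?case
  proof (induction q rule: poly_mapping_induct_single)
    case zero
    show ?case by (simp add: dp_eval_def)
  next
    case (add p p')
    then show ?case by (simp add: distrib_left dp_eval_add)
  next
    case (single m' c')
    let ?K = "Poly_Mapping.keys m \<union> Poly_Mapping.keys m'"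
    have ext: "(\<Prod>k\<in>Poly_Mapping.keys n. v k ^ Poly_Mapping.lookup n k)
        = (\<Prod>k\<in>?K. v k ^ Poly_Mapping.lookup n k)" if "Poly_Mapping.keys n \<subseteq> ?K" for n
      using that by (intro prod.mono_neutral_left) (auto simp: in_keys_iff)
    show ?case
      unfolding mult_single dp_eval_single
        ext[OF Poly_Mapping.keys_add] ext[OF Un_upper1] ext[OF Un_upper2]
      by (simp add: lookup_add power_add prod.distrib mult_ac)
  qed
qed

lemma dp_eval_const [simp]: "dp_eval v (dp_const c) = c"
  by (simp add: dp_const_def dp_eval_single)

lemma dp_eval_u [simp]: "dp_eval v (dp_u k) = v k"
  by (simp add: dp_u_def dp_eval_single)

lemma dp_eval_0 [simp]: "dp_eval v 0 = 0" and dp_eval_1 [simp]: "dp_eval v 1 = 1"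
  using dp_eval_const[of v 0] dp_eval_const[of v 1] by (simp_all del: dp_eval_const)

lemma dp_eval_uminus: "dp_eval v (- p) = - dp_eval v p"
  using dp_eval_add[of v p "- p"] by (simp add: eq_neg_iff_add_eq_0 add.commute)

lemma dp_eval_diff: "dp_eval v (p - q) = dp_eval v p - dp_eval v q"
  using dp_eval_add[of v p "- q"] by (simp add: dp_eval_uminus)

lemma dp_eval_sum: "dp_eval v (\<Sum>i\<in>A. f i) = (\<Sum>i\<in>A. dp_eval v (f i))"
  by (induction A rule: infinite_finite_induct) (simp_all add: dp_eval_add)


subsection \<open>Derivations\<close>

text \<open>The derivation sending \<open>dp_u k\<close> to \<open>w k\<close>, kept general because
  both d/dx (\<open>w k = dp_u (Suc k)\<close>) and the time flows
  (\<open>w = flow_weight n\<close>) are instances.\<close>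

definition dp_der :: "(nat \<Rightarrow> 'a dpoly) \<Rightarrow> 'a::comm_ring_1 dpoly \<Rightarrow> 'a dpoly" where
  "dp_der w p = (\<Sum>m\<in>Poly_Mapping.keys p. \<Sum>k\<in>Poly_Mapping.keys m.
     Poly_Mapping.single (m - Poly_Mapping.single k 1)
       (Poly_Mapping.lookup p m * of_nat (Poly_Mapping.lookup m k)) * w k)"

lemma dp_deriv_eq_dp_der: "dp_deriv = dp_der (\<lambda>k. dp_u (Suc k))"
  by (simp add: fun_eq_iff dp_deriv_def dp_der_def dp_u_def mult_single)

lemma dp_der_superset:
  assumes "finite A" "Poly_Mapping.keys p \<subseteq> A"
  shows "dp_der w p = (\<Sum>m\<in>A. \<Sum>k\<in>Poly_Mapping.keys m.
     Poly_Mapping.single (m - Poly_Mapping.single k 1)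
       (Poly_Mapping.lookup p m * of_nat (Poly_Mapping.lookup m k)) * w k)"
  unfolding dp_der_def using assms
  by (intro sum.mono_neutral_left) (auto simp: in_keys_iff)

lemma dp_der_add: "dp_der w (p + q) = dp_der w p + dp_der w q"
  using Poly_Mapping.keys_add[of p q]
  by (simp add: dp_der_superset[of "Poly_Mapping.keys p \<union> Poly_Mapping.keys q"]
      lookup_add distrib_right sum.distrib single_add)

lemma dp_der_single: "dp_der w (Poly_Mapping.single m c) = (\<Sum>k\<in>Poly_Mapping.keys m.
     Poly_Mapping.single (m - Poly_Mapping.single k 1) (c * of_nat (Poly_Mapping.lookup m k)) * w k)"
  by (simp add: dp_der_superset[of "{m}"])

lemma dp_der_single_superset:
  assumes "finite K" "Poly_Mapping.keys m \<subseteq> K"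
  shows "dp_der w (Poly_Mapping.single m c) = (\<Sum>k\<in>K.
     Poly_Mapping.single (m - Poly_Mapping.single k 1) (c * of_nat (Poly_Mapping.lookup m k)) * w k)"
  unfolding dp_der_single using assms
  by (intro sum.mono_neutral_left) (auto simp: in_keys_iff)

text \<open>Subtraction of exponents is truncated, so shifting by \<open>m'\<close> may fail when
  \<open>k\<close> does not occur in \<open>m\<close>; there the coefficient is 0 and both sides
  vanish.\<close>

lemma single_minus_add:
  fixes m m' :: "nat \<Rightarrow>\<^sub>0 nat"
  shows "Poly_Mapping.single (m + m' - Poly_Mapping.single k 1) (c * of_nat (Poly_Mapping.lookup m k))
    = Poly_Mapping.single m' 1 *
      (Poly_Mapping.single (m - Poly_Mapping.single k 1) (c * of_nat (Poly_Mapping.lookup m k)) :: 'a::comm_ring_1 dpoly)"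
proof (cases "Poly_Mapping.lookup m k = 0")
  case False
  then have "m + m' - Poly_Mapping.single k 1 = m' + (m - Poly_Mapping.single k 1)"
    by (intro poly_mapping_eqI) (auto simp: lookup_add lookup_minus lookup_single when_def)
  then show ?thesis by (simp add: mult_single)
qed simp

lemma dp_der_mult: "dp_der w (p * q) = dp_der w p * q + p * dp_der w q"
proof (induction p rule: poly_mapping_induct_single)
  case zero
  show ?case by (simp add: dp_der_def)
next
  case (add p p')
  then show ?case by (simp add: algebra_simps dp_der_add)
next
  case (single m c)
  show ?case
  proof (induction q rule: poly_mapping_induct_single)
    case zero
    show ?case by (simp add: dp_der_def)
  next
    case (add p p')
    then show ?case by (simp add: algebra_simps dp_der_add)
  next
    case (single m' c')
    let ?K = "Poly_Mapping.keys m \<union> Poly_Mapping.keys m'"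
    let ?e = "\<lambda>k. Poly_Mapping.single k 1 :: nat \<Rightarrow>\<^sub>0 nat"
    let ?l = "Poly_Mapping.lookup" and ?s = "Poly_Mapping.single :: _ \<Rightarrow> _ \<Rightarrow> 'a dpoly"
    have *: "?s (m + m' - ?e k) (c * c' * of_nat (?l (m + m') k)) =
        ?s (m - ?e k) (c * of_nat (?l m k)) * ?s m' c' + ?s m c * ?s (m' - ?e k) (c' * of_nat (?l m' k))" for k
    proof -
      have "?s (m + m' - ?e k) (c * c' * of_nat (?l (m + m') k)) =
         ?s (m + m' - ?e k) ((c' * c) * of_nat (?l m k)) + ?s (m' + m - ?e k) ((c * c') * of_nat (?l m' k))"
        by (simp add: lookup_add distrib_left single_add add.commute mult.commute)
      also have "\<dots> = ?s m' 1 * ?s (m - ?e k) ((c' * c) * of_nat (?l m k))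
          + ?s m 1 * ?s (m' - ?e k) ((c * c') * of_nat (?l m' k))"
        by (simp only: single_minus_add)
      also have "\<dots> = ?s (m - ?e k) (c * of_nat (?l m k)) * ?s m' c' + ?s m c * ?s (m' - ?e k) (c' * of_nat (?l m' k))"
        by (simp add: mult_single add.commute mult_ac)
      finally show ?thesis .
    qed
    have "dp_der w (?s m c * ?s m' c') = (\<Sum>k\<in>?K. ?s (m + m' - ?e k) (c * c' * of_nat (?l (m + m') k)) * w k)"
      unfolding mult_single using Poly_Mapping.keys_add[of m m']
      by (intro dp_der_single_superset) auto
    also have "\<dots> = (\<Sum>k\<in>?K. ?s (m - ?e k) (c * of_nat (?l m k)) * w k) * ?s m' c'
         + ?s m c * (\<Sum>k\<in>?K. ?s (m' - ?e k) (c' * of_nat (?l m' k)) * w k)"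
      unfolding * by (simp add: algebra_simps sum.distrib sum_distrib_left)
    also have "\<dots> = dp_der w (?s m c) * ?s m' c' + ?s m c * dp_der w (?s m' c')"
      by (subst (1 2) dp_der_single_superset[of ?K]) auto
    finally show ?case .
  qed
qed

lemma dp_der_const [simp]: "dp_der w (dp_const c) = 0"
  by (simp add: dp_const_def dp_der_single)

lemma dp_der_u [simp]: "dp_der w (dp_u k) = w k"
  by (simp add: dp_u_def dp_der_single)

lemma dp_der_0 [simp]: "dp_der w 0 = 0" and dp_der_1 [simp]: "dp_der w 1 = 0"
  using dp_der_const[of w 0] dp_der_const[of w 1] by (simp_all del: dp_der_const)

lemma dp_der_uminus: "dp_der w (- p) = - dp_der w p"
  using dp_der_add[of w p "- p"] by (simp add: eq_neg_iff_add_eq_0 add.commute)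

lemma dp_der_diff: "dp_der w (p - q) = dp_der w p - dp_der w q"
  using dp_der_add[of w p "- q"] by (simp add: dp_der_uminus)

lemma dp_der_sum: "dp_der w (\<Sum>i\<in>A. f i) = (\<Sum>i\<in>A. dp_der w (f i))"
  by (induction A rule: infinite_finite_induct) (simp_all add: dp_der_add)

lemma dp_der_const_mult: "dp_der w (dp_const c * p) = dp_const c * dp_der w p"
  by (simp add: dp_der_mult)

lemmas dp_deriv_simps =
  dp_der_const[of "\<lambda>k. dp_u (Suc k)", folded dp_deriv_eq_dp_der]
  dp_der_u[of "\<lambda>k. dp_u (Suc k)", folded dp_deriv_eq_dp_der]
  dp_der_0[of "\<lambda>k. dp_u (Suc k)", folded dp_deriv_eq_dp_der]
  dp_der_1[of "\<lambda>k. dp_u (Suc k)", folded dp_deriv_eq_dp_der]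
declare dp_deriv_simps [simp]

lemmas dp_deriv_mult = dp_der_mult[of "\<lambda>k. dp_u (Suc k)", folded dp_deriv_eq_dp_der]
lemmas dp_deriv_add = dp_der_add[of "\<lambda>k. dp_u (Suc k)", folded dp_deriv_eq_dp_der]
lemmas dp_deriv_sum = dp_der_sum[of "\<lambda>k. dp_u (Suc k)", folded dp_deriv_eq_dp_der]
lemmas dp_deriv_const_mult = dp_der_const_mult[of "\<lambda>k. dp_u (Suc k)", folded dp_deriv_eq_dp_der]

text \<open>These are the evolutionary derivations: the value on u^(k+1) is the x-derivative of the
  value on u^(k), so both orders agree on the generators.\<close>

lemma dp_der_commute:
  assumes "\<And>k. w (Suc k) = dp_deriv (w k)"
  shows "dp_der w (dp_deriv p) = dp_deriv (dp_der w p)"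
proof (induction p rule: dpoly_induct)
  case (mult p q)
  then show ?case by (simp add: dp_deriv_mult dp_der_mult dp_deriv_add dp_der_add algebra_simps)
qed (simp_all add: assms dp_deriv_add dp_der_add)

lemma funpow_dp_deriv_add: "(dp_deriv ^^ k) (p + q) = (dp_deriv ^^ k) p + (dp_deriv ^^ k) q"
  by (induction k) (simp_all add: dp_deriv_add)

lemma funpow_dp_deriv_0 [simp]: "(dp_deriv ^^ k) 0 = 0"
  by (induction k) simp_all

lemma funpow_dp_deriv_1: "(dp_deriv ^^ k) 1 = (if k = 0 then 1 else 0)"
  by (induction k) simp_all

lemma funpow_dp_deriv_sum: "(dp_deriv ^^ k) (\<Sum>i\<in>A. f i) = (\<Sum>i\<in>A. (dp_deriv ^^ k) (f i))"
  by (induction A rule: infinite_finite_induct) (simp_all add: funpow_dp_deriv_add)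

lemma funpow_dp_deriv_const_mult:
  "(dp_deriv ^^ k) (dp_const c * p) = dp_const c * (dp_deriv ^^ k) p"
  by (induction k) (simp_all add: dp_deriv_const_mult)

lemma funpow_dp_deriv_mult:
  "(dp_deriv ^^ n) (p * q) = (\<Sum>k\<le>n. of_nat (n choose k) * ((dp_deriv ^^ k) p * (dp_deriv ^^ (n - k)) q))"
proof (induction n)
  case (Suc n)
  let ?t = "\<lambda>i j. (dp_deriv ^^ i) p * (dp_deriv ^^ j) q"
  have d: "dp_deriv (of_nat m * r) = of_nat m * dp_deriv r" for m and r :: "'a dpoly"
    by (simp add: dp_const_of_nat[symmetric] dp_deriv_const_mult)
  have "(dp_deriv ^^ Suc n) (p * q) =
      (\<Sum>k\<le>n. of_nat (n choose k) * ?t (Suc k) (n - k)) + (\<Sum>k\<le>n. of_nat (n choose k) * ?t k (Suc n - k))"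
    by (simp add: Suc dp_deriv_sum d dp_deriv_mult[of "_ p"] distrib_left sum.distrib Suc_diff_le)
  \<comment> \<open>The missing term at k = 0 is padded with coefficient 0, so that Pascal's rule
    can be applied term by term.\<close>
  also have "(\<Sum>k\<le>n. of_nat (n choose k) * ?t (Suc k) (n - k)) =
      (\<Sum>k\<le>Suc n. of_nat (case k of 0 \<Rightarrow> 0 | Suc j \<Rightarrow> n choose j) * ?t k (Suc n - k))"
    by (subst sum.atMost_Suc_shift) simp
  also have "(\<Sum>k\<le>n. of_nat (n choose k) * ?t k (Suc n - k)) =
      (\<Sum>k\<le>Suc n. of_nat (n choose k) * ?t k (Suc n - k))"
    by (simp add: binomial_eq_0)
  also have "(\<Sum>k\<le>Suc n. of_nat (case k of 0 \<Rightarrow> 0 | Suc j \<Rightarrow> n choose j) * ?t k (Suc n - k)) + \<dots>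
      = (\<Sum>k\<le>Suc n. of_nat (Suc n choose k) * ?t k (Suc n - k))"
    unfolding sum.distrib[symmetric] distrib_right[symmetric] of_nat_add[symmetric]
    by (intro sum.cong refl arg_cong2[of _ _ _ _ times] arg_cong[of _ _ of_nat])
      (auto split: nat.split)
  finally show ?case .
qed simp


subsection \<open>The kernel of the derivation\<close>

text \<open>No index above \<open>k\<close> occurs in \<open>p\<close>. The shifted monomial
  contains u^(k+1), which only the differentiation of a factor u^(k) can create, so no other term of
  \<open>p\<close> contributes to its coefficient.\<close>

lemma lookup_dp_deriv_top:
  fixes p :: "'a::comm_ring_1 dpoly"
  assumes K: "\<And>m j. m \<in> Poly_Mapping.keys p \<Longrightarrow> k < j \<Longrightarrow> Poly_Mapping.lookup m j = 0"
    and m: "Poly_Mapping.lookup m k \<noteq> 0" "\<And>j. k < j \<Longrightarrow> Poly_Mapping.lookup m j = 0"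
  shows "Poly_Mapping.lookup (dp_deriv p) (m - Poly_Mapping.single k 1 + Poly_Mapping.single (Suc k) 1)
    = Poly_Mapping.lookup p m * of_nat (Poly_Mapping.lookup m k)"
proof -
  let ?sh = "\<lambda>m k. m - Poly_Mapping.single k 1 + Poly_Mapping.single (Suc k) 1 :: nat \<Rightarrow>\<^sub>0 nat"
  let ?l = "Poly_Mapping.lookup"
  have inj: "m' = m \<and> j = k" if m': "m' \<in> Poly_Mapping.keys p" "j \<in> Poly_Mapping.keys m'" and eq: "?sh m' j = ?sh m k" for m' j
  proof -
    have jk: "j \<le> k" using m' K[of m' j] by (metis in_keys_iff not_le)
    have e: "?l (?sh m' j) i = ?l (?sh m k) i" for i by (simp only: eq)
    have "j = k"
      using e[of "Suc k"] m(2)[of "Suc k"] K[OF m'(1), of "Suc k"] jk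
      by (auto simp: lookup_add lookup_minus lookup_single when_def split: if_splits)
    have "?l m' i = ?l m i" for i
      using e[of i] m(1) m'(2) \<open>j = k\<close>
      by (auto simp: lookup_add lookup_minus lookup_single when_def in_keys_iff split: if_splits)
    then show ?thesis using \<open>j = k\<close> by (auto intro: poly_mapping_eqI)
  qed
  have "?l (dp_deriv p) (?sh m k) = (\<Sum>m'\<in>Poly_Mapping.keys p. \<Sum>j\<in>Poly_Mapping.keys m'.
      if m' = m \<and> j = k then ?l p m * of_nat (?l m k) else 0)"
    unfolding dp_deriv_def lookup_sum
    by (intro sum.cong refl) (auto simp: lookup_single when_def dest: inj)
  also have "\<dots> = (\<Sum>m'\<in>Poly_Mapping.keys p. if m' = m then ?l p m * of_nat (?l m k) else 0)"
    using m(1) by (intro sum.cong refl) (auto simp: sum.delta' in_keys_iff)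
  also have "\<dots> = ?l p m * of_nat (?l m k)"
    by (auto simp: in_keys_iff)
  finally show ?thesis .
qed

text \<open>If some indeterminate occurred, take the highest index: the corresponding monomial of
  the derivative keeps a nonzero coefficient, since the multiplicity is nonzero in characteristic 0.
  The remaining constant is read off at u = 0.\<close>

lemma dp_deriv_eq_0D:
  fixes p :: "'a::field_char_0 dpoly"
  assumes "dp_deriv p = 0"
  shows "p = dp_const (dp_eval (\<lambda>_. 0) p)"
proof -
  define A where "A = (\<Union>m\<in>Poly_Mapping.keys p. Poly_Mapping.keys m)"
  have A: "finite A" by (simp add: A_def)
  have "A = {}"
  proof (rule ccontr)
    assume ne: "A \<noteq> {}"
    define k where "k = Max A"
    have "k \<in> A" using A ne by (simp add: k_def)
    then obtain m where m: "m \<in> Poly_Mapping.keys p" "k \<in> Poly_Mapping.keys m" by (auto simp: A_def)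
    have top: "Poly_Mapping.lookup m' j = 0" if "m' \<in> Poly_Mapping.keys p" "k < j" for m' j
    proof (rule ccontr)
      assume "Poly_Mapping.lookup m' j \<noteq> 0"
      then have "j \<in> A" using that by (auto simp: A_def in_keys_iff)
      then show False using Max_ge[OF A, of j] that by (simp add: k_def)
    qed
    have "Poly_Mapping.lookup p m * of_nat (Poly_Mapping.lookup m k) = 0"
      using lookup_dp_deriv_top[of p k m] top m assms by (simp add: in_keys_iff)
    then show False using m by (simp add: in_keys_iff)
  qed
  then have keys: "Poly_Mapping.keys p \<subseteq> {0}" by (auto simp: A_def)
  have "p = dp_const (Poly_Mapping.lookup p 0)"
  proof (rule poly_mapping_eqI)
    fix m show "Poly_Mapping.lookup p m = Poly_Mapping.lookup (dp_const (Poly_Mapping.lookup p 0)) m"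
      using keys by (cases "m = 0") (auto simp: dp_const_def lookup_single in_keys_iff)
  qed
  then show ?thesis by (metis dp_eval_const)
qed

lemma dp_eval_0_deriv: "dp_eval (\<lambda>_. 0) (dp_deriv p) = 0"
  by (induction p rule: dpoly_induct) (simp_all add: dp_deriv_add dp_deriv_mult dp_eval_add dp_eval_mult)

lemma dp_eval_0_funpow_deriv: "m \<noteq> 0 \<Longrightarrow> dp_eval (\<lambda>_. 0) ((dp_deriv ^^ m) p) = 0"
  by (cases m) (simp_all add: dp_eval_0_deriv)

section \<open>Pseudo-differential operators of bounded order\<close>

definition pdo_bounded :: "int \<Rightarrow> 'a::field_char_0 pdo \<Rightarrow> bool" where
  "pdo_bounded N A \<longleftrightarrow> (\<forall>k>N. A k = 0)"

text \<open>Counting down from the leading orders turns the index set of the product into a triangle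
  of naturals, finite for each \<open>c\<close> and open to induction on \<open>c\<close>.\<close>

lemma pdo_mult_nth:
  fixes A B :: "'a::field_char_0 pdo"
  assumes A: "pdo_bounded N A" and B: "pdo_bounded M B"
  shows "pdo_mult A B (N + M - int c) = (\<Sum>a\<le>c. \<Sum>b\<le>c - a.
    dp_const (of_int (N - int a) gchoose (c - a - b)) * A (N - int a) * (dp_deriv ^^ (c - a - b)) (B (M - int b)))"
proof -
  let ?n = "N + M - int c"
  let ?T = "\<lambda>i j. dp_const ((of_int i :: 'a) gchoose nat (i + j - ?n)) * A i * (dp_deriv ^^ nat (i + j - ?n)) (B j)"
  let ?f = "\<lambda>(a, b). (N - int a, M - int b)"
  let ?I = "SIGMA a:{..c}. {..c - a}"
  have sub: "{(i, j). A i \<noteq> 0 \<and> B j \<noteq> 0 \<and> ?n \<le> i + j} \<subseteq> ?f ` ?I"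
  proof safe
    fix i j assume ij: "A i \<noteq> 0" "B j \<noteq> 0" "?n \<le> i + j"
    have "i \<le> N" "j \<le> M" using ij A B by (meson not_le pdo_bounded_def)+
    then have "(i, j) = ?f (nat (N - i), nat (M - j))" "(nat (N - i), nat (M - j)) \<in> ?I"
      using ij(3) by auto
    then show "(i, j) \<in> ?f ` ?I" by blast
  qed
  have "pdo_mult A B ?n = (\<Sum>(i, j)\<in>?f ` ?I. ?T i j)"
    unfolding pdo_mult_def
    by (rule sum.mono_neutral_left[OF _ sub]) auto
  also have "\<dots> = (\<Sum>(a, b)\<in>?I. ?T (N - int a) (M - int b))"
    by (subst sum.reindex) (auto simp: inj_on_def intro!: sum.cong)
  also have "\<dots> = (\<Sum>a\<le>c. \<Sum>b\<le>c - a. ?T (N - int a) (M - int b))"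
    by (subst sum.Sigma) auto
  also have "\<dots> = (\<Sum>a\<le>c. \<Sum>b\<le>c - a.
    dp_const (of_int (N - int a) gchoose (c - a - b)) * A (N - int a) * (dp_deriv ^^ (c - a - b)) (B (M - int b)))"
  proof (intro sum.cong refl)
    fix a b assume "a \<in> {..c}" "b \<in> {..c - a}"
    then have "nat (N - int a + (M - int b) - ?n) = c - a - b" by auto
    then show "?T (N - int a) (M - int b) = dp_const (of_int (N - int a) gchoose (c - a - b)) * A (N - int a) *
        (dp_deriv ^^ (c - a - b)) (B (M - int b))" by simp
  qed
  finally show ?thesis .
qed

lemma pdo_bounded_mult:
  assumes A: "pdo_bounded N A" and B: "pdo_bounded M B"
  shows "pdo_bounded (N + M) (pdo_mult A B)"
  unfolding pdo_bounded_def
proof safe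
  fix k assume k: "N + M < k"
  have "{(i, j). A i \<noteq> 0 \<and> B j \<noteq> 0 \<and> k \<le> i + j} = {}"
  proof safe
    fix i j assume ij: "A i \<noteq> 0" "B j \<noteq> 0" "k \<le> i + j"
    have "i \<le> N" "j \<le> M" using ij A B by (meson not_le pdo_bounded_def)+
    then show "(i, j) \<in> {}" using ij(3) k by simp
  qed
  then show "pdo_mult A B k = 0" by (simp only: pdo_mult_def sum.empty)
qed

lemma pdo_eqI:
  assumes "pdo_bounded N A" "pdo_bounded N B" "\<And>c. A (N - int c) = B (N - int c)"
  shows "A = B"
proof
  fix k show "A k = B k"
    using assms(1,2) assms(3)[of "nat (N - k)"] by (cases "k \<le> N") (auto simp: pdo_bounded_def)
qed

text \<open>The coefficient identity behind associativity. Of the derivatives, \<open>p\<close> fall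
  on the middle operator and \<open>q\<close> on the right one; \<open>v\<close> of the latter come
  from the left operator, the others from the middle one. It is trinomial revision followed by
  Vandermonde's convolution.\<close>

lemma gbinomial_convolution_revision:
  fixes x y :: "'a::field_char_0"
  shows "(\<Sum>v\<le>q. (x gchoose (p + v)) * of_nat ((p + v) choose p) * (y gchoose (q - v)))
    = (x gchoose p) * (x + y - of_nat p gchoose q)"
proof -
  have "(\<Sum>v\<le>q. (x gchoose (p + v)) * of_nat ((p + v) choose p) * (y gchoose (q - v)))
      = (x gchoose p) * (\<Sum>v\<in>{0..q}. (x - of_nat p gchoose v) * (y gchoose (q - v)))"
    unfolding sum_distrib_left atLeast0AtMost
  proof (intro sum.cong refl)
    fix v
    have "(x gchoose (p + v)) * of_nat ((p + v) choose p) = (x gchoose p) * (x - of_nat p gchoose v)"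
      using gbinomial_trinomial_revision[of p "p + v" x] by (simp add: binomial_gbinomial)
    then show "(x gchoose (p + v)) * of_nat ((p + v) choose p) * (y gchoose (q - v))
        = (x gchoose p) * ((x - of_nat p gchoose v) * (y gchoose (q - v)))" by (simp add: mult.assoc)
  qed
  also have "\<dots> = (x gchoose p) * (x - of_nat p + y gchoose q)" by (simp only: gbinomial_Vandermonde)
  finally show ?thesis by (simp add: algebra_simps)
qed

lemma funpow_funpow: "(f ^^ m) ((f ^^ n) x) = (f ^^ (m + n)) x"
  by (simp add: funpow_add)

text \<open>Both bracketings are expanded over quadruples (a, b, d, p): \<open>a\<close>,
  \<open>b\<close>, \<open>d\<close> are the drops in order inside the three factors and
  \<open>p\<close> counts the derivatives that fall on \<open>B\<close>; those left over fall on
  \<open>C\<close>. The scalars then agree by \<open>gbinomial_convolution_revision\<close>.\<close>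

lemma pdo_mult_assoc:
  fixes A B C :: "'a::field_char_0 pdo"
  assumes A: "pdo_bounded N A" and B: "pdo_bounded M B" and C: "pdo_bounded K C"
  shows "pdo_mult (pdo_mult A B) C = pdo_mult A (pdo_mult B C)"
proof (rule pdo_eqI)
  show "pdo_bounded (N + M + K) (pdo_mult (pdo_mult A B) C)"
    by (intro pdo_bounded_mult assms)
  show "pdo_bounded (N + M + K) (pdo_mult A (pdo_mult B C))"
    unfolding add.assoc by (intro pdo_bounded_mult assms)
next
  fix c :: nat
  let ?g = "\<lambda>(x :: int) k. (of_int x :: 'a) gchoose k"
  let ?A = "\<lambda>a. A (N - int a)" and ?B = "\<lambda>b k. (dp_deriv ^^ k) (B (M - int b))"
    and ?C = "\<lambda>d k. (dp_deriv ^^ k) (C (K - int d))"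
  let ?W = "{(a, b, d, p). a + b + d + p \<le> c}"
  let ?M = "\<lambda>a b d p. ?A a * ?B b p * ?C d (c - a - b - d - p)"
  have finW: "finite ?W"
    by (rule finite_subset[of _ "{..c} \<times> {..c} \<times> {..c} \<times> {..c}"]) auto
  have "pdo_mult (pdo_mult A B) C (N + M + K - int c) = (\<Sum>x\<le>c. \<Sum>d\<le>c - x. \<Sum>a\<le>x. \<Sum>b\<le>x - a.
      dp_const (?g (N + M - int x) (c - x - d)) * (dp_const (?g (N - int a) (x - a - b)) * ?A a * ?B b (x - a - b)) * ?C d (c - x - d))"
    by (simp add: pdo_mult_nth[OF pdo_bounded_mult[OF A B] C] pdo_mult_nth[OF A B] sum_distrib_left sum_distrib_right)
  also have "\<dots> = (\<Sum>(x, d, a, b)\<in>(SIGMA x:{..c}. SIGMA d:{..c - x}. SIGMA a:{..x}. {..x - a}).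
      dp_const (?g (N + M - int x) (c - x - d)) * (dp_const (?g (N - int a) (x - a - b)) * ?A a * ?B b (x - a - b)) * ?C d (c - x - d))"
    by (simp add: sum.Sigma)
  also have "\<dots> = (\<Sum>(a, b, d, p)\<in>?W.
      dp_const (?g (N + M - int (a + b + p)) (c - a - b - d - p)) * (dp_const (?g (N - int a) p) * ?A a * ?B b p) * ?C d (c - a - b - d - p))"
    by (rule sum.reindex_bij_witness[where i = "\<lambda>(a, b, d, p). (a + b + p, d, a, b)"
          and j = "\<lambda>(x, d, a, b). (a, b, d, x - a - b)"]) (auto simp: diff_diff_left add_ac)
  also have "\<dots> = (\<Sum>(a, b, d, p)\<in>?W. dp_const (\<Sum>v\<le>c - a - b - d - p. ?g (N - int a) (p + v) * of_nat ((p + v) choose p)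
       * ?g (M - int b) (c - a - b - d - p - v)) * ?M a b d p)"
    unfolding gbinomial_convolution_revision
    by (intro sum.cong refl) (auto simp: dp_const_mult algebra_simps)
  finally have L: "pdo_mult (pdo_mult A B) C (N + M + K - int c) = (\<Sum>(a, b, d, p)\<in>?W.
     dp_const (\<Sum>v\<le>c - a - b - d - p. ?g (N - int a) (p + v) * of_nat ((p + v) choose p)
       * ?g (M - int b) (c - a - b - d - p - v)) * ?M a b d p)" .
  have "pdo_mult A (pdo_mult B C) (N + M + K - int c) = (\<Sum>a\<le>c. \<Sum>y\<le>c - a. \<Sum>b\<le>y. \<Sum>d\<le>y - b. \<Sum>p\<le>c - a - y.
      dp_const (?g (N - int a) (c - a - y)) * ?A a * (dp_const (?g (M - int b) (y - b - d)) *
        (of_nat ((c - a - y) choose p) * (?B b p * ?C d (c - a - b - d - p)))))"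
    unfolding pdo_mult_nth[OF A pdo_bounded_mult[OF B C], unfolded add.assoc[symmetric]]
      pdo_mult_nth[OF B C] mult.assoc[of "dp_const _"] funpow_dp_deriv_sum funpow_dp_deriv_const_mult
    by (simp add: sum_distrib_left funpow_dp_deriv_mult mult.assoc funpow_funpow add_ac)
  also have "\<dots> = (\<Sum>(a, y, b, d, p)\<in>(SIGMA a:{..c}. SIGMA y:{..c - a}. SIGMA b:{..y}. SIGMA d:{..y - b}. {..c - a - y}).
      dp_const (?g (N - int a) (c - a - y)) * ?A a * (dp_const (?g (M - int b) (y - b - d)) *
        (of_nat ((c - a - y) choose p) * (?B b p * ?C d (c - a - b - d - p)))))"
    by (simp add: sum.Sigma)
  \<comment> \<open>Here \<open>v\<close> is the number of derivatives from \<open>A\<close> that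
    reach \<open>C\<close>, and \<open>y\<close>, the drop in order within the inner product, is
    recovered as \<open>c - a - p - v\<close>.\<close>
  also have "\<dots> = (\<Sum>((a, b, d, p), v)\<in>Sigma ?W (\<lambda>(a, b, d, p). {..c - a - b - d - p}).
      dp_const (?g (N - int a) (p + v)) * ?A a * (dp_const (?g (M - int b) (c - a - b - d - p - v)) *
        (of_nat ((p + v) choose p) * (?B b p * ?C d (c - a - b - d - p)))))"
    by (rule sum.reindex_bij_witness[where i = "\<lambda>((a, b, d, p), v). (a, c - a - p - v, b, d, p)"
          and j = "\<lambda>(a, y, b, d, p). ((a, b, d, p), c - a - y - p)"]) (auto simp: diff_diff_left add_ac)
  also have "\<dots> = (\<Sum>w\<in>?W. \<Sum>v\<in>(case w of (a, b, d, p) \<Rightarrow> {..c - a - b - d - p}). case w of (a, b, d, p) \<Rightarrow>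
      dp_const (?g (N - int a) (p + v)) * ?A a * (dp_const (?g (M - int b) (c - a - b - d - p - v)) *
        (of_nat ((p + v) choose p) * (?B b p * ?C d (c - a - b - d - p)))))"
    by (subst sum.Sigma) (auto simp: finW intro!: sum.cong)
  also have "\<dots> = (\<Sum>(a, b, d, p)\<in>?W.
     dp_const (\<Sum>v\<le>c - a - b - d - p. ?g (N - int a) (p + v) * of_nat ((p + v) choose p)
       * ?g (M - int b) (c - a - b - d - p - v)) * ?M a b d p)"
  proof (intro sum.cong refl)
    fix w assume "w \<in> ?W"
    obtain a b d p where w: "w = (a, b, d, p)" by (metis prod_cases4)
    have s: "dp_const (\<Sum>v\<in>V. f v) = (\<Sum>v\<in>V. dp_const (f v))" for V and f :: "nat \<Rightarrow> 'a"
      by (induction V rule: infinite_finite_induct) (simp_all add: dp_const_add)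
    show "(\<Sum>v\<in>(case w of (a, b, d, p) \<Rightarrow> {..c - a - b - d - p}). case w of (a, b, d, p) \<Rightarrow>
      dp_const (?g (N - int a) (p + v)) * ?A a * (dp_const (?g (M - int b) (c - a - b - d - p - v)) *
        (of_nat ((p + v) choose p) * (?B b p * ?C d (c - a - b - d - p))))) =
      (case w of (a, b, d, p) \<Rightarrow> dp_const (\<Sum>v\<le>c - a - b - d - p. ?g (N - int a) (p + v) * of_nat ((p + v) choose p)
       * ?g (M - int b) (c - a - b - d - p - v)) * ?M a b d p)"
      by (simp add: w s sum_distrib_left sum_distrib_right dp_const_mult dp_const_of_nat mult_ac)
  qed
  finally show "pdo_mult (pdo_mult A B) C (N + M + K - int c) = pdo_mult A (pdo_mult B C) (N + M + K - int c)"
    using L by simp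
qed

section \<open>The square root of \<open>Q\<close> and the Gelfand-Dickey recursion\<close>

lemma pdo_mult_pdo_one: "pdo_bounded N A \<Longrightarrow> pdo_mult A pdo_one = A"
proof -
  assume A: "pdo_bounded N A"
  have one: "pdo_bounded 0 pdo_one" by (simp add: pdo_bounded_def pdo_one_def)
  have "pdo_mult A pdo_one (N - int c) = A (N - int c)" for c
  proof -
    have "pdo_mult A pdo_one (N + 0 - int c) = (\<Sum>a\<le>c. \<Sum>b\<le>c - a. if b = 0 then (if a = c then A (N - int a) else 0) else 0)"
      unfolding pdo_mult_nth[OF A one] by (intro sum.cong refl) (auto simp: pdo_one_def funpow_dp_deriv_1)
    then show ?thesis by simp
  qed
  then show ?thesis
    using pdo_bounded_mult[OF A one] A by (intro pdo_eqI[of N]) auto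
qed

lemma pdo_one_mult: "pdo_bounded N A \<Longrightarrow> pdo_mult pdo_one A = A"
proof -
  assume A: "pdo_bounded N A"
  have one: "pdo_bounded 0 pdo_one" by (simp add: pdo_bounded_def pdo_one_def)
  have "pdo_mult pdo_one A (N - int c) = A (N - int c)" for c
  proof -
    have "pdo_mult pdo_one A (0 + N - int c) = (\<Sum>a\<le>c. if a = 0 then (\<Sum>b\<le>c. if b = c then A (N - int b) else 0) else 0)"
      unfolding pdo_mult_nth[OF one A]
    proof (intro sum.cong refl)
      fix a assume "a \<in> {..c}"
      show "(\<Sum>b\<le>c - a. dp_const (of_int (0 - int a) gchoose (c - a - b)) * pdo_one (0 - int a) *
          (dp_deriv ^^ (c - a - b)) (A (N - int b))) = (if a = 0 then (\<Sum>b\<le>c. if b = c then A (N - int b) else 0) else 0)"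
      proof (cases "a = 0")
        case True
        show ?thesis unfolding True
          by (simp only: simp_thms if_True diff_zero) (intro sum.cong refl, auto simp: gbinomial_0_left pdo_one_def)
      qed (simp add: pdo_one_def)
    qed
    then show ?thesis by simp
  qed
  then show ?thesis
    using pdo_bounded_mult[OF one A] A by (intro pdo_eqI[of N]) auto
qed

text \<open>Coefficients are indexed downwards from the order: \<open>sqrt_coeff c\<close> belongs to \<open>\<partial>^(1 - c)\<close>.\<close>

function sqrt_coeff :: "nat \<Rightarrow> 'a::field_char_0 dpoly" where
  "sqrt_coeff c = (if c = 0 then 1 else dp_const (1 / 2) * (pdo_Q (2 - int c) -
     (\<Sum>a<c. \<Sum>b\<in>{..c - a} - {c}. dp_const (of_int (1 - int a) gchoose (c - a - b))
        * sqrt_coeff a * (dp_deriv ^^ (c - a - b)) (sqrt_coeff b))))"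
  by auto
termination by (relation "Wellfounded.measure id") auto

declare sqrt_coeff.simps [simp del]

definition pdo_of_coeffs :: "(nat \<Rightarrow> 'a::field_char_0 dpoly) \<Rightarrow> 'a pdo" where
  "pdo_of_coeffs l = (\<lambda>k. if k \<le> 1 then l (nat (1 - k)) else 0)"

lemma dp_half: "2 * (dp_const (1 / 2) * p) = p" for p :: "'a::field_char_0 dpoly"
proof -
  have "2 * (dp_const (1 / 2) * p) = dp_const (2 * (1 / 2)) * p"
    unfolding dp_const_mult dp_const_numeral by (simp add: mult.assoc)
  then show ?thesis by simp
qed

text \<open>Division by 2 is multiplication by the constant 1/2: the coefficients form a field, the
  differential polynomials do not.\<close>

lemma dp_half_cancel:
  fixes p q :: "'a::field_char_0 dpoly"
  assumes "2 * p = 2 * q"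
  shows "p = q"
proof -
  have "dp_const (1 / 2) * (2 * r) = r" for r :: "'a dpoly"
    by (subst mult.left_commute) (rule dp_half)
  from this[of p, unfolded assms] this[of q] show ?thesis by (rule trans[OF sym])
qed

text \<open>The coefficient of index \<open>c\<close> enters from (a, b) = (0, c) and from (c, 0),
  each time with factor 1 because the leading coefficient is 1. Removing \<open>c\<close> from the
  inner index set takes out the first of these, the bound \<open>a < c\<close> the second; all
  remaining terms have smaller indices.\<close>

lemma pdo_square_nth:
  fixes L :: "'a::field_char_0 pdo"
  assumes L: "pdo_bounded 1 L" "L 1 = 1" and c: "c > 0"
  shows "pdo_mult L L (2 - int c) = 2 * L (1 - int c) +
     (\<Sum>a<c. \<Sum>b\<in>{..c - a} - {c}. dp_const (of_int (1 - int a) gchoose (c - a - b))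
        * L (1 - int a) * (dp_deriv ^^ (c - a - b)) (L (1 - int b)))"
proof -
  let ?T = "\<lambda>a b. dp_const (of_int (1 - int a) gchoose (c - a - b)) * L (1 - int a) * (dp_deriv ^^ (c - a - b)) (L (1 - int b))"
  have "pdo_mult L L (1 + 1 - int c) = (\<Sum>a\<le>c. \<Sum>b\<le>c - a. ?T a b)"
    by (rule pdo_mult_nth[OF L(1) L(1)])
  also have "\<dots> = (\<Sum>a<c. \<Sum>b\<le>c - a. ?T a b) + ?T c 0"
    unfolding lessThan_Suc_atMost[symmetric] sum.lessThan_Suc by simp
  finally have 1: "pdo_mult L L (2 - int c) = (\<Sum>a<c. \<Sum>b\<le>c - a. ?T a b) + ?T c 0"
    by (simp only: one_add_one)
  have 2: "(\<Sum>b\<le>c - a. ?T a b) = (\<Sum>b\<in>{..c - a} - {c}. ?T a b) + (if a = 0 then ?T 0 c else 0)" for a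
  proof (cases "a = 0")
    case True
    then show ?thesis
      using sum.remove[of "{..c}" c "?T 0"] by (simp only: diff_zero if_True finite_atMost atMost_iff order.refl simp_thms add.commute)
  next
    case False
    then have "{..c - a} - {c} = {..c - a}" using c by auto
    then show ?thesis using False by simp
  qed
  have 3: "(\<Sum>a<c. if a = 0 then ?T 0 c else 0) = ?T 0 c"
    by (subst sum.delta) (use c in simp_all)
  have 4: "?T 0 c = L (1 - int c)" "?T c 0 = L (1 - int c)" using L(2) by simp_all
  show ?thesis unfolding 1 2 sum.distrib 3 unfolding 4 mult_2 by (simp only: add_ac)
qed

lemma pdo_bounded_Q: "pdo_bounded 2 pdo_Q"
  by (simp add: pdo_bounded_def pdo_Q_def)

text \<open>Comparing coefficients in L L = Q gives twice the coefficient of index \<open>c\<close>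
  in terms of earlier ones. As 2 is invertible, the recursion both constructs L and forces it, so
  the description \<open>pdo_sqrt_Q\<close> denotes.\<close>

lemma pdo_sqrt_Q_unique_existence:
  "\<exists>!L :: 'a::field_char_0 pdo. L 1 = 1 \<and> (\<forall>k>1. L k = 0) \<and> pdo_mult L L = pdo_Q"
proof (rule ex_ex1I)
  let ?L = "pdo_of_coeffs sqrt_coeff :: 'a pdo"
  have nth: "?L (1 - int c) = sqrt_coeff c" for c by (simp add: pdo_of_coeffs_def)
  have 1: "?L 1 = 1" using nth[of 0] by (simp add: sqrt_coeff.simps)
  have b: "pdo_bounded 1 ?L" by (simp add: pdo_bounded_def pdo_of_coeffs_def)
  have "pdo_mult ?L ?L = pdo_Q"
  proof (rule pdo_eqI[OF _ pdo_bounded_Q])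
    show "pdo_bounded 2 (pdo_mult ?L ?L)" using pdo_bounded_mult[OF b b] by simp
    fix c
    show "pdo_mult ?L ?L (2 - int c) = pdo_Q (2 - int c)"
    proof (cases "c = 0")
      case True
      then show ?thesis using pdo_mult_nth[OF b b, of 0] 1 by (simp add: pdo_Q_def)
    next
      case False
      have "2 * sqrt_coeff c = pdo_Q (2 - int c) -
         (\<Sum>a<c. \<Sum>b\<in>{..c - a} - {c}. dp_const (of_int (1 - int a) gchoose (c - a - b))
        * sqrt_coeff a * (dp_deriv ^^ (c - a - b)) (sqrt_coeff b :: 'a dpoly))"
        using False by (subst sqrt_coeff.simps) (simp only: dp_half if_False)
      then show ?thesis unfolding pdo_square_nth[OF b 1 False[unfolded neq0_conv]] nth by simp
    qed
  qed
  then show "\<exists>L :: 'a pdo. L 1 = 1 \<and> (\<forall>k>1. L k = 0) \<and> pdo_mult L L = pdo_Q"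
    using 1 b unfolding pdo_bounded_def by blast
next
  fix L L' :: "'a pdo"
  assume L: "L 1 = 1 \<and> (\<forall>k>1. L k = 0) \<and> pdo_mult L L = pdo_Q"
    and L': "L' 1 = 1 \<and> (\<forall>k>1. L' k = 0) \<and> pdo_mult L' L' = pdo_Q"
  have b: "pdo_bounded 1 L" "pdo_bounded 1 L'" using L L' by (auto simp: pdo_bounded_def)
  have "L (1 - int c) = L' (1 - int c)" for c
  proof (induction c rule: less_induct)
    case (less c)
    show ?case
    proof (cases "c = 0")
      case False
      then have c: "c > 0" by simp
      have "(\<Sum>a<c. \<Sum>b\<in>{..c - a} - {c}. dp_const (of_int (1 - int a) gchoose (c - a - b))
        * L (1 - int a) * (dp_deriv ^^ (c - a - b)) (L (1 - int b)))
        = (\<Sum>a<c. \<Sum>b\<in>{..c - a} - {c}. dp_const (of_int (1 - int a) gchoose (c - a - b))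
        * L' (1 - int a) * (dp_deriv ^^ (c - a - b)) (L' (1 - int b)))"
      proof (intro sum.cong refl)
        fix a b assume ab: "a \<in> {..<c}" "b \<in> {..c - a} - {c}"
        then have "b < c" by auto
        then show "dp_const (of_int (1 - int a) gchoose (c - a - b))
        * L (1 - int a) * (dp_deriv ^^ (c - a - b)) (L (1 - int b)) =
          dp_const (of_int (1 - int a) gchoose (c - a - b))
        * L' (1 - int a) * (dp_deriv ^^ (c - a - b)) (L' (1 - int b))"
          using less[of a] less[of b] ab by simp
      qed
      then have "2 * L (1 - int c) = 2 * L' (1 - int c)"
        using pdo_square_nth[OF b(1) _ c] pdo_square_nth[OF b(2) _ c] L L' by simp
      then show ?thesis by (rule dp_half_cancel)
    qed (use L L' in simp)
  qed
  then show "L = L'" by (rule pdo_eqI[OF b])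
qed

lemma pdo_sqrt_Q:
  "pdo_sqrt_Q 1 = (1 :: 'a::field_char_0 dpoly)" "pdo_bounded 1 (pdo_sqrt_Q :: 'a pdo)"
  "pdo_mult pdo_sqrt_Q pdo_sqrt_Q = (pdo_Q :: 'a pdo)"
  using theI'[OF pdo_sqrt_Q_unique_existence, folded pdo_sqrt_Q_def] by (auto simp: pdo_bounded_def)

lemma pdo_bounded_power: "pdo_bounded (int n) (pdo_power pdo_sqrt_Q n :: 'a::field_char_0 pdo)"
proof (induction n)
  case 0
  show ?case by (simp add: pdo_bounded_def pdo_one_def)
next
  case (Suc n)
  show ?case using pdo_bounded_mult[OF pdo_sqrt_Q(2) Suc] by simp
qed

section \<open>Commutation with Q and the Lenard recursion\<close>

lemma pdo_sqrt_Q_power_commute: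
  "pdo_mult pdo_sqrt_Q (pdo_power pdo_sqrt_Q n :: 'a::field_char_0 pdo) = pdo_mult (pdo_power pdo_sqrt_Q n) pdo_sqrt_Q"
proof (induction n)
  case 0
  show ?case using pdo_mult_pdo_one[OF pdo_sqrt_Q(2), where 'a = 'a] pdo_one_mult[OF pdo_sqrt_Q(2), where 'a = 'a] by simp
next
  case (Suc n)
  then show ?case
    using pdo_mult_assoc[OF pdo_sqrt_Q(2) pdo_bounded_power[of n] pdo_sqrt_Q(2), where 'a = 'a] by simp
qed

text \<open>Associativity moves the factor Q to either side of the power. The recursion is the
  coefficientwise comparison of these two products.\<close>

lemma pdo_power_Suc_Suc:
  "pdo_power pdo_sqrt_Q (Suc (Suc n)) = pdo_mult pdo_Q (pdo_power pdo_sqrt_Q n :: 'a::field_char_0 pdo)"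
  "pdo_power pdo_sqrt_Q (Suc (Suc n)) = pdo_mult (pdo_power pdo_sqrt_Q n) (pdo_Q :: 'a pdo)"
proof -
  note b = pdo_sqrt_Q(2) pdo_bounded_power[of n]
  show "pdo_power pdo_sqrt_Q (Suc (Suc n)) = pdo_mult pdo_Q (pdo_power pdo_sqrt_Q n :: 'a pdo)"
    using pdo_mult_assoc[OF b(1) b(1) b(2), where 'a = 'a] by (simp add: pdo_sqrt_Q(3))
  show "pdo_power pdo_sqrt_Q (Suc (Suc n)) = pdo_mult (pdo_power pdo_sqrt_Q n) (pdo_Q :: 'a pdo)"
    using pdo_mult_assoc[OF b(1) b(2) b(1), where 'a = 'a] pdo_mult_assoc[OF b(2) b(1) b(1), where 'a = 'a]
    by (simp add: pdo_sqrt_Q(3) pdo_sqrt_Q_power_commute)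
qed

lemma pdo_Q_mult:
  assumes P: "pdo_bounded N P" and k: "k \<le> N"
  shows "pdo_mult pdo_Q P k = P (k - 2) + 2 * dp_deriv (P (k - 1)) + dp_deriv (dp_deriv (P k)) + dp_u 0 * P k"
proof -
  define c where "c = nat (N + 2 - k)"
  have c: "k = 2 + N - int c" "c \<ge> 2" using k by (auto simp: c_def)
  let ?t = "\<lambda>a b. dp_const (of_int (2 - int a) gchoose (c - a - b)) * pdo_Q (2 - int a) * (dp_deriv ^^ (c - a - b)) (P (N - int b))"
  have "pdo_mult pdo_Q P k = (\<Sum>a\<le>c. \<Sum>b\<le>c - a. ?t a b)"
    unfolding c(1) by (rule pdo_mult_nth[OF pdo_bounded_Q P])
  also have "\<dots> = (\<Sum>a\<in>{0, 2}. \<Sum>b\<le>c - a. ?t a b)"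
  proof (rule sum.mono_neutral_right)
    show "\<forall>a\<in>{..c} - {0, 2}. (\<Sum>b\<le>c - a. ?t a b) = 0"
    proof
      fix a assume "a \<in> {..c} - {0, 2}"
      then have "pdo_Q (2 - int a) = (0 :: 'a dpoly)" by (auto simp: pdo_Q_def)
      then show "(\<Sum>b\<le>c - a. ?t a b) = 0" by simp
    qed
  qed (use c in auto)
  also have "\<dots> = (\<Sum>b\<le>c. ?t 0 b) + (\<Sum>b\<le>c - 2. ?t 2 b)"
    by simp
  also have "(\<Sum>b\<le>c. ?t 0 b) = (\<Sum>b\<in>{c, c - 1, c - 2}. ?t 0 b)"
  proof (rule sum.mono_neutral_right)
    show "\<forall>b\<in>{..c} - {c, c - 1, c - 2}. ?t 0 b = 0"
    proof
      fix b assume "b \<in> {..c} - {c, c - 1, c - 2}"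
      then have "2 < c - b" by auto
      then have "(of_nat 2 :: 'a) gchoose (c - b) = 0"
        unfolding binomial_gbinomial[symmetric] by (simp add: binomial_eq_0)
      then show "?t 0 b = 0" by simp
    qed
  qed (use c in auto)
  also have "\<dots> = P (k - 2) + 2 * dp_deriv (P (k - 1)) + dp_deriv (dp_deriv (P k))"
  proof -
    have ne: "c \<noteq> c - 1" "c \<noteq> c - 2" "c - 1 \<noteq> c - 2" and d: "c - (c - 1) = 1" "c - (c - 2) = 2"
      and i: "N - int c = k - 2" "N - int (c - 1) = k - 1" "N - int (c - 2) = k"
      using c by (auto simp: of_nat_diff)
    have g: "(2 :: 'a) gchoose 2 = 1" using gbinomial_of_nat_symmetric[of 2 2, where 'a = 'a] by simp
    have d2: "(dp_deriv ^^ 2) p = dp_deriv (dp_deriv p)" for p :: "'a dpoly" by (simp add: numeral_2_eq_2)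
    have "(\<Sum>b\<in>{c, c - 1, c - 2}. ?t 0 b) = ?t 0 c + (?t 0 (c - 1) + ?t 0 (c - 2))"
      using ne by simp
    also have "\<dots> = P (k - 2) + (2 * dp_deriv (P (k - 1)) + dp_deriv (dp_deriv (P k)))"
      unfolding minus_nat.diff_0 i d by (simp add: g d2 pdo_Q_def dp_const_numeral)
    finally show ?thesis by (simp add: add.assoc)
  qed
  also have "(\<Sum>b\<le>c - 2. ?t 2 b) = (\<Sum>b\<le>c - 2. if b = c - 2 then dp_u 0 * P k else 0)"
  proof (intro sum.cong refl)
    fix b assume "b \<in> {..c - 2}"
    moreover have "N - int (c - 2) = k" using c by (simp add: of_nat_diff)
    ultimately show "?t 2 b = (if b = c - 2 then dp_u 0 * P k else 0)"
      by (cases "b = c - 2") (simp_all add: gbinomial_0_left pdo_Q_def del: of_nat_diff)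
  qed
  finally show ?thesis by simp
qed

text \<open>In the coefficient of order k of P u, the term of order i carries the binomial (i choose
  i - k). For k < 0 it vanishes at every i \<ge> 0, so only the orders between k and -1
  contribute.\<close>

lemma pdo_mult_Q:
  assumes P: "pdo_bounded (int N) P"
  shows "pdo_mult P pdo_Q (-1) = P (-3) + P (-1) * dp_u 0"
    and "pdo_mult P pdo_Q (-2) = P (-4) + P (-2) * dp_u 0 - P (-1) * dp_u 1"
proof -
  have *: "pdo_mult P pdo_Q k = P (k - 2) + (\<Sum>a\<le>nat (int N - k).
      dp_const (of_int (int N - int a) gchoose (nat (int N - k) - a)) * P (int N - int a) * (dp_deriv ^^ (nat (int N - k) - a)) (dp_u 0))"
    if k: "k \<le> int N" for k
  proof -
    define c where "c = nat (int N + 2 - k)"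
    have c: "k = int N + 2 - int c" "c \<ge> 2" "nat (int N - k) = c - 2" using k by (auto simp: c_def)
    let ?t = "\<lambda>a b. dp_const (of_int (int N - int a) gchoose (c - a - b)) * P (int N - int a) * (dp_deriv ^^ (c - a - b)) (pdo_Q (2 - int b))"
    have "pdo_mult P pdo_Q k = (\<Sum>a\<le>c. \<Sum>b\<le>c - a. ?t a b)"
      unfolding c(1) by (rule pdo_mult_nth[OF P pdo_bounded_Q])
    also have "\<dots> = (\<Sum>a\<le>c. (if a = c then P (int N - int c) else 0) + (if a \<le> c - 2 then
       dp_const (of_int (int N - int a) gchoose (c - 2 - a)) * P (int N - int a) * (dp_deriv ^^ (c - 2 - a)) (dp_u 0) else 0))"
    proof (intro sum.cong refl)
      fix a assume a: "a \<in> {..c}"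
      have "(\<Sum>b\<le>c - a. ?t a b) = (\<Sum>b\<le>c - a. (if b = 0 then (if a = c then P (int N - int c) else 0) else 0) +
         (if b = 2 then dp_const (of_int (int N - int a) gchoose (c - 2 - a)) * P (int N - int a) * (dp_deriv ^^ (c - 2 - a)) (dp_u 0) else 0))"
        using a by (intro sum.cong refl) (auto simp: pdo_Q_def funpow_dp_deriv_1 diff_commute)
      also have "\<dots> = (if a = c then P (int N - int c) else 0) + (if 2 \<le> c - a then
       dp_const (of_int (int N - int a) gchoose (c - 2 - a)) * P (int N - int a) * (dp_deriv ^^ (c - 2 - a)) (dp_u 0) else 0)"
        by (simp add: sum.distrib)
      also have "2 \<le> c - a \<longleftrightarrow> a \<le> c - 2" using c by auto
      finally show "(\<Sum>b\<le>c - a. ?t a b) = (if a = c then P (int N - int c) else 0) + (if a \<le> c - 2 then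
       dp_const (of_int (int N - int a) gchoose (c - 2 - a)) * P (int N - int a) * (dp_deriv ^^ (c - 2 - a)) (dp_u 0) else 0)" .
    qed
    also have "\<dots> = P (int N - int c) + (\<Sum>a\<in>{a\<in>{..c}. a \<le> c - 2}.
       dp_const (of_int (int N - int a) gchoose (c - 2 - a)) * P (int N - int a) * (dp_deriv ^^ (c - 2 - a)) (dp_u 0))"
      unfolding sum.distrib sum.inter_filter[OF finite_atMost] by simp
    also have "{a\<in>{..c}. a \<le> c - 2} = {..c - 2}" by auto
    finally show ?thesis using c by simp
  qed
  have nonneg: "(of_int (int N - int a) :: 'a) gchoose m = 0" if "a \<le> N" "N - a < m" for a m
  proof -
    have "(of_int (int N - int a) :: 'a) gchoose m = of_nat (N - a) gchoose m" using that by (simp add: of_nat_diff)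
    then show ?thesis unfolding binomial_gbinomial[symmetric] using that by (simp add: binomial_eq_0)
  qed
  let ?t = "\<lambda>c a. dp_const (of_int (int N - int a) gchoose (c - a)) * P (int N - int a) * (dp_deriv ^^ (c - a)) (dp_u 0)"
  have z: "?t c a = 0" if "a \<le> N" "N < c" for c a
    using nonneg[of a "c - a"] that by simp
  have z': "(\<Sum>a\<le>N. ?t c a) = 0" if "N < c" for c
    using that by (intro sum.neutral ballI z) auto
  have "(\<Sum>a\<le>Suc N. ?t (Suc N) a) = P (-1) * dp_u 0"
    unfolding sum.atMost_Suc z'[OF lessI] by simp
  then show "pdo_mult P pdo_Q (-1) = P (-3) + P (-1) * dp_u 0"
    using *[of "-1"] by (simp add: nat_add_distrib)
  have "(\<Sum>a\<le>Suc (Suc N). ?t (Suc (Suc N)) a) = P (-2) * dp_u 0 - P (-1) * dp_u 1"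
    unfolding sum.atMost_Suc z'[OF less_SucI[OF lessI]] by (simp add: dp_const_uminus)
  then show "pdo_mult P pdo_Q (-2) = P (-4) + P (-2) * dp_u 0 - P (-1) * dp_u 1"
    using *[of "-2"] by (simp add: nat_add_distrib)
qed

lemma gelfand_dickey_1: "2 * gelfand_dickey (Suc 0) = (dp_u 0 :: 'a::field_char_0 dpoly)"
proof -
  let ?L = "pdo_sqrt_Q :: 'a pdo"
  have e: "pdo_power ?L 1 = ?L" using pdo_mult_pdo_one[OF pdo_sqrt_Q(2), where 'a = 'a] by simp
  have "{..1::nat} - {1} = {0}" by auto
  then have "?L 0 = (0 :: 'a dpoly)"
    using pdo_square_nth[OF pdo_sqrt_Q(2,1), of 1, where 'a = 'a] dp_half_cancel[of "?L 0" 0]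
    by (simp add: pdo_sqrt_Q pdo_Q_def)
  moreover from this have "dp_deriv (?L 0) = (0 :: 'a dpoly)" by simp
  moreover have "{..<2 :: nat} = {0, 1}" "{..2 :: nat} - {2} = {0, 1}" "{..1::nat} = {0, 1}" by auto
  ultimately have "2 * ?L (-1) = dp_u 0"
    using pdo_square_nth[OF pdo_sqrt_Q(2,1), of 2, where 'a = 'a]
    by (simp add: pdo_sqrt_Q pdo_Q_def funpow_dp_deriv_1)
  then show ?thesis using e by simp
qed

text \<open>Orders -1 and -2 of Q P = P Q express the derivatives of \<open>P (-2)\<close> and
  \<open>P (-3)\<close> through \<open>P (-1)\<close>. The next residue is the coefficient of order
  -1 of P Q, namely \<open>P (-3) + P (-1) * dp_u 0\<close>. The factor 4 clears
  denominators.\<close>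

theorem gelfand_dickey_recursion:
  "4 * dp_deriv (gelfand_dickey (Suc n)) = dp_deriv (dp_deriv (dp_deriv (gelfand_dickey n)))
    + 4 * (dp_u 0 * dp_deriv (gelfand_dickey n)) + 2 * (dp_u 1 * (gelfand_dickey n :: 'a::field_char_0 dpoly))"
proof (cases n)
  \<comment> \<open>\<open>gelfand_dickey 0\<close> is 1 by definition and not a residue, so the
    first instance is checked from R_1 = u/2.\<close>
  case 0
  have "2 * dp_deriv (gelfand_dickey (Suc 0)) = (dp_u 1 :: 'a dpoly)"
    using arg_cong[OF gelfand_dickey_1[where 'a = 'a], of dp_deriv]
    by (simp only: mult_2 dp_deriv_add dp_deriv_simps One_nat_def)
  then have "2 * (2 * dp_deriv (gelfand_dickey (Suc 0))) = 2 * (dp_u 1 :: 'a dpoly)" by simp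
  then show ?thesis unfolding 0 gelfand_dickey.simps(1) by (simp add: mult.assoc[symmetric] del: gelfand_dickey.simps)
next
  case (Suc m)
  let ?N = "2 * m + 1"
  define P where "P = (pdo_power pdo_sqrt_Q ?N :: 'a pdo)"
  have b: "pdo_bounded (int ?N) P" unfolding P_def by (rule pdo_bounded_power)
  have r: "gelfand_dickey n = P (-1)" "gelfand_dickey (Suc n) = pdo_mult pdo_Q P (-1)"
    using pdo_power_Suc_Suc(1)[of ?N, where 'a = 'a] by (simp_all add: Suc P_def)
  have comm: "pdo_mult pdo_Q P = pdo_mult P pdo_Q"
    unfolding P_def by (rule trans[OF pdo_power_Suc_Suc(1)[symmetric] pdo_power_Suc_Suc(2)])
  note Q = pdo_Q_mult[OF b]
  have 1: "dp_deriv (dp_deriv (P (-1))) + 2 * dp_deriv (P (-2)) = 0"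
    using Q[of "-1"] unfolding comm pdo_mult_Q(1)[OF b] by (simp add: mult.commute add.commute)
  have 2: "2 * dp_deriv (P (-3)) + dp_deriv (dp_deriv (P (-2))) + P (-1) * dp_u 1 = 0"
    using Q[of "-2"] unfolding comm pdo_mult_Q(2)[OF b] by (simp add: algebra_simps)
  have two: "dp_deriv (2 * q) = 2 * dp_deriv q" for q :: "'a dpoly"
    by (simp only: mult_2 dp_deriv_add)
  have 3: "dp_deriv (dp_deriv (dp_deriv (P (-1)))) + 2 * dp_deriv (dp_deriv (P (-2))) = 0"
    using arg_cong[OF 1, of dp_deriv] by (simp add: dp_deriv_add two)
  have "4 * dp_deriv (gelfand_dickey (Suc n)) = 2 * (2 * dp_deriv (P (-3)))
      + 4 * dp_deriv (P (-1)) * dp_u 0 + 4 * P (-1) * dp_u 1"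
    unfolding r(2) comm pdo_mult_Q(1)[OF b] by (simp add: dp_deriv_add dp_deriv_mult algebra_simps)
  also have "2 * (2 * dp_deriv (P (-3))) = dp_deriv (dp_deriv (dp_deriv (P (-1)))) - 2 * (P (-1) * dp_u 1)
      + 2 * (2 * dp_deriv (P (-3)) + dp_deriv (dp_deriv (P (-2))) + P (-1) * dp_u 1)
      - (dp_deriv (dp_deriv (dp_deriv (P (-1)))) + 2 * dp_deriv (dp_deriv (P (-2))))"
    by (simp add: algebra_simps)
  finally show ?thesis
    unfolding 2 3 r(1) by (simp add: algebra_simps)
qed

section \<open>Constant terms of the Gelfand-Dickey polynomials\<close>

lemma dp_eval_0_pdo_mult:
  fixes A B :: "'a::field_char_0 pdo"
  assumes "\<And>k. k \<noteq> a \<Longrightarrow> dp_eval (\<lambda>_. 0) (A k) = 0" "\<And>k. k \<noteq> b \<Longrightarrow> dp_eval (\<lambda>_. 0) (B k) = 0" "n \<noteq> a + b"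
  shows "dp_eval (\<lambda>_. 0) (pdo_mult A B n) = 0"
proof -
  show ?thesis
    unfolding pdo_mult_def dp_eval_sum
  proof (rule sum.neutral[OF ballI], clarify)
    fix i j assume "n \<le> i + j"
    then consider "i \<noteq> a" | "j \<noteq> b" "nat (i + j - n) = 0" | "nat (i + j - n) \<noteq> 0"
      using assms(3) by (cases "i = a"; cases "j = b") auto
    then show "dp_eval (\<lambda>_. 0) (dp_const ((of_int i :: 'a) gchoose nat (i + j - n)) * A i * (dp_deriv ^^ nat (i + j - n)) (B j)) = 0"
      by cases (simp_all add: dp_eval_mult assms dp_eval_0_funpow_deriv)
  qed
qed

lemma dp_eval_0_sqrt_Q:
  assumes "k \<noteq> 1"
  shows "dp_eval (\<lambda>_. 0) (pdo_sqrt_Q k :: 'a::field_char_0 dpoly) = 0"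
proof -
  let ?e = "dp_eval (\<lambda>_. 0) :: 'a dpoly \<Rightarrow> 'a" and ?L = "pdo_sqrt_Q :: 'a pdo"
  have "?e (?L (1 - int c)) = 0" if "c > 0" for c
    using that
  proof (induction c rule: less_induct)
    case (less c)
    have "(\<Sum>a<c. \<Sum>b\<in>{..c - a} - {c}. ?e (dp_const (of_int (1 - int a) gchoose (c - a - b))
        * ?L (1 - int a) * (dp_deriv ^^ (c - a - b)) (?L (1 - int b)))) = 0"
    proof (intro sum.neutral ballI)
      fix a b assume ab: "a \<in> {..<c}" "b \<in> {..c - a} - {c}"
      \<comment> \<open>Without derivatives b = c - a, and b = c is excluded, so a > 0 and the
        induction hypothesis applies to \<open>?L (1 - int a)\<close>.\<close>
      then consider "c - a - b \<noteq> 0" | "0 < a" "a < c" by force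
      then show "?e (dp_const (of_int (1 - int a) gchoose (c - a - b))
        * ?L (1 - int a) * (dp_deriv ^^ (c - a - b)) (?L (1 - int b))) = 0"
        by cases (use ab less.IH in \<open>simp_all add: dp_eval_mult dp_eval_0_funpow_deriv\<close>)
    qed
    moreover have "?e (pdo_Q (2 - int c)) = 0" using less.prems by (auto simp: pdo_Q_def)
    ultimately have "?e (2 * ?L (1 - int c)) = 0"
      using arg_cong[OF pdo_square_nth[OF pdo_sqrt_Q(2,1) less.prems], of ?e]
      unfolding pdo_sqrt_Q(3) dp_eval_add dp_eval_sum by (simp only: add_0_right)
    then have "2 * ?e (?L (1 - int c)) = 0" by (simp only: mult_2 dp_eval_add)
    then show ?case by simp
  qed
  from this[of "nat (1 - k)"] show ?thesis
    using assms pdo_sqrt_Q(2)[where 'a = 'a] by (cases "k \<le> 1") (auto simp: pdo_bounded_def)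
qed

text \<open>At u = 0 the operator Q is the square of d/dx, its root is d/dx, and an odd power is
  again a pure power of d/dx, with no term of order -1. This fixes the integration constants that
  the recursion leaves open.\<close>

lemma dp_eval_0_gelfand_dickey:
  assumes "n > 0"
  shows "dp_eval (\<lambda>_. 0) (gelfand_dickey n :: 'a::field_char_0 dpoly) = 0"
proof -
  have pow: "dp_eval (\<lambda>_. 0) (pdo_power pdo_sqrt_Q m k :: 'a dpoly) = 0" if "k \<noteq> int m" for m k
    using that
  proof (induction m arbitrary: k)
    case 0
    then show ?case by (simp add: pdo_one_def)
  next
    case (Suc m)
    then show ?case
      using dp_eval_0_pdo_mult[where a = 1 and b = "int m" and n = k, OF dp_eval_0_sqrt_Q Suc.IH] by simp
  qed
  obtain m where "n = Suc m" using assms by (cases n) auto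
  then show ?thesis using pow[of "-1" "2 * m + 1"] by simp
qed

section \<open>Formal series in the inverse spectral parameter\<close>

definition fps_map :: "('a \<Rightarrow> 'b) \<Rightarrow> 'a fps \<Rightarrow> 'b fps" where
  "fps_map f F = Abs_fps (\<lambda>n. f (fps_nth F n))"

lemma fps_map_nth [simp]: "fps_nth (fps_map f F) n = f (fps_nth F n)"
  by (simp add: fps_map_def)

abbreviation fps_der :: "(nat \<Rightarrow> 'a dpoly) \<Rightarrow> 'a::field_char_0 dpoly fps \<Rightarrow> 'a dpoly fps" where
  "fps_der w \<equiv> fps_map (dp_der w)"

abbreviation fps_D :: "'a::field_char_0 dpoly fps \<Rightarrow> 'a dpoly fps" where
  "fps_D \<equiv> fps_map dp_deriv"

abbreviation fps_u :: "nat \<Rightarrow> 'a::field_char_0 dpoly fps" where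
  "fps_u k \<equiv> fps_const (dp_u k)"

lemma fps_D_eq_fps_der: "fps_D = fps_der (\<lambda>k. dp_u (Suc k))"
  by (simp add: dp_deriv_eq_dp_der)

lemma fps_der_add: "fps_der w (F + G) = fps_der w F + fps_der w G"
  by (simp add: fps_eq_iff dp_der_add)

lemma fps_der_diff: "fps_der w (F - G) = fps_der w F - fps_der w G"
  by (simp add: fps_eq_iff dp_der_diff)

lemma fps_der_uminus: "fps_der w (- F) = - fps_der w F"
  by (simp add: fps_eq_iff dp_der_uminus)

lemma fps_der_mult: "fps_der w (F * G) = fps_der w F * G + F * fps_der w G"
  by (simp add: fps_eq_iff fps_mult_nth dp_der_sum dp_der_mult sum.distrib)

lemma fps_der_const: "fps_der w (fps_const p) = fps_const (dp_der w p)"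
  by (simp add: fps_eq_iff)

lemma fps_der_0 [simp]: "fps_der w 0 = 0" and fps_der_1 [simp]: "fps_der w 1 = 0"
  by (simp_all add: fps_eq_iff)

lemma fps_der_numeral [simp]: "fps_der w (numeral n) = 0"
proof -
  have "(numeral n :: 'a dpoly fps) = fps_const (dp_const (numeral n))"
    by (simp add: dp_const_numeral numeral_fps_const)
  then show ?thesis by (simp only: fps_der_const dp_der_const fps_const_0_eq_0)
qed

lemma fps_der_X [simp]: "fps_der w fps_X = 0"
  by (simp add: fps_eq_iff fps_X_def)

lemma fps_der_X_power [simp]: "fps_der w (fps_X ^ k) = 0"
  by (simp add: fps_eq_iff fps_X_power_nth)

lemma fps_der_deriv: "fps_der w (fps_deriv F) = fps_deriv (fps_der w F)"
proof -
  have "dp_der w (of_nat m * p) = of_nat m * dp_der w p" for m and p :: "'a dpoly"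
    by (simp add: dp_const_of_nat[symmetric] dp_der_const_mult)
  then show ?thesis by (simp add: fps_eq_iff fps_deriv_nth del: of_nat_Suc)
qed

lemma fps_der_fps_D:
  assumes "\<And>k. w (Suc k) = dp_deriv (w k)"
  shows "fps_der w (fps_D F) = fps_D (fps_der w F)"
  by (simp add: fps_eq_iff dp_der_commute[where w = w, OF assms])

lemmas fps_D_add = fps_der_add[of "\<lambda>k. dp_u (Suc k)", folded fps_D_eq_fps_der]
lemmas fps_D_diff = fps_der_diff[of "\<lambda>k. dp_u (Suc k)", folded fps_D_eq_fps_der]
lemmas fps_D_uminus = fps_der_uminus[of "\<lambda>k. dp_u (Suc k)", folded fps_D_eq_fps_der]
lemmas fps_D_mult = fps_der_mult[of "\<lambda>k. dp_u (Suc k)", folded fps_D_eq_fps_der]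
lemmas fps_D_const = fps_der_const[of "\<lambda>k. dp_u (Suc k)", folded fps_D_eq_fps_der dp_deriv_eq_dp_der]
lemmas fps_D_deriv = fps_der_deriv[of "\<lambda>k. dp_u (Suc k)", folded fps_D_eq_fps_der]
lemmas fps_D_simps [simp] =
  fps_der_0[of "\<lambda>k. dp_u (Suc k)", folded fps_D_eq_fps_der]
  fps_der_1[of "\<lambda>k. dp_u (Suc k)", folded fps_D_eq_fps_der]
  fps_der_numeral[of "\<lambda>k. dp_u (Suc k)", folded fps_D_eq_fps_der]
  fps_der_X[of "\<lambda>k. dp_u (Suc k)", folded fps_D_eq_fps_der]
  fps_der_X_power[of "\<lambda>k. dp_u (Suc k)", folded fps_D_eq_fps_der]

section \<open>The generating series and its quadratic first integral\<close>

definition gd_fps :: "'a::field_char_0 dpoly fps" where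
  "gd_fps = Abs_fps gelfand_dickey"

lemma gd_fps_nth [simp]: "fps_nth gd_fps n = gelfand_dickey n"
  by (simp add: gd_fps_def)

text \<open>A quarter of this is the third-order operator \<open>\<partial>^3 / 4 + u \<partial> + u_x / 2\<close> of the recursion.\<close>

definition lenard :: "'a::field_char_0 dpoly fps \<Rightarrow> 'a dpoly fps" where
  "lenard F = fps_D (fps_D (fps_D F)) + 4 * (fps_u 0 * fps_D F) + 2 * (fps_u 1 * F)"

text \<open>The polarization of the first integral of \<open>4 F' = z * lenard F\<close>, where \<open>z = 1 / \<lambda>\<close>.\<close>

definition resolvent_form :: "'a::field_char_0 dpoly fps \<Rightarrow> 'a dpoly fps \<Rightarrow> 'a dpoly fps" where
  "resolvent_form F G = fps_X * (F * fps_D (fps_D G) + fps_D (fps_D F) * G) - fps_X * (fps_D F * fps_D G)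
     + 4 * (fps_X * fps_u 0 - 1) * (F * G)"

lemma lenard_gd_fps: "4 * fps_D gd_fps = fps_X * lenard gd_fps"
proof (rule fps_ext)
  fix n
  have 4: "(4 :: 'a dpoly fps) = fps_const 4" and 2: "(2 :: 'a dpoly fps) = fps_const 2"
    by (simp_all add: numeral_fps_const)
  show "fps_nth (4 * fps_D gd_fps) n = fps_nth (fps_X * lenard (gd_fps :: 'a dpoly fps)) n"
  proof (cases n)
    case 0
    then show ?thesis by (simp add: 4)
  next
    case (Suc m)
    show ?thesis
      unfolding Suc lenard_def 4 2
      using gelfand_dickey_recursion[of m, where 'a = 'a] by (simp del: gelfand_dickey.simps)
  qed
qed

lemma fps_double_eq_0D:
  fixes F :: "'a::field_char_0 dpoly fps"
  assumes "2 * F = 0"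
  shows "F = 0"
proof (rule fps_ext)
  fix n
  have "2 * fps_nth F n = fps_nth (2 * F) n" by (simp add: numeral_fps_const)
  then have "2 * fps_nth F n = 2 * 0" by (simp add: assms)
  then show "fps_nth F n = fps_nth 0 n" using dp_half_cancel by fastforce
qed

lemma fps_map_dp_eval_mult: "fps_map (dp_eval v) (F * G) = fps_map (dp_eval v) F * fps_map (dp_eval v) G"
  by (simp add: fps_eq_iff fps_mult_nth dp_eval_sum dp_eval_mult)

lemma fps_map_dp_eval_add: "fps_map (dp_eval v) (F + G) = fps_map (dp_eval v) F + fps_map (dp_eval v) G"
  by (simp add: fps_eq_iff dp_eval_add)

lemma fps_map_dp_eval_diff: "fps_map (dp_eval v) (F - G) = fps_map (dp_eval v) F - fps_map (dp_eval v) G"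
  by (simp add: fps_eq_iff dp_eval_diff)

lemma fps_map_dp_eval_numeral: "fps_map (dp_eval v) (numeral n) = numeral n"
proof -
  have "(numeral n :: 'a dpoly fps) = fps_const (dp_const (numeral n))"
    by (simp add: dp_const_numeral numeral_fps_const)
  then show ?thesis by (simp add: fps_eq_iff numeral_fps_const)
qed

text \<open>The derivative is 2 R times the defect of the Lenard equation, hence zero, so every
  coefficient is a constant. At u = 0 only R_0 = 1 survives and the form takes the value -4. The
  normalization is 4/\<lambda> times the first integral with value -\<lambda>.\<close>

lemma resolvent_form_gd_fps: "resolvent_form gd_fps gd_fps = (- 4 :: 'a::field_char_0 dpoly fps)"
proof -
  let ?R = "gd_fps :: 'a dpoly fps" and ?z = "fps_X :: 'a dpoly fps" and ?e = "fps_map (dp_eval (\<lambda>_. 0 :: 'a))"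
  define Y where "Y = resolvent_form ?R ?R + 4"
  have "fps_D Y = 2 * ?R * (?z * lenard ?R - 4 * fps_D ?R)"
    unfolding Y_def resolvent_form_def lenard_def fps_D_add fps_D_diff fps_D_mult fps_D_simps fps_D_const
      dp_deriv_simps One_nat_def
    by algebra
  then have "fps_D Y = 0" by (simp add: lenard_gd_fps)
  then have D: "dp_deriv (fps_nth Y n) = 0" for n by (simp add: fps_eq_iff)
  have R: "?e ?R = 1"
    using dp_eval_0_gelfand_dickey by (auto simp: fps_eq_iff simp del: gelfand_dickey.simps(2))
  have R': "?e (fps_D F) = 0" for F by (simp add: fps_eq_iff dp_eval_0_deriv)
  have u: "?e (fps_u 0) = 0" by (simp add: fps_eq_iff)
  have one: "?e 1 = 1" by (simp add: fps_eq_iff)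
  have "?e Y = 0"
    unfolding Y_def resolvent_form_def
    by (simp only: fps_map_dp_eval_mult fps_map_dp_eval_add fps_map_dp_eval_diff fps_map_dp_eval_numeral R R' u one) simp
  then have "dp_eval (\<lambda>_. 0) (fps_nth Y n) = 0" for n by (simp add: fps_eq_iff)
  then have "fps_nth Y n = 0" for n using dp_deriv_eq_0D[OF D, of n] by simp
  then have "Y = 0" by (simp add: fps_eq_iff)
  then show ?thesis unfolding Y_def by (simp only: eq_neg_iff_add_eq_0)
qed

text \<open>The Wronskian of two homogeneous solutions is annihilated. A source \<open>s\<close> in
  the equation of \<open>G\<close> leaves 4 z s F^2, which is the shape in which a variation of u
  enters the derivative of K(R, R).\<close>

lemma resolvent_form_wronskian:
  fixes F G :: "'a::field_char_0 dpoly fps"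
  assumes F: "4 * fps_D F = fps_X * lenard F" and G: "4 * fps_D G = fps_X * lenard G - 4 * (fps_X * s)"
  shows "resolvent_form F (F * fps_D G - fps_D F * G) = 4 * (fps_X * s * F ^ 2)"
proof -
  have "resolvent_form F (F * fps_D G - fps_D F * G) = 4 * (fps_X * s * F ^ 2)
      + F * (F * (fps_X * lenard G - 4 * (fps_X * s) - 4 * fps_D G) - G * (fps_X * lenard F - 4 * fps_D F))"
    unfolding resolvent_form_def lenard_def fps_D_add fps_D_diff fps_D_mult by algebra
  then show ?thesis by (simp add: F G)
qed


subsection \<open>Differential ideals\<close>

text \<open>Closure under d/dx is required because K differentiates its arguments. The ideal {0}
  gives identities of differential polynomials, the ideal of a jet gives identities that hold along
  a solution.\<close>

definition dp_diff_ideal :: "'a::field_char_0 dpoly set \<Rightarrow> bool" where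
  "dp_diff_ideal J \<longleftrightarrow> 0 \<in> J \<and> (\<forall>p\<in>J. \<forall>q\<in>J. p + q \<in> J) \<and> (\<forall>p\<in>J. \<forall>q. q * p \<in> J) \<and> (\<forall>p\<in>J. dp_deriv p \<in> J)"

definition fps_in_below :: "'a::field_char_0 dpoly set \<Rightarrow> nat \<Rightarrow> 'a dpoly fps \<Rightarrow> bool" where
  "fps_in_below J n F \<longleftrightarrow> (\<forall>m<n. fps_nth F m \<in> J)"

context
  fixes J :: "'a::field_char_0 dpoly set"
  assumes J: "dp_diff_ideal J"
begin

lemma ideal_sum: "(\<And>i. i \<in> A \<Longrightarrow> f i \<in> J) \<Longrightarrow> (\<Sum>i\<in>A. f i) \<in> J"
  using J by (induction A rule: infinite_finite_induct) (auto simp: dp_diff_ideal_def)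

lemma fps_in_below_add: "fps_in_below J n F \<Longrightarrow> fps_in_below J n G \<Longrightarrow> fps_in_below J n (F + G)"
  using J by (auto simp: fps_in_below_def dp_diff_ideal_def)

lemma fps_in_below_mult: "fps_in_below J n G \<Longrightarrow> fps_in_below J n (F * G)"
  unfolding fps_in_below_def fps_mult_nth
  by (intro allI impI ideal_sum) (use J in \<open>auto simp: dp_diff_ideal_def\<close>)

lemma fps_in_below_uminus: "fps_in_below J n F \<Longrightarrow> fps_in_below J n (- F)"
  using fps_in_below_mult[of n F "- 1"] by simp

lemma fps_in_below_diff: "fps_in_below J n F \<Longrightarrow> fps_in_below J n G \<Longrightarrow> fps_in_below J n (F - G)"
  using fps_in_below_add[OF _ fps_in_below_uminus] by fastforce

lemma fps_in_below_D: "fps_in_below J n F \<Longrightarrow> fps_in_below J n (fps_D F)"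
  using J by (auto simp: fps_in_below_def dp_diff_ideal_def)

lemma fps_in_below_X: "fps_in_below J n F \<Longrightarrow> fps_in_below J (Suc n) (fps_X * F)"
  using J by (auto simp: fps_in_below_def dp_diff_ideal_def)

text \<open>Since R = 1 + O(z), the form is -4 F plus z times an expression in F and its
  x-derivatives, so membership passes from the coefficients below \<open>n\<close> to the one at
  \<open>n\<close>.\<close>

lemma resolvent_form_inj:
  assumes "\<And>n. fps_in_below J n (resolvent_form gd_fps F)"
  shows "fps_in_below J n F"
proof (induction n)
  case 0
  show ?case by (simp add: fps_in_below_def)
next
  case (Suc n)
  let ?R = "gd_fps :: 'a dpoly fps"
  define R1 where "R1 = fps_shift 1 ?R"
  have R: "?R = 1 + fps_X * R1"
    by (rule fps_ext) (auto simp: R1_def split: nat.split simp del: gelfand_dickey.simps(2) intro: arg_cong[of _ _ gelfand_dickey])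
  have "4 * F = fps_X * (?R * fps_D (fps_D F) + fps_D (fps_D ?R) * F) - fps_X * (fps_D ?R * fps_D F)
     + fps_X * (4 * fps_u 0 * ?R * F) - fps_X * (4 * R1 * F) - resolvent_form ?R F"
    using R unfolding resolvent_form_def by algebra
  moreover have "fps_in_below J (Suc n) \<dots>"
    by (intro fps_in_below_diff fps_in_below_add fps_in_below_X fps_in_below_mult fps_in_below_D Suc assms)
  ultimately have "fps_in_below J (Suc n) (fps_const (dp_const (1 / 4)) * (4 * F))"
    by (simp only: fps_in_below_mult)
  also have "fps_const (dp_const (1 / 4)) * (4 * F) = fps_const (dp_const (1 / 4 * 4)) * F"
    unfolding dp_const_mult dp_const_numeral by (simp add: numeral_fps_const mult.assoc[symmetric])
  finally show ?case by simp
qed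

end

lemma dp_diff_ideal_0: "dp_diff_ideal {0}"
  by (simp add: dp_diff_ideal_def)

lemma fps_in_below_0: "fps_in_below {0} n F \<Longrightarrow> m < n \<Longrightarrow> fps_nth F m = 0"
  by (simp add: fps_in_below_def)


subsection \<open>Truncations and the hierarchy flows\<close>

definition fps_trunc :: "nat \<Rightarrow> 'b::zero fps \<Rightarrow> 'b fps" where
  "fps_trunc N F = Abs_fps (\<lambda>m. if m \<le> N then fps_nth F m else 0)"

lemma fps_trunc_nth [simp]: "fps_nth (fps_trunc N F) m = (if m \<le> N then fps_nth F m else 0)"
  by (simp add: fps_trunc_def)

lemma fps_D_trunc: "fps_D (fps_trunc N F) = fps_trunc N (fps_D F)"
  by (simp add: fps_eq_iff)

lemma fps_der_trunc: "fps_der w (fps_trunc N F) = fps_trunc N (fps_der w F)"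
  by (simp add: fps_eq_iff)

lemma lenard_nth: "fps_nth (lenard F) n = dp_deriv (dp_deriv (dp_deriv (fps_nth F n)))
    + 4 * (dp_u 0 * dp_deriv (fps_nth F n)) + 2 * (dp_u 1 * fps_nth F n)"
proof -
  have 4: "(4 :: 'a dpoly fps) = fps_const 4" and 2: "(2 :: 'a dpoly fps) = fps_const 2"
    by (simp_all add: numeral_fps_const)
  show ?thesis unfolding lenard_def 4 2 by simp
qed

lemma lenard_trunc: "lenard (fps_trunc N F) = fps_trunc N (lenard F)"
  by (rule fps_ext) (simp add: lenard_nth)

text \<open>Truncation breaks the equation at the single power z^(N+1), where the left side has lost
  4 F_(N+1)'. That term becomes the source in \<open>resolvent_form_wronskian\<close>.\<close>

lemma lenard_trunc_eq:
  fixes F :: "'a::field_char_0 dpoly fps"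
  assumes "4 * fps_D F = fps_X * lenard F"
  shows "4 * fps_D (fps_trunc N F) = fps_X * lenard (fps_trunc N F)
      - 4 * (fps_X * (fps_X ^ N * fps_const (dp_deriv (fps_nth F (Suc N)))))"
proof (rule fps_ext)
  fix m
  have 4: "(4 :: 'a dpoly fps) = fps_const 4" by (simp add: numeral_fps_const)
  have eq: "4 * dp_deriv (fps_nth F k) = (if k = 0 then 0 else fps_nth (lenard F) (k - 1))" for k
    using arg_cong[OF assms, of "\<lambda>H. fps_nth H k"] by (simp add: 4)
  show "fps_nth (4 * fps_D (fps_trunc N F)) m = fps_nth (fps_X * lenard (fps_trunc N F)
      - 4 * (fps_X * (fps_X ^ N * fps_const (dp_deriv (fps_nth F (Suc N)))))) m"
    unfolding fps_D_trunc lenard_trunc 4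
    using eq[of m] eq[of "Suc N"]
    by (cases "m = Suc N"; cases m) (auto simp: fps_X_power_mult_nth)
qed

text \<open>The derivative of u^(k) along t_(2n+1) as prescribed by the hierarchy. Prolonging the
  value at k = 0 by d/dx makes the resulting derivation commute with
  \<open>dp_deriv\<close>.\<close>

definition flow_weight :: "nat \<Rightarrow> nat \<Rightarrow> 'a::field_char_0 dpoly" where
  "flow_weight n k = (dp_deriv ^^ k) (2 * dp_deriv (gelfand_dickey (Suc n)))"

lemma flow_weight_Suc: "flow_weight n (Suc k) = dp_deriv (flow_weight n k)"
  by (simp add: flow_weight_def)

lemma flow_weight_0: "flow_weight n 0 = 2 * dp_deriv (gelfand_dickey (Suc n))"
  by (simp add: flow_weight_def)

text \<open>Both sides have the same image under K(R, _): the left one by differentiating K(R, R) =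
  -4 along the flow, where u changes by 2 R_(n+1)', the right one because truncating R at
  \<open>n\<close> produces exactly the source R_(n+1)'.\<close>

theorem flow_gd_fps:
  "fps_X ^ n * fps_der (flow_weight n) gd_fps =
    fps_trunc n gd_fps * fps_D gd_fps - fps_D (fps_trunc n gd_fps) * (gd_fps :: 'a::field_char_0 dpoly fps)"
proof -
  let ?R = "gd_fps :: 'a dpoly fps" and ?z = "fps_X :: 'a dpoly fps" and ?d = "fps_der (flow_weight n) :: 'a dpoly fps \<Rightarrow> _"
  let ?P = "fps_trunc n ?R" and ?r = "fps_const (dp_deriv (gelfand_dickey (Suc n))) :: 'a dpoly fps"
  note comm = fps_der_fps_D[where w = "flow_weight n :: _ \<Rightarrow> 'a dpoly", OF flow_weight_Suc]
  have u: "?d (fps_u 0) = 2 * ?r"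
    unfolding fps_der_const dp_der_u flow_weight_0 by (simp add: numeral_fps_const del: gelfand_dickey.simps)
  have "?d (resolvent_form ?R ?R) = 2 * resolvent_form ?R (?d ?R) + 8 * (?z * ?r * ?R ^ 2)"
    unfolding resolvent_form_def fps_der_add fps_der_diff fps_der_mult fps_der_X fps_der_numeral fps_der_1 comm u
    by algebra
  then have "2 * (resolvent_form ?R (?d ?R) + 4 * (?z * ?r * ?R ^ 2)) = 0"
    unfolding resolvent_form_gd_fps fps_der_uminus fps_der_numeral by (simp add: algebra_simps)
  then have *: "resolvent_form ?R (?d ?R) + 4 * (?z * ?r * ?R ^ 2) = 0"
    by (rule fps_double_eq_0D)
  have W: "resolvent_form ?R (?R * fps_D ?P - fps_D ?R * ?P) = 4 * (?z * (?z ^ n * ?r) * ?R ^ 2)"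
    using resolvent_form_wronskian[OF lenard_gd_fps lenard_trunc_eq[OF lenard_gd_fps]] by simp
  let ?X = "?z ^ n * ?d ?R - (?P * fps_D ?R - fps_D ?P * ?R)"
  have "resolvent_form ?R ?X = ?z ^ n * (resolvent_form ?R (?d ?R) + 4 * (?z * ?r * ?R ^ 2))
      + (resolvent_form ?R (?R * fps_D ?P - fps_D ?R * ?P) - 4 * (?z * (?z ^ n * ?r) * ?R ^ 2))"
    unfolding resolvent_form_def fps_D_add fps_D_diff fps_D_mult fps_D_simps by algebra
  then have "resolvent_form ?R ?X = 0" unfolding * W by simp
  then have "fps_in_below {0} m (resolvent_form ?R ?X)" for m
    by (simp only: fps_in_below_def fps_zero_nth singleton_iff simp_thms)
  then have "fps_in_below {0} m ?X" for m
    by (rule resolvent_form_inj[OF dp_diff_ideal_0])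
  then have "fps_nth ?X m = 0" for m using fps_in_below_0[of "Suc m"] by blast
  then have "?X = 0" by (simp only: fps_eq_iff fps_zero_nth simp_thms)
  then show ?thesis by simp
qed


section \<open>Flow of the truncated product c R modulo the string equation\<close>

definition const_series :: "nat \<Rightarrow> (nat \<Rightarrow> 'a) \<Rightarrow> 'a::field_char_0 dpoly fps" where
  "const_series g c = Abs_fps (\<lambda>i. if i \<le> g then dp_const (c i) else 0)"

lemma const_series_nth: "fps_nth (const_series g c) i = (if i \<le> g then dp_const (c i) else 0)"
  by (simp add: const_series_def)

lemma fps_der_const_series [simp]: "fps_der w (const_series g c) = 0"
  by (simp add: fps_eq_iff const_series_nth)

lemma fps_D_const_series [simp]: "fps_D (const_series g c) = 0"
  by (simp add: fps_eq_iff const_series_nth)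

lemma lenard_const_series_mult:
  "4 * fps_D (const_series g c * gd_fps) = fps_X * lenard (const_series g c * gd_fps)"
proof -
  have "4 * fps_D (const_series g c * gd_fps) = const_series g c * (4 * fps_D gd_fps)"
    unfolding fps_D_mult fps_D_const_series by (simp add: algebra_simps)
  also have "\<dots> = fps_X * lenard (const_series g c * gd_fps)"
    unfolding lenard_gd_fps unfolding lenard_def fps_D_mult fps_D_const_series fps_D_add fps_D_simps
    by (simp add: algebra_simps)
  finally show ?thesis .
qed

text \<open>In terms of \<open>\<lambda>\<close> this is \<open>2 dR/d\<lambda> - R/\<lambda>\<close>.\<close>

definition euler_op :: "'a::field_char_0 dpoly fps \<Rightarrow> 'a dpoly fps" where
  "euler_op F = - 2 * (fps_X ^ 2 * fps_deriv F) - fps_X * F"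

lemma fps_D_euler_op: "fps_D (euler_op F) = euler_op (fps_D F)"
  unfolding euler_op_def fps_D_diff fps_D_mult fps_D_uminus fps_D_simps fps_D_deriv by simp

text \<open>Differentiating K(R, R) = -4 in z shows that 2 K(R, dR/dz) is minus the explicit
  z-derivative of the form, which equals (K(R, R) + 4 R^2)/z. The term -z R in
  \<open>euler_op\<close> removes the K(R, R) part and leaves 4 z R^2, the image of twice a
  Wronskian with source 1/2.\<close>

lemma resolvent_form_euler:
  "resolvent_form gd_fps (euler_op gd_fps) = 4 * (fps_X * gd_fps ^ 2 :: 'a::field_char_0 dpoly fps)"
proof -
  let ?R = "gd_fps :: 'a dpoly fps" and ?z = "fps_X :: 'a dpoly fps"
  have dc: "fps_deriv (fps_u 0 :: 'a dpoly fps) = 0" by simp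
  have dn: "fps_deriv (numeral k :: 'a dpoly fps) = 0" for k by (simp add: numeral_fps_const)
  have "fps_deriv (resolvent_form ?R ?R) = 0"
    unfolding resolvent_form_gd_fps by (simp add: numeral_fps_const)
  then have 1: "2 * resolvent_form ?R (fps_deriv ?R) + 2 * (?R * fps_D (fps_D ?R)) - (fps_D ?R)^2 + 4 * (fps_u 0 * ?R^2) = 0"
    unfolding resolvent_form_def fps_deriv_add fps_deriv_sub fps_deriv_mult fps_deriv_fps_X fps_D_deriv dc dn fps_deriv_1
    by algebra
  have "resolvent_form ?R (euler_op ?R) = - (?z^2 * (2 * resolvent_form ?R (fps_deriv ?R))) - ?z * resolvent_form ?R ?R"
    unfolding resolvent_form_def euler_op_def fps_D_add fps_D_diff fps_D_uminus fps_D_mult fps_D_simps power2_eq_square by algebra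
  also have "\<dots> = 4 * (?z * ?R^2)
    - ?z^2 * (2 * resolvent_form ?R (fps_deriv ?R) + 2 * (?R * fps_D (fps_D ?R)) - (fps_D ?R)^2 + 4 * (fps_u 0 * ?R^2))"
    unfolding resolvent_form_def[of ?R ?R] by algebra
  finally show ?thesis unfolding 1 by simp
qed

lemma euler_op_nth:
  "fps_nth (euler_op F) m = (if m = 0 then 0 else - (of_nat (2 * m - 1) * fps_nth F (m - 1)))"
proof (cases m)
  case (Suc k)
  have "fps_nth (2 * (fps_X ^ 2 * fps_deriv F)) (Suc k) = of_nat (2 * k) * fps_nth F k"
  proof (cases k)
    case (Suc j)
    have "of_nat (2 * Suc j) = 2 * (of_nat (Suc j) :: 'a dpoly)" by (simp only: of_nat_mult of_nat_numeral)
    then show ?thesis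
      unfolding Suc by (simp add: numeral_fps_const fps_X_power_mult_nth mult.assoc del: of_nat_Suc mult_Suc_right)
  qed (simp add: numeral_fps_const fps_X_power_mult_nth)
  then show ?thesis
    unfolding euler_op_def Suc by (simp add: algebra_simps)
qed (simp add: euler_op_def)

text \<open>A ring identity to be read with a = z^n, e = z^g, p + z a q = R and b + e \<rho> = B;
  primes are x-derivatives and the index 1 is the flow. The last two terms on the right will start
  beyond z^(n+g).\<close>

lemma wronskian_truncation:
  fixes a :: "'r::comm_ring_1"
  assumes "a * (b\<^sub>1 + e * \<rho>\<^sub>1) = p * (b' + e * \<rho>') - p' * (b + e * \<rho>)"
  shows "2 * (a * b\<^sub>1 - (p * b' - p' * b)) - e * f =
    e * (2 * ((p + z * a * q) * \<rho>' - (p' + z * a * q') * \<rho>) - f) - 2 * (a * e * \<rho>\<^sub>1)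
      - 2 * (z * (a * e) * (q * \<rho>' - q' * \<rho>))"
proof -
  have "2 * (a * b\<^sub>1 - (p * b' - p' * b)) - e * f =
    e * (2 * ((p + z * a * q) * \<rho>' - (p' + z * a * q') * \<rho>) - f) - 2 * (a * e * \<rho>\<^sub>1)
      - 2 * (z * (a * e) * (q * \<rho>' - q' * \<rho>))
      + 2 * (a * (b\<^sub>1 + e * \<rho>\<^sub>1) - (p * (b' + e * \<rho>') - p' * (b + e * \<rho>)))"
    by (simp add: algebra_simps)
  then show ?thesis by (simp add: assms)
qed

text \<open>The tail \<rho> of B solves the Lenard equation with source s = -B_(g+1)', and the
  string equation says s = 1/2 modulo \<open>J\<close>. For that source, twice the Wronskian of R
  and \<rho> has the same image as \<open>euler_op gd_fps\<close>. The range
  \<open>M \<le> n + g\<close> is the part that is polynomial in \<lambda> after multiplication by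
  \<lambda>^(n+g).\<close>

theorem hierarchy_flow_mod_ideal:
  fixes c :: "nat \<Rightarrow> 'a::field_char_0" and B :: "'a dpoly fps"
  assumes B_def: "B = const_series g c * gd_fps"
    and J: "dp_diff_ideal J" and string: "2 * dp_deriv (fps_nth B (Suc g)) + 1 \<in> J" and M: "M \<le> n + g"
  shows "fps_nth (2 * (fps_X ^ n * fps_der (flow_weight n) (fps_trunc g B)
      - (fps_trunc n gd_fps * fps_D (fps_trunc g B) - fps_D (fps_trunc n gd_fps) * fps_trunc g B))
      - fps_X ^ g * euler_op gd_fps) M \<in> J"
proof -
  let ?R = "gd_fps :: 'a dpoly fps" and ?z = "fps_X :: 'a dpoly fps" and ?d = "fps_der (flow_weight n) :: 'a dpoly fps \<Rightarrow> _"
  let ?P = "fps_trunc n ?R" and ?B = "fps_trunc g B"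
  define s where "s = fps_const (- dp_deriv (fps_nth B (Suc g)))"
  define \<rho> where "\<rho> = fps_shift g (B - ?B)"
  have B: "B = ?B + ?z ^ g * \<rho>"
    by (rule fps_ext) (simp add: \<rho>_def fps_X_power_mult_nth)
  have \<rho>: "fps_nth \<rho> m = (if m = 0 then 0 else fps_nth B (m + g))" for m by (simp add: \<rho>_def)
  define R' where "R' = fps_shift (Suc n) (?R - ?P)"
  have R': "?R = ?P + ?z ^ Suc n * R'"
    by (rule fps_ext) (auto simp: R'_def fps_X_power_mult_nth simp del: power_Suc gelfand_dickey.simps)
  have LB: "4 * fps_D B = ?z * lenard B"
    unfolding B_def by (rule lenard_const_series_mult)
  have 4: "(4 :: 'a dpoly fps) = fps_const 4" by (simp add: numeral_fps_const)
  \<comment> \<open>The series \<open>\<rho>\<close> begins with B_(g+1) at z^1, where the shifted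
    equation has nothing on the right; this is the only index at which a source appears.\<close>
  have L\<rho>: "4 * fps_D \<rho> = ?z * lenard \<rho> - 4 * (?z * s)"
  proof (rule fps_ext)
    fix m
    have eq: "4 * dp_deriv (fps_nth B k) = (if k = 0 then 0 else fps_nth (lenard B) (k - 1))" for k
      using arg_cong[OF LB, of "\<lambda>H. fps_nth H k"] by (simp add: 4)
    consider "m = 0" | "m = 1" | k where "m = Suc (Suc k)" by (cases m; cases "m - 1") auto
    then show "fps_nth (4 * fps_D \<rho>) m = fps_nth (?z * lenard \<rho> - 4 * (?z * s)) m"
    proof cases
      case 3
      then show ?thesis using eq[of "m + g"] by (simp add: 4 \<rho> lenard_nth s_def)
    qed (simp_all add: 4 \<rho> lenard_nth s_def)
  qed
  define E where "E = ?R * fps_D \<rho> - fps_D ?R * \<rho>"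
  have "resolvent_form ?R (2 * E - euler_op ?R) = 2 * resolvent_form ?R E - resolvent_form ?R (euler_op ?R)"
    unfolding resolvent_form_def fps_D_add fps_D_diff fps_D_mult fps_D_simps by algebra
  also have "\<dots> = (- 4 * (?z * ?R ^ 2)) * (1 - 2 * s)"
    unfolding E_def resolvent_form_wronskian[OF lenard_gd_fps L\<rho>] resolvent_form_euler by algebra
  finally have K: "resolvent_form ?R (2 * E - euler_op ?R) = (- 4 * (?z * ?R ^ 2)) * (1 - 2 * s)" .
  have "fps_in_below J m (1 - 2 * s)" for m
  proof -
    have "1 - 2 * s = fps_const (2 * dp_deriv (fps_nth B (Suc g)) + 1)"
      by (rule fps_ext) (simp add: s_def numeral_fps_const)
    then show ?thesis using string J by (auto simp: fps_in_below_def dp_diff_ideal_def)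
  qed
  then have "fps_in_below J m (resolvent_form ?R (2 * E - euler_op ?R))" for m
    unfolding K using fps_in_below_mult[OF J] by blast
  then have "fps_in_below J m (2 * E - euler_op ?R)" for m
    by (rule resolvent_form_inj[OF J])
  then have "fps_nth (2 * E - euler_op ?R) m \<in> J" for m by (auto simp: fps_in_below_def)
  moreover have "0 \<in> J" using J by (simp add: dp_diff_ideal_def)
  ultimately have in_J: "fps_nth (?z ^ g * (2 * E - euler_op ?R)) M \<in> J"
    by (simp only: fps_X_power_mult_nth split: if_split) simp
  have flow: "?z ^ n * ?d B = ?P * fps_D B - fps_D ?P * B"
  proof -
    have "?z ^ n * ?d B = const_series g c * (?z ^ n * ?d ?R)"
      unfolding B_def fps_der_mult fps_der_const_series by (simp add: mult_ac)
    also have "\<dots> = ?P * fps_D B - fps_D ?P * B"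
      unfolding flow_gd_fps B_def fps_D_mult fps_D_const_series by (simp add: algebra_simps)
    finally show ?thesis .
  qed
  let ?T = "R' * fps_D \<rho> - fps_D R' * \<rho>"
  have "2 * (?z ^ n * ?d ?B - (?P * fps_D ?B - fps_D ?P * ?B)) - ?z ^ g * euler_op ?R
     = ?z ^ g * (2 * E - euler_op ?R) - 2 * (?z ^ (n + g) * (?d \<rho>)) - 2 * (?z ^ Suc (n + g) * ?T)"
  proof -
    have D: "fps_D B = fps_D ?B + ?z ^ g * fps_D \<rho>"
      using arg_cong[OF B, of fps_D] unfolding fps_D_add fps_D_mult[of "?z ^ g"] fps_D_simps mult_zero_left add_0_left .
    have d: "?d B = ?d ?B + ?z ^ g * ?d \<rho>"
      using arg_cong[OF B, of ?d] unfolding fps_der_add fps_der_mult[of _ "?z ^ g"] fps_der_X_power mult_zero_left add_0_left .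
    have DR: "fps_D ?R = fps_D ?P + ?z ^ Suc n * fps_D R'"
      using arg_cong[OF R', of fps_D] unfolding fps_D_add fps_D_mult[of "?z ^ Suc n"] fps_D_simps mult_zero_left add_0_left .
    have "?z ^ n * (?d ?B + ?z ^ g * ?d \<rho>)
        = ?P * (fps_D ?B + ?z ^ g * fps_D \<rho>) - fps_D ?P * (?B + ?z ^ g * \<rho>)"
      using flow unfolding D[symmetric] d[symmetric] B[symmetric] .
    from wronskian_truncation[OF this, of "euler_op ?R" "?z" R' "fps_D R'"]
    show ?thesis
      unfolding E_def DR power_add[symmetric] mult.assoc[symmetric] power_Suc[symmetric] R'[symmetric] .
  qed
  \<comment> \<open>\<open>\<rho>\<close> has no constant coefficient, so this term starts at
    z^(n+g+1).\<close>
  moreover have "fps_nth (2 * (?z ^ (n + g) * (?d \<rho>))) M = 0"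
    using M by (simp add: numeral_fps_const fps_X_power_mult_nth \<rho>)
  moreover have "fps_nth (2 * (?z ^ Suc (n + g) * ?T)) M = 0"
    using M by (simp add: numeral_fps_const fps_X_power_mult_nth del: power_Suc)
  ultimately show ?thesis using in_J by simp
qed

section \<open>Evaluation at a jet\<close>

text \<open>
  \<open>spec_poly v N F\<close> is \<open>\<lambda>^N * F(1 / \<lambda>)\<close>, cut off below \<open>\<lambda>^0\<close>, with the indeterminates
  replaced by the values \<open>v\<close>.
\<close>

definition spec_poly :: "(nat \<Rightarrow> 'a) \<Rightarrow> nat \<Rightarrow> 'a::field_char_0 dpoly fps \<Rightarrow> 'a poly" where
  "spec_poly v N F = (\<Sum>m\<le>N. monom (dp_eval v (fps_nth F m)) (N - m))"

lemma coeff_spec_poly: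
  "coeff (spec_poly v N F) i = (if i \<le> N then dp_eval v (fps_nth F (N - i)) else 0)"
  unfolding spec_poly_def by (rule coeff_sum_monom)

lemma spec_poly_add: "spec_poly v N (F + G) = spec_poly v N F + spec_poly v N G"
  by (rule poly_eqI) (simp add: coeff_spec_poly dp_eval_add)

lemma spec_poly_diff: "spec_poly v N (F - G) = spec_poly v N F - spec_poly v N G"
  by (rule poly_eqI) (simp add: coeff_spec_poly dp_eval_diff)

lemma spec_poly_const_mult: "spec_poly v N (fps_const p * F) = smult (dp_eval v p) (spec_poly v N F)"
  by (rule poly_eqI) (simp add: coeff_spec_poly dp_eval_mult)

lemma dp_eval_numeral: "dp_eval v (numeral n) = numeral n"
  using dp_eval_const[of v "numeral n"] by (simp add: dp_const_numeral)

lemma spec_poly_numeral_mult: "spec_poly v N (numeral n * F) = smult (numeral n) (spec_poly v N F)"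
  using spec_poly_const_mult[of v N "numeral n" F] by (simp add: numeral_fps_const dp_eval_numeral)

lemma spec_poly_X_power: "spec_poly v (n + N) (fps_X ^ n * F) = spec_poly v N F"
  by (rule poly_eqI) (auto simp: coeff_spec_poly fps_X_power_mult_nth)

lemma spec_poly_trunc: "spec_poly v N (fps_trunc N F) = spec_poly v N F"
  by (rule poly_eqI) (simp add: coeff_spec_poly)

lemma spec_poly_Suc:
  assumes "fps_nth F (Suc N) = 0"
  shows "spec_poly v (Suc N) F = pCons 0 (spec_poly v N F)"
  by (rule poly_eqI) (use assms in \<open>auto simp: coeff_spec_poly coeff_pCons split: nat.split\<close>)

text \<open>A tail in negative powers of \<lambda> would meet positive powers of the other factor
  and re-enter the polynomial part; without tails, taking polynomial parts is
  multiplicative.\<close>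

lemma spec_poly_mult:
  assumes F: "\<And>m. m > n \<Longrightarrow> fps_nth F m = 0" and G: "\<And>m. m > N \<Longrightarrow> fps_nth G m = 0"
  shows "spec_poly v (n + N) (F * G) = spec_poly v n F * spec_poly v N G"
proof (rule poly_eqI)
  fix i
  let ?f = "\<lambda>k. dp_eval v (fps_nth F k)" and ?g = "\<lambda>k. dp_eval v (fps_nth G k)"
  have L: "coeff (spec_poly v n F * spec_poly v N G) i = (\<Sum>j\<in>{j. j \<le> i \<and> j \<le> n \<and> i - j \<le> N}. ?f (n - j) * ?g (N - (i - j)))"
    unfolding coeff_mult coeff_spec_poly by (intro sum.mono_neutral_cong_right) auto
  show "coeff (spec_poly v (n + N) (F * G)) i = coeff (spec_poly v n F * spec_poly v N G) i"
  proof (cases "i \<le> n + N")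
    case True
    have "coeff (spec_poly v (n + N) (F * G)) i = (\<Sum>k = 0..n + N - i. ?f k * ?g (n + N - i - k))"
      using True by (simp add: coeff_spec_poly fps_mult_nth dp_eval_sum dp_eval_mult)
    also have "\<dots> = (\<Sum>k\<in>{k. k \<le> n + N - i \<and> k \<le> n \<and> n + N - i - k \<le> N}. ?f k * ?g (n + N - i - k))"
    proof (rule sum.mono_neutral_right)
      show "\<forall>k\<in>{0..n + N - i} - {k. k \<le> n + N - i \<and> k \<le> n \<and> n + N - i - k \<le> N}. ?f k * ?g (n + N - i - k) = 0"
      proof
        fix k assume "k \<in> {0..n + N - i} - {k. k \<le> n + N - i \<and> k \<le> n \<and> n + N - i - k \<le> N}"
        then have "k > n \<or> n + N - i - k > N" by auto
        then show "?f k * ?g (n + N - i - k) = 0" by (elim disjE) (simp_all add: F G)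
      qed
    qed auto
    also have "\<dots> = (\<Sum>j\<in>{j. j \<le> i \<and> j \<le> n \<and> i - j \<le> N}. ?f (n - j) * ?g (N - (i - j)))"
      by (rule sum.reindex_bij_witness[where i = "\<lambda>j. n - j" and j = "\<lambda>k. n - k"])
        (use True in \<open>auto intro!: arg_cong[of _ _ "dp_eval v"] arg_cong[of _ _ "fps_nth G"] arg_cong2[of _ _ _ _ times]\<close>)
    finally show ?thesis using L by simp
  next
    case False
    then have e: "{j. j \<le> i \<and> j \<le> n \<and> i - j \<le> N} = {}" by auto
    show ?thesis using False unfolding L e coeff_spec_poly[of v "n + N"] by simp
  qed
qed

lemma spec_poly_mult_trunc:
  "spec_poly v (n + N) (fps_trunc n F * fps_trunc N G) = spec_poly v n F * spec_poly v N G"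
  by (simp add: spec_poly_mult spec_poly_trunc)

lemma dp_eval_of_nat: "dp_eval v (of_nat n) = of_nat n"
  using dp_eval_const[of v "of_nat n"] by (simp add: dp_const_of_nat)

text \<open>Product rule: \<lambda>^n (2 dR/d\<lambda> - R/\<lambda>) = 2 d(\<lambda>^n
  R)/d\<lambda> - (2n+1) \<lambda>^(n-1) R. The factor 2n+1 is the one in c_(g+1-n) = (2n+1)/2
  t_(2n+1), so the last term will cancel the explicit time derivative of V.\<close>

lemma spec_poly_euler_op:
  "spec_poly v n (euler_op F) = 2 * pderiv (spec_poly v n F) -
     (if n = 0 then 0 else smult (of_nat (2 * n + 1)) (spec_poly v (n - 1) F))"
proof (rule poly_eqI)
  fix i
  have two: "coeff (2 * p) j = 2 * coeff p j" for p :: "'a poly" and j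
    by (simp add: numeral_poly)
  consider "i > n" | "i = n" | "i < n" by linarith
  then show "coeff (spec_poly v n (euler_op F)) i = coeff (2 * pderiv (spec_poly v n F) -
     (if n = 0 then 0 else smult (of_nat (2 * n + 1)) (spec_poly v (n - 1) F))) i"
  proof cases
    case 3
    have e: "n - i - 1 = n - Suc i" "n - 1 - i = n - Suc i" by auto
    have "of_nat (2 * (n - i) - 1) = (of_nat (2 * n + 1) - 2 * of_nat (Suc i) :: 'a)"
    proof -
      have "2 * n + 1 = (2 * (n - i) - 1) + 2 * Suc i" using 3 by auto
      then have "of_nat (2 * n + 1) = (of_nat ((2 * (n - i) - 1) + 2 * Suc i) :: 'a)" by simp
      then show ?thesis by (simp only: of_nat_add of_nat_mult of_nat_numeral add_diff_cancel_right')
    qed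
    note k = this
    let ?x = "dp_eval v (fps_nth F (n - Suc i))"
    have L: "coeff (spec_poly v n (euler_op F)) i = - (of_nat (2 * (n - i) - 1) * ?x)"
    proof -
      have c: "i \<le> n" "n - i \<noteq> 0" using 3 by auto
      show ?thesis
        unfolding coeff_spec_poly euler_op_nth if_P[OF c(1)] if_not_P[OF c(2)] e dp_eval_uminus dp_eval_mult dp_eval_of_nat ..
    qed
    have R: "coeff (2 * pderiv (spec_poly v n F) -
       (if n = 0 then 0 else smult (of_nat (2 * n + 1)) (spec_poly v (n - 1) F))) i
       = 2 * (of_nat (Suc i) * ?x) - of_nat (2 * n + 1) * ?x"
    proof -
      have c: "Suc i \<le> n" "n \<noteq> 0" "i \<le> n - 1" using 3 by auto
      show ?thesis
        unfolding coeff_diff two coeff_pderiv coeff_smult coeff_spec_poly if_not_P[OF c(2)] if_P[OF c(1)]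
          coeff_smult coeff_spec_poly if_P[OF c(3)] e ..
    qed
    show ?thesis unfolding L R k left_diff_distrib mult.assoc minus_diff_eq ..
  qed (auto simp: coeff_spec_poly euler_op_nth two coeff_pderiv)
qed

lemma spec_poly_lenard:
  "spec_poly v N (lenard F) = spec_poly v N (fps_D (fps_D (fps_D F)))
     + smult (4 * v 0) (spec_poly v N (fps_D F)) + smult (2 * v 1) (spec_poly v N F)"
  unfolding lenard_def spec_poly_add spec_poly_numeral_mult spec_poly_const_mult by simp

text \<open>The equation multiplies by \<lambda>, which lifts the first coefficient below the cut,
  F_(N+1)', to the constant term.\<close>

lemma spec_poly_lenard_eq:
  fixes F :: "'a::field_char_0 dpoly fps"
  assumes "4 * fps_D F = fps_X * lenard F"
  shows "spec_poly v N (lenard F)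
    = smult 4 (pCons 0 (spec_poly v N (fps_D F))) + [:4 * dp_eval v (dp_deriv (fps_nth F (Suc N))):]"
proof -
  let ?c = "fps_const (dp_deriv (fps_nth F (Suc N))) :: 'a dpoly fps"
  have "spec_poly v (Suc N) (4 * fps_D (fps_trunc N F)) = spec_poly v (Suc N) (fps_X * lenard (fps_trunc N F))
      - spec_poly v (Suc N) (4 * (fps_X ^ Suc N * ?c))"
    unfolding lenard_trunc_eq[OF assms] spec_poly_diff by (simp add: mult.assoc)
  also have "spec_poly v (Suc N) (4 * (fps_X ^ Suc N * ?c)) = [:4 * dp_eval v (dp_deriv (fps_nth F (Suc N))):]"
    using spec_poly_X_power[of v "Suc N" 0 ?c]
    unfolding spec_poly_numeral_mult by (simp add: spec_poly_def monom_0 del: power_Suc)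
  also have "spec_poly v (Suc N) (fps_X * lenard (fps_trunc N F)) = spec_poly v N (lenard F)"
    using spec_poly_X_power[of v 1 N "lenard (fps_trunc N F)"] by (simp add: lenard_trunc spec_poly_trunc)
  also have "spec_poly v (Suc N) (4 * fps_D (fps_trunc N F)) = smult 4 (pCons 0 (spec_poly v N (fps_D F)))"
    unfolding spec_poly_numeral_mult by (subst spec_poly_Suc) (simp_all add: fps_D_trunc spec_poly_trunc)
  finally show ?thesis by (simp add: algebra_simps)
qed

text \<open>The largest differential ideal inside the kernel of evaluation at \<open>v\<close>; the
  kernel itself need not be closed under d/dx.\<close>

definition jet_ideal :: "(nat \<Rightarrow> 'a) \<Rightarrow> 'a::field_char_0 dpoly set" where
  "jet_ideal v = {p. \<forall>k. dp_eval v ((dp_deriv ^^ k) p) = 0}"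

lemma dp_diff_ideal_jet_ideal: "dp_diff_ideal (jet_ideal v)"
proof -
  have "dp_eval v ((dp_deriv ^^ k) (dp_deriv p)) = 0" if "\<forall>k. dp_eval v ((dp_deriv ^^ k) p) = 0" for k p
    using spec[OF that, of "Suc k"] by (simp add: funpow_swap1)
  then show ?thesis
    unfolding dp_diff_ideal_def jet_ideal_def
    by (auto simp: funpow_dp_deriv_add dp_eval_add funpow_dp_deriv_mult dp_eval_sum dp_eval_mult)
qed

lemma jet_idealD: "p \<in> jet_ideal v \<Longrightarrow> dp_eval v p = 0 \<and> dp_deriv p \<in> jet_ideal v"
proof
  assume p: "p \<in> jet_ideal v"
  then have "dp_eval v ((dp_deriv ^^ 0) p) = 0" unfolding jet_ideal_def by blast
  then show "dp_eval v p = 0" by simp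
  show "dp_deriv p \<in> jet_ideal v" using dp_diff_ideal_jet_ideal p by (auto simp: dp_diff_ideal_def)
qed

context
  fixes v :: "nat \<Rightarrow> 'a::field_char_0" and c :: "nat \<Rightarrow> 'a" and g n :: nat and B :: "'a dpoly fps"
  assumes B_def: "B = const_series g c * gd_fps"
    and string: "2 * dp_deriv (fps_nth B (Suc g)) + 1 \<in> jet_ideal v"
begin

text \<open>The congruence for \<beta> is differentiated twice in x, which gives the three series
  that make up \<beta>, \<alpha> and \<gamma>. Evaluation at the jet is legitimate each time because
  the ideal is closed under \<open>dp_deriv\<close>.\<close>

lemma spec_poly_flow:
  defines "d \<equiv> fps_der (flow_weight n)"
  shows "2 * spec_poly v g (d B) =
      2 * (spec_poly v n gd_fps * spec_poly v g (fps_D B) - spec_poly v n (fps_D gd_fps) * spec_poly v g B)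
      + spec_poly v n (euler_op gd_fps)" (is ?S0)
    and "2 * spec_poly v g (d (fps_D B)) =
      2 * (spec_poly v n gd_fps * spec_poly v g (fps_D (fps_D B)) - spec_poly v n (fps_D (fps_D gd_fps)) * spec_poly v g B)
      + spec_poly v n (euler_op (fps_D gd_fps))" (is ?S1)
    and "2 * spec_poly v g (d (fps_D (fps_D B))) =
      2 * (spec_poly v n (fps_D gd_fps) * spec_poly v g (fps_D (fps_D B)) + spec_poly v n gd_fps * spec_poly v g (fps_D (fps_D (fps_D B)))
         - spec_poly v n (fps_D (fps_D (fps_D gd_fps))) * spec_poly v g B - spec_poly v n (fps_D (fps_D gd_fps)) * spec_poly v g (fps_D B))
      + spec_poly v n (euler_op (fps_D (fps_D gd_fps)))" (is ?S2)
proof -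
  let ?R = "gd_fps :: 'a dpoly fps" and ?z = "fps_X :: 'a dpoly fps"
  let ?P = "fps_trunc n ?R" and ?B = "fps_trunc g B"
  define X where "X = 2 * (?z ^ n * d ?B - (?P * fps_D ?B - fps_D ?P * ?B)) - ?z ^ g * euler_op ?R"
  have X: "fps_nth X M \<in> jet_ideal v" if "M \<le> n + g" for M
    using hierarchy_flow_mod_ideal[OF B_def dp_diff_ideal_jet_ideal string that] unfolding X_def d_def .
  have X0: "spec_poly v (n + g) X = 0" "spec_poly v (n + g) (fps_D X) = 0" "spec_poly v (n + g) (fps_D (fps_D X)) = 0"
    using X by (auto simp: spec_poly_def jet_idealD)
  have comm: "d (fps_D F) = fps_D (d F)" for F :: "'a dpoly fps"
    unfolding d_def by (rule fps_der_fps_D) (rule flow_weight_Suc)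
  have X1: "fps_D X = 2 * (?z ^ n * d (fps_D ?B) - (?P * fps_D (fps_D ?B) - fps_D (fps_D ?P) * ?B)) - ?z ^ g * euler_op (fps_D ?R)"
    unfolding X_def fps_D_diff fps_D_mult fps_D_simps fps_D_euler_op comm by (simp add: algebra_simps)
  have X2: "fps_D (fps_D X) = 2 * (?z ^ n * d (fps_D (fps_D ?B)) - (fps_D ?P * fps_D (fps_D ?B) + ?P * fps_D (fps_D (fps_D ?B))
      - fps_D (fps_D (fps_D ?P)) * ?B - fps_D (fps_D ?P) * fps_D ?B)) - ?z ^ g * euler_op (fps_D (fps_D ?R))"
    unfolding X1 fps_D_diff fps_D_mult fps_D_simps fps_D_euler_op comm by (simp add: algebra_simps)
  have d: "d (fps_trunc N F) = fps_trunc N (d F)" for N F unfolding d_def by (rule fps_der_trunc)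
  have e: "spec_poly v (n + g) (?z ^ g * F) = spec_poly v n F" for F
    using spec_poly_X_power[of v g n F] by (simp add: add.commute)
  have two: "2 * p = smult 2 p" for p :: "'a poly" by (simp add: numeral_poly)
  note s = spec_poly_diff spec_poly_add spec_poly_numeral_mult fps_D_trunc d spec_poly_X_power spec_poly_mult_trunc e spec_poly_trunc
  show ?S0 using X0(1) unfolding X_def s two[symmetric] by (simp add: algebra_simps)
  show ?S1 using X0(2) unfolding X1 s two[symmetric] by (simp add: algebra_simps)
  show ?S2 using X0(3) unfolding X2 s two[symmetric] by (simp add: algebra_simps)
qed

text \<open>The constant term in \<open>spec_poly_lenard_eq\<close>, here 4 B_(g+1)' at the jet, is
  -2 by the string equation.\<close>

lemma spec_poly_lenard_B:
  "spec_poly v g (lenard B) = smult 4 (pCons 0 (spec_poly v g (fps_D B))) + [:- 2:]"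
proof -
  have "2 * dp_eval v (dp_deriv (fps_nth B (Suc g))) + 1 = 0"
    using jet_idealD[OF string] by (simp add: dp_eval_add dp_eval_mult dp_eval_numeral)
  then have "2 * dp_eval v (dp_deriv (fps_nth B (Suc g))) = - 1" by (simp add: eq_neg_iff_add_eq_0)
  then have "2 * (2 * dp_eval v (dp_deriv (fps_nth B (Suc g)))) = - 2" by simp
  then show ?thesis unfolding B_def spec_poly_lenard_eq[OF lenard_const_series_mult] by simp
qed

end

section \<open>Partial derivatives over a normed field\<close>

lemma norm_axis: "norm (axis i a) = norm (a :: 'a::real_normed_vector)"
proof -
  have "(\<Sum>k\<in>UNIV. (norm (axis i a $ k))\<^sup>2) = (\<Sum>k\<in>UNIV. if k = i then (norm a)\<^sup>2 else 0)"
    by (intro sum.cong) (auto simp: axis_def)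
  then show ?thesis by (simp add: norm_vec_def L2_set_def)
qed

lemma axis_add: "axis i (a + b) = axis i a + axis i (b :: 'a::real_normed_vector)"
  by (simp add: vec_eq_iff axis_def)

lemma axis_0 [simp]: "axis i (0 :: 'a::real_normed_vector) = 0"
  by (simp add: vec_eq_iff axis_def)

lemma continuous_on_axis [continuous_intros]:
  "continuous_on A f \<Longrightarrow> continuous_on A (\<lambda>x. axis i (f x) :: 'a::real_normed_vector ^ 'n::finite)"
proof -
  assume f: "continuous_on A f"
  have "bounded_linear (axis i :: 'a \<Rightarrow> 'a ^ 'n)"
  proof (rule bounded_linear_intro[where K = 1])
    fix a :: 'a and r :: real
    show "axis i (r *\<^sub>R a) = r *\<^sub>R axis i a" by (simp add: vec_eq_iff axis_def)
  qed (simp_all add: axis_add norm_axis)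
  then show ?thesis using f by (rule bounded_linear.continuous_on)
qed

lemma eventually_axis_in:
  fixes t :: "'a::real_normed_field ^ 'n::finite"
  assumes "open S" "t \<in> S"
  shows "eventually (\<lambda>s. t + axis i s \<in> S) (nhds 0)"
proof -
  have "open ((\<lambda>s. t + axis i s) -` S)"
    by (intro open_vimage assms continuous_intros)
  then show ?thesis using assms by (auto simp: eventually_nhds)
qed

lemma partial_cong:
  assumes "open S" "t \<in> S" "\<And>y. y \<in> S \<Longrightarrow> f y = h y"
  shows "partial i f t = partial i h t"
  unfolding partial_def
  by (rule deriv_cong_ev[OF eventually_mono[OF eventually_axis_in[OF assms(1,2), of i]]]) (simp_all add: assms(3))

lemma partialI: "((\<lambda>s. f (t + axis i s)) has_field_derivative d) (at 0) \<Longrightarrow> partial i f t = d"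
  unfolding partial_def by (rule DERIV_imp_deriv)

lemma Ck_on_partial: "Ck_on (Suc k) S f \<Longrightarrow> Ck_on k S (partial i f)"
  by simp

lemma smooth_fun_on_partial: "smooth_fun_on S f \<Longrightarrow> smooth_fun_on S (partial i f)"
  unfolding smooth_fun_on_def using Ck_on_partial by blast

lemma smooth_fun_on_continuous: "smooth_fun_on S f \<Longrightarrow> continuous_on S f"
  unfolding smooth_fun_on_def by (metis Ck_on.simps(1))

lemma smooth_fun_on_has_partial_0:
  assumes "smooth_fun_on S f" "t \<in> S"
  shows "((\<lambda>s. f (t + axis i s)) has_field_derivative partial i f t) (at 0)"
proof -
  have "Ck_on (Suc 0) S f" using assms(1) unfolding smooth_fun_on_def by blast
  then show ?thesis using assms(2) unfolding partial_def DERIV_deriv_iff_field_differentiable by simp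
qed

lemma smooth_fun_on_has_partial:
  assumes "smooth_fun_on S f" "t + axis i s \<in> S"
  shows "((\<lambda>s. f (t + axis i s)) has_field_derivative partial i f (t + axis i s)) (at s)"
proof -
  have "((\<lambda>r. f (t + axis i s + axis i r)) has_field_derivative partial i f (t + axis i s)) (at 0)"
    by (rule smooth_fun_on_has_partial_0[OF assms])
  then have "((\<lambda>r. f (t + axis i (r + s))) has_field_derivative partial i f (t + axis i s)) (at 0)"
    by (simp add: axis_add add.assoc add.commute[of "axis i s"])
  then show ?thesis using DERIV_shift[of "\<lambda>s. f (t + axis i s)" _ 0 s] by simp
qed

lemma smooth_fun_on_has_vector_partial:
  assumes "smooth_fun_on S f" "t + axis i (of_real a) \<in> S"
  shows "((\<lambda>a. f (t + axis i (of_real a))) has_vector_derivative partial i f (t + axis i (of_real a))) (at a within A)"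
  by (rule has_vector_derivative_real_field[OF smooth_fun_on_has_partial[OF assms]])

lemma vector_derivative_bound:
  fixes f :: "real \<Rightarrow> 'b::real_normed_vector"
  assumes f: "\<And>x. x \<in> {0..h} \<Longrightarrow> (f has_vector_derivative f' x) (at x within {0..h})"
    and B: "\<And>x. x \<in> {0..h} \<Longrightarrow> norm (f' x) \<le> B" and h: "h \<ge> 0"
  shows "norm (f h - f 0) \<le> B * h"
proof -
  have "norm (f h - f 0) \<le> B * norm (h - 0)"
  proof (rule differentiable_bound[of "{0..h}" f "\<lambda>x r. r *\<^sub>R f' x"])
    show "(f has_derivative (\<lambda>r. r *\<^sub>R f' x)) (at x within {0..h})" if "x \<in> {0..h}" for x
      using f[OF that] by (simp add: has_vector_derivative_def)
    show "onorm (\<lambda>r. r *\<^sub>R f' x) \<le> B" if "x \<in> {0..h}" for x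
    proof (rule onorm_bound)
      show "0 \<le> B" using B[OF that] norm_ge_zero order_trans by blast
      show "norm (r *\<^sub>R f' x) \<le> B * norm r" for r
        using mult_right_mono[OF B[OF that], of "norm r"] by (simp add: mult.commute)
    qed
  qed (use h in auto)
  then show ?thesis using h by simp
qed

text \<open>The mean value estimate is applied twice: along \<open>j\<close> for
  \<open>partial i f\<close>, then along \<open>i\<close> for the difference in direction
  \<open>j\<close>. Subtracting the terms linear in \<open>A\<close> first makes the bound depend
  only on the oscillation \<open>\<epsilon>\<close> of the mixed derivative.\<close>

lemma second_difference_bound:
  fixes f :: "'a::real_normed_field ^ 'n::finite \<Rightarrow> 'a"
  assumes f: "smooth_fun_on S f" and h: "h \<ge> 0"
    and S: "\<And>a b. a \<in> {0..h} \<Longrightarrow> b \<in> {0..h} \<Longrightarrow> t + axis i (of_real a) + axis j (of_real b) \<in> S"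
    and A: "\<And>a b. a \<in> {0..h} \<Longrightarrow> b \<in> {0..h} \<Longrightarrow>
      norm (partial j (partial i f) (t + axis i (of_real a) + axis j (of_real b)) - A) \<le> \<epsilon>"
  shows "norm ((f (t + axis i (of_real h) + axis j (of_real h)) - f (t + axis i (of_real h)))
      - (f (t + axis j (of_real h)) - f t) - h *\<^sub>R h *\<^sub>R A) \<le> \<epsilon> * h * h"
proof -
  let ?p = "\<lambda>a b. t + axis i (of_real a) + axis j (of_real b)"
  have inner: "norm (partial i f (?p a h) - partial i f (?p a 0) - h *\<^sub>R A) \<le> \<epsilon> * h" if a: "a \<in> {0..h}" for a
  proof -
    have "norm ((partial i f (?p a h) - h *\<^sub>R A) - (partial i f (?p a 0) - 0 *\<^sub>R A)) \<le> \<epsilon> * h"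
    proof (rule vector_derivative_bound[where f' = "\<lambda>b. partial j (partial i f) (?p a b) - A"])
      show "((\<lambda>b. partial i f (?p a b) - b *\<^sub>R A) has_vector_derivative partial j (partial i f) (?p a b) - A)
          (at b within {0..h})" if "b \<in> {0..h}" for b
        by (auto intro!: derivative_eq_intros smooth_fun_on_has_vector_partial[OF smooth_fun_on_partial[OF f] S[OF a that]])
    qed (use A a h in auto)
    then show ?thesis by (simp add: algebra_simps)
  qed
  let ?\<phi> = "\<lambda>a. f (?p a h) - f (?p a 0) - a *\<^sub>R h *\<^sub>R A"
  have swap: "?p a b = (t + axis j (of_real b)) + axis i (of_real a)" for a b by (simp add: algebra_simps)
  have "norm (?\<phi> h - ?\<phi> 0) \<le> (\<epsilon> * h) * h"
  proof (rule vector_derivative_bound[where f' = "\<lambda>a. partial i f (?p a h) - partial i f (?p a 0) - h *\<^sub>R A"])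
    fix a assume a: "a \<in> {0..h}"
    have d: "((\<lambda>a. f (?p a b)) has_vector_derivative partial i f (?p a b)) (at a within {0..h})" if "b \<in> {0..h}" for b
      using smooth_fun_on_has_vector_partial[OF f, of "t + axis j (of_real b)" i a "{0..h}"] S[OF a that]
      by (simp add: swap)
    show "(?\<phi> has_vector_derivative partial i f (?p a h) - partial i f (?p a 0) - h *\<^sub>R A) (at a within {0..h})"
      using h d[of 0] by (auto intro!: derivative_eq_intros d)
  qed (use inner h in auto)
  then show ?thesis by (simp add: algebra_simps)
qed

text \<open>
  The field is not known to be complete, so the symmetry is derived from mean value estimates
  along real directions instead of an integral representation.
\<close>

lemma partial_commute:
  fixes f :: "'a::real_normed_field ^ 'n::finite \<Rightarrow> 'a"
  assumes S: "open S" and f: "smooth_fun_on S f" and t: "t \<in> S"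
  shows "partial j (partial i f) t = partial i (partial j f) t"
proof (rule ccontr)
  let ?A = "partial j (partial i f)" and ?C = "partial i (partial j f)"
  assume ne: "?A t \<noteq> ?C t"
  \<comment> \<open>Both orders of differentiation will lie within \<open>\<epsilon>\<close> of the
    same difference quotient, hence within 2 \<open>\<epsilon>\<close> of each other, which is half
    their supposed distance.\<close>
  define \<epsilon> where "\<epsilon> = norm (?A t - ?C t) / 4"
  have \<epsilon>: "\<epsilon> > 0" using ne by (simp add: \<epsilon>_def)
  have close: "eventually (\<lambda>y. norm (F y - F t) < \<epsilon>) (nhds t)" if "smooth_fun_on S F" for F
  proof -
    have "isCont F t" using smooth_fun_on_continuous[OF that] S t by (simp add: continuous_on_eq_continuous_at)
    then have "eventually (\<lambda>y. dist (F y) (F t) < \<epsilon>) (nhds t)"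
      unfolding isCont_def using tendstoD[of F "F t" "nhds t", OF _ \<epsilon>] by (simp add: tendsto_at_iff_tendsto_nhds)
    then show ?thesis by (simp add: dist_norm)
  qed
  have "eventually (\<lambda>y. y \<in> S \<and> norm (?A y - ?A t) < \<epsilon> \<and> norm (?C y - ?C t) < \<epsilon>) (nhds t)"
    using S t by (intro eventually_conj close smooth_fun_on_partial f eventually_nhds_in_open)
  then obtain r where r: "r > 0" "\<And>y. dist y t < r \<Longrightarrow> y \<in> S \<and> norm (?A y - ?A t) < \<epsilon> \<and> norm (?C y - ?C t) < \<epsilon>"
    unfolding eventually_nhds_metric by blast
  define h where "h = r / 4"
  have h: "h > 0" using r by (simp add: h_def)
  have near: "dist (t + axis k (of_real a) + axis l (of_real b)) t < r" if "a \<in> {0..h}" "b \<in> {0..h}" for a b and k l :: 'n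
  proof -
    have "dist (t + axis k (of_real a) + axis l (of_real b)) t = norm (axis k (of_real a :: 'a) + axis l (of_real b))"
      by (simp add: dist_norm add.assoc)
    also have "\<dots> \<le> norm (axis k (of_real a :: 'a)) + norm (axis l (of_real b :: 'a))" by (rule norm_triangle_ineq)
    also have "\<dots> = a + b" using that by (simp add: norm_axis)
    also have "\<dots> < r" using that r(1) by (simp add: h_def)
    finally show ?thesis .
  qed
  let ?D = "(f (t + axis i (of_real h) + axis j (of_real h)) - f (t + axis i (of_real h))) - (f (t + axis j (of_real h)) - f t)"
  have 1: "norm (?D - h *\<^sub>R h *\<^sub>R ?A t) \<le> \<epsilon> * h * h"
    by (rule second_difference_bound[OF f]) (use r(2) near h in \<open>auto intro: less_imp_le\<close>)
  have "norm ((f (t + axis j (of_real h) + axis i (of_real h)) - f (t + axis j (of_real h)))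
      - (f (t + axis i (of_real h)) - f t) - h *\<^sub>R h *\<^sub>R ?C t) \<le> \<epsilon> * h * h"
    by (rule second_difference_bound[OF f]) (use r(2) near h in \<open>auto intro: less_imp_le\<close>)
  then have 2: "norm (?D - h *\<^sub>R h *\<^sub>R ?C t) \<le> \<epsilon> * h * h"
    by (simp add: algebra_simps)
  have "norm (h *\<^sub>R h *\<^sub>R (?A t - ?C t)) \<le> \<epsilon> * h * h + \<epsilon> * h * h"
    using norm_triangle_ineq4[of "?D - h *\<^sub>R h *\<^sub>R ?C t" "?D - h *\<^sub>R h *\<^sub>R ?A t"] 1 2 by (simp add: scaleR_diff_right)
  moreover have "norm (h *\<^sub>R h *\<^sub>R (?A t - ?C t)) = h * h * norm (?A t - ?C t)" using h by simp
  ultimately have "(h * h) * norm (?A t - ?C t) \<le> (h * h) * (2 * \<epsilon>)" by (simp only: mult_2 distrib_left mult_ac)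
  then have "norm (?A t - ?C t) \<le> 2 * \<epsilon>" using h by simp
  then show False using \<epsilon> by (simp add: \<epsilon>_def)
qed

text \<open>Chain rule along a curve of jets: both sides obey the sum and product rules in
  \<open>p\<close>, so only the coordinates need checking.\<close>

lemma dp_eval_has_derivative:
  fixes v :: "'a::real_normed_field \<Rightarrow> nat \<Rightarrow> 'a"
  assumes "\<And>k. ((\<lambda>s. v s k) has_field_derivative dp_eval (v s\<^sub>0) (w k)) (at s\<^sub>0)"
  shows "((\<lambda>s. dp_eval (v s) p) has_field_derivative dp_eval (v s\<^sub>0) (dp_der w p)) (at s\<^sub>0)"
proof (induction p rule: dpoly_induct)
  case (add p q)
  then show ?case by (auto simp: dp_eval_add dp_der_add intro: DERIV_add)
next
  case (mult p q)
  then show ?case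
    using DERIV_mult[OF mult] by (simp add: dp_eval_add dp_eval_mult dp_der_mult add.commute mult.commute)
qed (use assms in simp_all)


section \<open>The Lax equations\<close>

locale PI_hierarchy =
  fixes g :: nat and ix :: "nat \<Rightarrow> 'n::finite" and S :: "('a::real_normed_field ^ 'n) set" and u :: "'a ^ 'n \<Rightarrow> 'a"
  assumes bij: "bij_betw ix {0..g} UNIV" and sol: "PI_solution g ix S u"
begin

abbreviation (input) jet :: "'a ^ 'n \<Rightarrow> nat \<Rightarrow> 'a" where
  "jet t k \<equiv> (partial (ix 0) ^^ k) u t"

lemma open_S: "open S" and smooth_u: "smooth_fun_on S u"
  using sol by (auto simp: PI_solution_def)

lemma smooth_jet: "smooth_fun_on S (\<lambda>t. jet t k)"
  by (induction k) (simp_all add: smooth_u smooth_fun_on_partial)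

lemma ix_eq_iff: "i \<le> g \<Longrightarrow> j \<le> g \<Longrightarrow> ix i = ix j \<longleftrightarrow> i = j"
  using bij by (auto simp: bij_betw_def inj_on_def)

lemma dp_eval_jet_x:
  assumes "t \<in> S"
  shows "((\<lambda>s. dp_eval (jet (t + axis (ix 0) s)) p) has_field_derivative dp_eval (jet t) (dp_deriv p)) (at 0)"
proof -
  have "((\<lambda>s. dp_eval (jet (t + axis (ix 0) s)) p) has_field_derivative
      dp_eval (jet (t + axis (ix 0) 0)) (dp_der (\<lambda>k. dp_u (Suc k)) p)) (at 0)"
  proof (rule dp_eval_has_derivative)
    fix k
    show "((\<lambda>s. jet (t + axis (ix 0) s) k) has_field_derivative dp_eval (jet (t + axis (ix 0) 0)) (dp_u (Suc k))) (at 0)"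
      using smooth_fun_on_has_partial_0[OF smooth_jet[of k] assms, of "ix 0"] by simp
  qed
  then show ?thesis by (simp add: dp_deriv_eq_dp_der)
qed

lemma partial_dp_eval_jet:
  "t \<in> S \<Longrightarrow> partial (ix 0) (\<lambda>t. dp_eval (jet t) p) t = dp_eval (jet t) (dp_deriv p)"
  by (rule partialI[OF dp_eval_jet_x])

lemma partial_PI_R:
  assumes "t \<in> S"
  shows "partial (ix 0) (PI_R ix u k) t = dp_eval (jet t) (dp_deriv (gelfand_dickey k))"
    and "partial (ix 0) (partial (ix 0) (PI_R ix u k)) t = dp_eval (jet t) (dp_deriv (dp_deriv (gelfand_dickey k)))"
proof -
  have 1: "partial (ix 0) (PI_R ix u k) t = dp_eval (jet t) (dp_deriv (gelfand_dickey k))" if "t \<in> S" for t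
    using partial_dp_eval_jet[OF that, of "gelfand_dickey k"] unfolding PI_R_def .
  then show "partial (ix 0) (PI_R ix u k) t = dp_eval (jet t) (dp_deriv (gelfand_dickey k))" using assms .
  show "partial (ix 0) (partial (ix 0) (PI_R ix u k)) t = dp_eval (jet t) (dp_deriv (dp_deriv (gelfand_dickey k)))"
    using partial_cong[OF open_S assms 1] partial_dp_eval_jet[OF assms] by simp
qed

text \<open>Mixed partials commute, so the flow of u^(k) is the k-th x-derivative of the flow of u.
  For n = 0 the prescribed value 2 R_1' is u' itself.\<close>

lemma partial_jet:
  assumes n: "n \<le> g" and t: "t \<in> S"
  shows "partial (ix n) (\<lambda>t. jet t k) t = dp_eval (jet t) (flow_weight n k)"
  using t
proof (induction k arbitrary: t)
  case (0 t)
  have R: "dp_eval (jet t) (flow_weight n 0) = 2 * partial (ix 0) (PI_R ix u (Suc n)) t"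
    unfolding flow_weight_0 dp_eval_mult dp_eval_numeral partial_PI_R[OF 0] ..
  show ?case
  proof (cases "n = 0")
    case True
    have "2 * dp_deriv (gelfand_dickey (Suc 0)) = (dp_u (Suc 0) :: 'a dpoly)"
      using arg_cong[OF gelfand_dickey_1[where 'a = 'a], of dp_deriv] by (simp only: mult_2 dp_deriv_add dp_deriv_simps)
    then show ?thesis unfolding True flow_weight_0 by simp
  next
    case False
    then have "partial (ix n) u t = 2 * partial (ix 0) (PI_R ix u (n + 1)) t"
      using sol 0 n unfolding PI_solution_def by auto
    then show ?thesis using R by simp
  qed
next
  case (Suc k t)
  have "partial (ix n) (\<lambda>t. jet t (Suc k)) t = partial (ix 0) (partial (ix n) (\<lambda>t. jet t k)) t"
    using partial_commute[OF open_S smooth_jet[of k] Suc.prems, of "ix n" "ix 0"] by simp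
  also have "\<dots> = partial (ix 0) (\<lambda>t. dp_eval (jet t) (flow_weight n k)) t"
    by (rule partial_cong[OF open_S Suc.prems Suc.IH])
  finally show ?case by (simp add: partial_dp_eval_jet[OF Suc.prems] flow_weight_Suc)
qed

lemma dp_eval_jet_flow:
  assumes n: "n \<le> g" and t: "t \<in> S"
  shows "((\<lambda>s. dp_eval (jet (t + axis (ix n) s)) p) has_field_derivative
    dp_eval (jet t) (dp_der (flow_weight n) p)) (at 0)"
proof -
  have "((\<lambda>s. dp_eval (jet (t + axis (ix n) s)) p) has_field_derivative
      dp_eval (jet (t + axis (ix n) 0)) (dp_der (flow_weight n) p)) (at 0)"
  proof (rule dp_eval_has_derivative)
    fix k
    show "((\<lambda>s. jet (t + axis (ix n) s) k) has_field_derivative dp_eval (jet (t + axis (ix n) 0)) (flow_weight n k)) (at 0)"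
      using smooth_fun_on_has_partial_0[OF smooth_jet[of k] t, of "ix n"] partial_jet[OF n t, of k] by simp
  qed
  then show ?thesis by simp
qed

section \<open>The string equation and its x-derivatives along a solution\<close>

abbreviation (input) V_series :: "'a ^ 'n \<Rightarrow> 'a dpoly fps" where
  "V_series t \<equiv> const_series g (\<lambda>i. PI_c g ix i t) * gd_fps"

lemma PI_c_x: "i \<le> g \<Longrightarrow> PI_c g ix i (t + axis (ix 0) s) = PI_c g ix i t"
  using ix_eq_iff[of "g - i + 1" 0] by (auto simp: PI_c_def axis_def)

lemma V_series_x: "V_series (t + axis (ix 0) s) = V_series t"
proof -
  have "const_series g (\<lambda>i. PI_c g ix i (t + axis (ix 0) s)) = const_series g (\<lambda>i. PI_c g ix i t)"
    by (rule fps_ext) (simp add: const_series_nth PI_c_x)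
  then show ?thesis by simp
qed

text \<open>Apart from x, the left side of the string equation is twice the coefficient of z^(g+1)
  in c R; no term with R_0 occurs because \<open>const_series\<close> stops at
  \<open>g\<close>.\<close>

lemma string_eq:
  assumes "t \<in> S"
  shows "2 * dp_eval (jet t) (fps_nth (V_series t) (Suc g)) + t $ ix 0 = 0"
proof -
  have "dp_eval (jet t) (fps_nth (V_series t) (Suc g)) = (\<Sum>i=0..Suc g. if i \<le> g then PI_c g ix i t * PI_R ix u (Suc g - i) t else 0)"
    unfolding fps_mult_nth dp_eval_sum
    by (intro sum.cong refl) (auto simp: const_series_nth dp_eval_mult PI_R_def)
  also have "\<dots> = (\<Sum>i=0..g. PI_c g ix i t * PI_R ix u (Suc g - i) t)"
    by (rule sum.mono_neutral_cong_right) auto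
  also have "\<dots> = PI_R ix u (Suc g) t + (\<Sum>i=1..g. PI_c g ix i t * PI_R ix u (Suc g - i) t)"
    by (simp add: sum.atLeast_Suc_atMost PI_c_def)
  finally show ?thesis
    using sol assms by (simp add: PI_solution_def distrib_left sum_distrib_left mult.assoc)
qed

text \<open>Moving along x leaves every c_i unchanged, so the same differential polynomial serves at
  all nearby points. An equation valid on the open set \<open>S\<close> then passes to all its
  x-derivatives.\<close>

lemma string_in_jet_ideal:
  assumes "t \<in> S"
  shows "2 * dp_deriv (fps_nth (V_series t) (Suc g)) + 1 \<in> jet_ideal (jet t)"
proof -
  let ?q = "\<lambda>t. 2 * dp_deriv (fps_nth (V_series t) (Suc g)) + 1"
  have nbhd: "eventually (\<lambda>s. t + axis (ix 0) s \<in> S) (nhds 0)" if "t \<in> S" for t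
    by (rule eventually_axis_in[OF open_S that])
  have base: "dp_eval (jet t) (?q t) = 0" if t: "t \<in> S" for t
  proof -
    let ?p = "fps_nth (V_series t) (Suc g)"
    have "((\<lambda>s. 2 * dp_eval (jet (t + axis (ix 0) s)) ?p + (t + axis (ix 0) s) $ ix 0) has_field_derivative
        2 * dp_eval (jet t) (dp_deriv ?p) + 1) (at 0)"
      by (auto intro!: derivative_eq_intros dp_eval_jet_x[OF t])
    moreover have "((\<lambda>s. 2 * dp_eval (jet (t + axis (ix 0) s)) ?p + (t + axis (ix 0) s) $ ix 0) has_field_derivative 0) (at 0)"
    proof (subst DERIV_cong_ev[OF refl _ refl])
      show "eventually (\<lambda>s. 2 * dp_eval (jet (t + axis (ix 0) s)) ?p + (t + axis (ix 0) s) $ ix 0 = 0) (nhds 0)"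
        using nbhd[OF t] by eventually_elim (use string_eq V_series_x in metis)
    qed simp
    ultimately have "2 * dp_eval (jet t) (dp_deriv ?p) + 1 = 0" by (rule DERIV_unique)
    then show ?thesis by (simp only: dp_eval_add dp_eval_mult dp_eval_numeral dp_eval_1)
  qed
  have "dp_eval (jet t) ((dp_deriv ^^ k) (?q t)) = 0" if "t \<in> S" for t k
    using that
  proof (induction k arbitrary: t)
    case 0
    then show ?case by (simp only: funpow_0 base)
  next
    case (Suc k t)
    have "((\<lambda>s. dp_eval (jet (t + axis (ix 0) s)) ((dp_deriv ^^ k) (?q t))) has_field_derivative 0) (at 0)"
    proof (subst DERIV_cong_ev[OF refl _ refl])
      show "eventually (\<lambda>s. dp_eval (jet (t + axis (ix 0) s)) ((dp_deriv ^^ k) (?q t)) = 0) (nhds 0)"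
        using nbhd[OF Suc.prems] by eventually_elim (use Suc.IH V_series_x in metis)
    qed simp
    from DERIV_unique[OF dp_eval_jet_x[OF Suc.prems] this] show ?case by (simp only: funpow.simps o_def)
  qed
  then show ?thesis using assms unfolding jet_ideal_def by blast
qed

end

text \<open>Polynomial parts taken separately at the exponents N - i add up to the polynomial part
  of the product series. N = g gives V, and N = n < g gives the combinations of the U_k that the
  Hamiltonians produce.\<close>

lemma spec_poly_const_series:
  assumes "N \<le> g"
  shows "(\<Sum>i\<le>N. smult (c i) (spec_poly v (N - i) F)) = spec_poly v N (const_series g c * F)"
proof (rule poly_eqI)
  fix j
  show "coeff (\<Sum>i\<le>N. smult (c i) (spec_poly v (N - i) F)) j = coeff (spec_poly v N (const_series g c * F)) j"
  proof (cases "j \<le> N")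
    case True
    have "coeff (\<Sum>i\<le>N. smult (c i) (spec_poly v (N - i) F)) j
        = (\<Sum>i\<in>{0..N - j}. c i * dp_eval v (fps_nth F (N - j - i)))"
      unfolding coeff_sum
    proof (rule sum.mono_neutral_cong_right)
      fix i assume "i \<in> {0..N - j}"
      then have "j \<le> N - i" "N - i - j = N - j - i" using True by auto
      then show "coeff (smult (c i) (spec_poly v (N - i) F)) j = c i * dp_eval v (fps_nth F (N - j - i))"
        unfolding coeff_smult coeff_spec_poly by simp
    qed (use True in \<open>auto simp: coeff_spec_poly\<close>)
    also have "\<dots> = coeff (spec_poly v N (const_series g c * F)) j"
      unfolding coeff_spec_poly fps_mult_nth if_P[OF True] dp_eval_sum
      using assms by (intro sum.cong refl) (auto simp: const_series_nth dp_eval_mult)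
    finally show ?thesis .
  qed (auto simp: coeff_sum coeff_spec_poly intro!: sum.neutral)
qed

context PI_hierarchy
begin

section \<open>Time derivatives of the entries of V\<close>

lemma PI_B_eq: "PI_B ix u n t = spec_poly (jet t) n gd_fps"
  unfolding PI_B_def spec_poly_def PI_R_def gd_fps_nth ..

lemma PI_A_eq: "t \<in> S \<Longrightarrow> PI_A ix u n t = smult (- 1 / 2) (spec_poly (jet t) n (fps_D gd_fps))"
  unfolding PI_A_def spec_poly_def fps_map_nth gd_fps_nth by (simp only: partial_PI_R)

lemma PI_Gamma_eq: "t \<in> S \<Longrightarrow> PI_Gamma ix u n t =
    smult (- 1 / 2) (spec_poly (jet t) n (fps_D (fps_D gd_fps))) + [:- u t, 1:] * spec_poly (jet t) n gd_fps"
  unfolding PI_Gamma_def PI_B_eq unfolding spec_poly_def fps_map_nth gd_fps_nth by (simp only: partial_PI_R)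

text \<open>Written as a sum so that the product rule sees the time dependence of the c_i;
  \<open>V_sum_eq\<close> gives the form with frozen c_i in which the algebra was done.\<close>

definition V_sum :: "'a \<Rightarrow> 'a dpoly fps \<Rightarrow> 'a ^ 'n \<Rightarrow> 'a" where
  "V_sum l F t = (\<Sum>i\<le>g. PI_c g ix i t * poly (spec_poly (jet t) (g - i) F) l)"

lemma V_sum_eq: "V_sum l F t = poly (spec_poly (jet t) g (const_series g (\<lambda>i. PI_c g ix i t) * F)) l"
  unfolding V_sum_def spec_poly_const_series[OF order.refl, symmetric] by (simp add: poly_sum)

text \<open>The variable t_(2n+1) occurs in c_(g+1-n) only; for n = 0 this index exceeds
  \<open>g\<close>, in accordance with no c_i depending on x.\<close>

lemma PI_c_has_derivative:
  fixes t :: "'a ^ 'n"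
  assumes "i \<le> g" "n \<le> g"
  shows "((\<lambda>s. PI_c g ix i (t + axis (ix n) s)) has_field_derivative
    (if i = g + 1 - n then of_nat (2 * n + 1) / 2 else 0)) (at 0)"
proof (cases "i = 0")
  case True
  then have "i \<noteq> g + 1 - n" using assms(2) by auto
  then show ?thesis using True by (simp add: PI_c_def)
next
  case False
  show ?thesis
  proof (cases "i = g + 1 - n")
    case True
    then have n: "g - i + 1 = n" "2 * (g - i) + 3 = 2 * n + 1" using False assms by auto
    have "((\<lambda>s. of_nat (2 * n + 1) / 2 * (t + axis (ix n) s) $ ix n) has_field_derivative of_nat (2 * n + 1) / 2) (at 0)"
      by (auto intro!: derivative_eq_intros)
    then show ?thesis using False unfolding PI_c_def n if_P[OF True] by (simp only: if_False simp_thms)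
  next
    case i: False
    then have "g - i + 1 \<noteq> n" using False assms by auto
    then have "ix (g - i + 1) \<noteq> ix n" using False assms by (subst ix_eq_iff) auto
    then have "axis (ix n) s $ ix (g - i + 1) = 0" for s :: 'a by (simp add: axis_def)
    then show ?thesis using i False unfolding PI_c_def by simp
  qed
qed

lemma V_sum_has_derivative:
  assumes n: "n \<le> g" and t: "t \<in> S"
  shows "((\<lambda>s. V_sum l F (t + axis (ix n) s)) has_field_derivative
      (if n = 0 then 0 else of_nat (2 * n + 1) / 2 * poly (spec_poly (jet t) (n - 1) F) l)
      + V_sum l (fps_der (flow_weight n) F) t) (at 0)"
proof -
  have p: "((\<lambda>s. poly (spec_poly (jet (t + axis (ix n) s)) N F) l) has_field_derivative
      poly (spec_poly (jet t) N (fps_der (flow_weight n) F)) l) (at 0)" for N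
    unfolding spec_poly_def poly_sum poly_monom fps_map_nth
    by (intro DERIV_sum DERIV_cmult_right dp_eval_jet_flow n t)
  have "((\<lambda>s. V_sum l F (t + axis (ix n) s)) has_field_derivative
      (\<Sum>i\<le>g. (if i = g + 1 - n then of_nat (2 * n + 1) / 2 else 0) * poly (spec_poly (jet t) (g - i) F) l
        + poly (spec_poly (jet t) (g - i) (fps_der (flow_weight n) F)) l * PI_c g ix i t)) (at 0)"
    unfolding V_sum_def
  proof (rule DERIV_sum)
    fix i assume "i \<in> {..g}"
    then have "i \<le> g" by simp
    from DERIV_mult[OF PI_c_has_derivative[OF this n] p]
    show "((\<lambda>s. PI_c g ix i (t + axis (ix n) s) * poly (spec_poly (jet (t + axis (ix n) s)) (g - i) F) l) has_field_derivative
        (if i = g + 1 - n then of_nat (2 * n + 1) / 2 else 0) * poly (spec_poly (jet t) (g - i) F) l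
        + poly (spec_poly (jet t) (g - i) (fps_der (flow_weight n) F)) l * PI_c g ix i t) (at 0)"
      by (simp only: axis_0 add_0_right)
  qed
  moreover have "(\<Sum>i\<le>g. (if i = g + 1 - n then of_nat (2 * n + 1) / 2 else 0) * poly (spec_poly (jet t) (g - i) F) l)
      = (if n = 0 then 0 else of_nat (2 * n + 1) / 2 * poly (spec_poly (jet t) (n - 1) F) l)"
  proof -
    have "(\<Sum>i\<le>g. (if i = g + 1 - n then of_nat (2 * n + 1) / 2 else 0) * poly (spec_poly (jet t) (g - i) F) l)
      = (\<Sum>i\<le>g. if i = g + 1 - n then of_nat (2 * n + 1) / 2 * poly (spec_poly (jet t) (n - 1) F) l else 0)"
    proof (intro sum.cong refl)
      fix i assume i: "i \<in> {..g}"
      have "g - i = n - 1" if "i = g + 1 - n" using that i n by auto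
      then show "(if i = g + 1 - n then of_nat (2 * n + 1) / 2 else 0) * poly (spec_poly (jet t) (g - i) F) l
        = (if i = g + 1 - n then of_nat (2 * n + 1) / 2 * poly (spec_poly (jet t) (n - 1) F) l else 0)" by simp
    qed
    also have "\<dots> = (if n = 0 then 0 else of_nat (2 * n + 1) / 2 * poly (spec_poly (jet t) (n - 1) F) l)"
      unfolding sum.delta[OF finite_atMost] using n by auto
    finally show ?thesis .
  qed
  ultimately show ?thesis unfolding sum.distrib V_sum_def by (simp only: mult.commute)
qed

text \<open>\<open>x k\<close> and \<open>y k\<close> are the k-th x-derivatives of \<beta> and of
  B_n at \<lambda> = l, and \<open>p k\<close> is the \<lambda>-derivative of the latter. The last
  two claims eliminate third x-derivatives, which do not occur in the matrix entries.\<close>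

lemma V_sum_flow:
  fixes l :: 'a
  assumes n: "n \<le> g" and t: "t \<in> S"
    and y_def: "y = (\<lambda>k. poly (spec_poly (jet t) n ((fps_D ^^ k) gd_fps)) l)"
    and x_def: "x = (\<lambda>k. V_sum l ((fps_D ^^ k) gd_fps) t)"
    and p_def: "p = (\<lambda>k. poly (pderiv (spec_poly (jet t) n ((fps_D ^^ k) gd_fps))) l)"
  shows "((\<lambda>s. V_sum l gd_fps (t + axis (ix n) s)) has_field_derivative y 0 * x 1 - y 1 * x 0 + p 0) (at 0)"
    and "((\<lambda>s. V_sum l (fps_D gd_fps) (t + axis (ix n) s)) has_field_derivative y 0 * x 2 - y 2 * x 0 + p 1) (at 0)"
    and "((\<lambda>s. V_sum l (fps_D (fps_D gd_fps)) (t + axis (ix n) s)) has_field_derivative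
           y 1 * x 2 + y 0 * x 3 - y 3 * x 0 - y 2 * x 1 + p 2) (at 0)"
    and "x 3 = 4 * (l - u t) * x 1 - 2 * partial (ix 0) u t * x 0 - 2"
    and "y 3 = 4 * (l - u t) * y 1 - 2 * partial (ix 0) u t * y 0 + 2 * dp_eval (jet t) (flow_weight n 0)"
proof -
  let ?v = "jet t" and ?c = "const_series g (\<lambda>i. PI_c g ix i t)"
  let ?q = "\<lambda>F. if n = 0 then 0 else of_nat (2 * n + 1) * poly (spec_poly ?v (n - 1) F) l"
  have D: "fps_D (?c * F) = ?c * fps_D F" for F unfolding fps_D_mult by simp
  have d: "fps_der w (?c * F) = ?c * fps_der w F" for w F unfolding fps_der_mult by simp
  note str = string_in_jet_ideal[OF t]
  note flow = spec_poly_flow[OF refl str, where n = n, unfolded D d]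
  have two: "poly (2 * f) l = 2 * poly f l" for f :: "'a poly" by (simp add: numeral_poly)
  have e: "poly (spec_poly ?v n (euler_op F)) l = 2 * poly (pderiv (spec_poly ?v n F)) l - ?q F" for F
    unfolding spec_poly_euler_op poly_diff two by simp
  \<comment> \<open>The term \<open>?q\<close> comes with sign plus from the explicit time
    dependence of V and with sign minus from \<open>euler_op\<close>; what remains is the
    \<lambda>-derivative that makes up U_n'.\<close>
  have half: "(if n = 0 then 0 else of_nat (2 * n + 1) / 2 * poly (spec_poly ?v (n - 1) F) l) + z = b + r"
    if "2 * z = 2 * b + (2 * r - ?q F)" for F and z b r :: 'a
  proof -
    have "2 * ((if n = 0 then 0 else of_nat (2 * n + 1) / 2 * poly (spec_poly ?v (n - 1) F) l) + z) = ?q F + 2 * z"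
      by (simp add: distrib_left)
    also have "\<dots> = 2 * (b + r)" unfolding that by (simp add: algebra_simps)
    finally show ?thesis by (simp only: mult_cancel_left) simp
  qed
  have k: "(fps_D ^^ 1) F = fps_D F" "(fps_D ^^ 2) F = fps_D (fps_D F)" "(fps_D ^^ 3) F = fps_D (fps_D (fps_D F))"
    for F :: "'a dpoly fps" by (simp_all add: eval_nat_numeral)
  note xyp = x_def y_def p_def V_sum_eq k funpow_0
  note poly_eq = arg_cong[where f = "\<lambda>f. poly f l"]
  show "((\<lambda>s. V_sum l gd_fps (t + axis (ix n) s)) has_field_derivative y 0 * x 1 - y 1 * x 0 + p 0) (at 0)"
    using V_sum_has_derivative[OF n t, of l gd_fps] half[OF poly_eq[OF flow(1), unfolded poly_add two e, unfolded poly_mult poly_add poly_diff]] unfolding xyp by simp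
  show "((\<lambda>s. V_sum l (fps_D gd_fps) (t + axis (ix n) s)) has_field_derivative y 0 * x 2 - y 2 * x 0 + p 1) (at 0)"
    using V_sum_has_derivative[OF n t, of l "fps_D gd_fps"] half[OF poly_eq[OF flow(2), unfolded poly_add two e, unfolded poly_mult poly_add poly_diff]] unfolding xyp by simp
  show "((\<lambda>s. V_sum l (fps_D (fps_D gd_fps)) (t + axis (ix n) s)) has_field_derivative
           y 1 * x 2 + y 0 * x 3 - y 3 * x 0 - y 2 * x 1 + p 2) (at 0)"
    using V_sum_has_derivative[OF n t, of l "fps_D (fps_D gd_fps)"] half[OF poly_eq[OF flow(3), unfolded poly_add two e, unfolded poly_mult poly_add poly_diff]] unfolding xyp by simp
  show "x 3 = 4 * (l - u t) * x 1 - 2 * partial (ix 0) u t * x 0 - 2"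
    using poly_eq[OF spec_poly_lenard_B[OF refl str]] unfolding spec_poly_lenard D xyp
    by (simp add: algebra_simps eq_diff_eq)
  show "y 3 = 4 * (l - u t) * y 1 - 2 * partial (ix 0) u t * y 0 + 2 * dp_eval (jet t) (flow_weight n 0)"
    using poly_eq[OF spec_poly_lenard_eq[OF lenard_gd_fps, of ?v n]]
    unfolding spec_poly_lenard xyp flow_weight_0 dp_eval_mult dp_eval_numeral gd_fps_nth
    by (simp add: algebra_simps eq_diff_eq del: gelfand_dickey.simps)
qed

section \<open>The matrix Lax equation\<close>

lemma PI_U_entries:
  "PI_U ix u n t $ 1 $ 1 = PI_A ix u n t" "PI_U ix u n t $ 1 $ 2 = PI_B ix u n t"
  "PI_U ix u n t $ 2 $ 1 = PI_Gamma ix u n t" "PI_U ix u n t $ 2 $ 2 = - PI_A ix u n t"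
  by (simp_all add: PI_U_def mat2_def)

lemma PI_V_entries:
  assumes "t \<in> S"
  shows "poly (PI_V g ix u t $ 1 $ 1) l = - 1 / 2 * V_sum l (fps_D gd_fps) t"
    and "poly (PI_V g ix u t $ 1 $ 2) l = V_sum l gd_fps t"
    and "poly (PI_V g ix u t $ 2 $ 1) l = - 1 / 2 * V_sum l (fps_D (fps_D gd_fps)) t + (l - u t) * V_sum l gd_fps t"
    and "poly (PI_V g ix u t $ 2 $ 2) l = - poly (PI_V g ix u t $ 1 $ 1) l"
  unfolding PI_V_def vec_lambda_beta PI_U_entries PI_A_eq[OF assms] PI_B_eq PI_Gamma_eq[OF assms] V_sum_def
  by (simp_all add: poly_sum sum_distrib_left sum_negf sum.distrib[symmetric] algebra_simps)

theorem lax_equation: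
  assumes n: "n \<le> g" and t: "t \<in> S"
  shows "((\<lambda>s. eval_mat (PI_V g ix u (t + axis (ix n) s)) l $ a $ b) has_field_derivative
    (eval_mat (commutator (PI_U ix u n t) (PI_V g ix u t)) l
      + eval_mat (\<chi> i j. pderiv (PI_U ix u n t $ i $ j)) l) $ a $ b) (at 0)"
proof -
  let ?R = "gd_fps :: 'a dpoly fps" and ?d = "\<lambda>s. t + axis (ix n) s" and ?V = "PI_V g ix u t" and ?U = "PI_U ix u n t"
  define y where "y = (\<lambda>k. poly (spec_poly (jet t) n ((fps_D ^^ k) ?R)) l)"
  define x where "x = (\<lambda>k. V_sum l ((fps_D ^^ k) ?R) t)"
  define p where "p = (\<lambda>k. poly (pderiv (spec_poly (jet t) n ((fps_D ^^ k) ?R))) l)"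
  define r where "r = dp_eval (jet t) (flow_weight n 0)"
  have k: "(fps_D ^^ 1) F = fps_D F" "(fps_D ^^ 2) F = fps_D (fps_D F)" for F :: "'a dpoly fps"
    by (simp_all add: eval_nat_numeral)
  note flow = V_sum_flow[OF n t y_def x_def p_def, folded r_def]
  have near: "eventually (\<lambda>s. ?d s \<in> S) (nhds 0)"
    by (rule eventually_axis_in[OF open_S t])
  have du: "((\<lambda>s. u (?d s)) has_field_derivative r) (at 0)"
    using smooth_fun_on_has_partial_0[OF smooth_u t, of "ix n"] partial_jet[OF n t, of 0] by (simp add: r_def)
  have V: "poly (?V $ 1 $ 1) l = - 1 / 2 * x 1" "poly (?V $ 1 $ 2) l = x 0"
    "poly (?V $ 2 $ 1) l = - 1 / 2 * x 2 + (l - u t) * x 0" "poly (?V $ 2 $ 2) l = 1 / 2 * x 1"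
    unfolding PI_V_entries[OF t] x_def k funpow_0 by simp_all
  have U: "poly (?U $ 1 $ 1) l = - 1 / 2 * y 1" "poly (?U $ 1 $ 2) l = y 0"
    "poly (?U $ 2 $ 1) l = - 1 / 2 * y 2 + (l - u t) * y 0" "poly (?U $ 2 $ 2) l = 1 / 2 * y 1"
    unfolding PI_U_entries PI_A_eq[OF t] PI_B_eq PI_Gamma_eq[OF t] y_def k funpow_0
    by (simp_all add: algebra_simps)
  have U': "poly (pderiv (?U $ 1 $ 1)) l = - 1 / 2 * p 1" "poly (pderiv (?U $ 1 $ 2)) l = p 0"
    "poly (pderiv (?U $ 2 $ 1)) l = - 1 / 2 * p 2 + (l - u t) * p 0 + y 0" "poly (pderiv (?U $ 2 $ 2)) l = 1 / 2 * p 1"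
    unfolding PI_U_entries PI_A_eq[OF t] PI_B_eq PI_Gamma_eq[OF t] y_def p_def k funpow_0
    unfolding pderiv_smult pderiv_add pderiv_mult pderiv_minus poly_add poly_mult poly_smult poly_minus
    by (simp_all add: pderiv_pCons algebra_simps)
  have rhs: "(eval_mat (commutator ?U ?V) l + eval_mat (\<chi> i j. pderiv (?U $ i $ j)) l) $ a $ b
      = poly (?U $ a $ 1) l * poly (?V $ 1 $ b) l + poly (?U $ a $ 2) l * poly (?V $ 2 $ b) l
        - (poly (?V $ a $ 1) l * poly (?U $ 1 $ b) l + poly (?V $ a $ 2) l * poly (?U $ 2 $ b) l)
        + poly (pderiv (?U $ a $ b)) l" for a b
    by (simp add: eval_mat_def commutator_def matrix_matrix_mult_def sum_2)
  \<comment> \<open>The formulas for the entries hold on \<open>S\<close>, so the derivative is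
    transferred through a neighbourhood of 0 on which the shifted point stays in
    \<open>S\<close>.\<close>
  have lhs: "((\<lambda>s. eval_mat (PI_V g ix u (?d s)) l $ a $ b) has_field_derivative z) (at 0)"
    if "((\<lambda>s. f (?d s)) has_field_derivative z) (at 0)" "\<And>t. t \<in> S \<Longrightarrow> poly (PI_V g ix u t $ a $ b) l = f t" for f z a b
  proof -
    have "eventually (\<lambda>s. eval_mat (PI_V g ix u (?d s)) l $ a $ b = f (?d s)) (nhds 0)"
      using near by eventually_elim (simp add: that(2) eval_mat_def)
    from DERIV_cong_ev[OF refl this refl] that(1) show ?thesis by simp
  qed
  have 11: "((\<lambda>s. eval_mat (PI_V g ix u (?d s)) l $ 1 $ 1) has_field_derivative - 1 / 2 * (y 0 * x 2 - y 2 * x 0 + p 1)) (at 0)"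
    by (rule lhs[where f = "\<lambda>t. - 1 / 2 * V_sum l (fps_D ?R) t", OF DERIV_cmult[OF flow(2)] PI_V_entries(1)])
  have 12: "((\<lambda>s. eval_mat (PI_V g ix u (?d s)) l $ 1 $ 2) has_field_derivative y 0 * x 1 - y 1 * x 0 + p 0) (at 0)"
    by (rule lhs[where f = "V_sum l ?R", OF flow(1) PI_V_entries(2)])
  have 22: "((\<lambda>s. eval_mat (PI_V g ix u (?d s)) l $ 2 $ 2) has_field_derivative - (- 1 / 2 * (y 0 * x 2 - y 2 * x 0 + p 1))) (at 0)"
    by (rule lhs[where f = "\<lambda>t. - (- 1 / 2 * V_sum l (fps_D ?R) t)", OF DERIV_minus[OF DERIV_cmult[OF flow(2)]]])
      (simp add: PI_V_entries)
  have 21: "((\<lambda>s. eval_mat (PI_V g ix u (?d s)) l $ 2 $ 1) has_field_derivative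
      - 1 / 2 * (y 1 * x 2 + y 0 * x 3 - y 3 * x 0 - y 2 * x 1 + p 2)
      + ((l - u t) * (y 0 * x 1 - y 1 * x 0 + p 0) - r * x 0)) (at 0)"
  proof (rule lhs[where f = "\<lambda>t. - 1 / 2 * V_sum l (fps_D (fps_D ?R)) t + (l - u t) * V_sum l ?R t", OF _ PI_V_entries(3)])
    have "((\<lambda>s. l - u (?d s)) has_field_derivative - r) (at 0)"
      using DERIV_diff[OF DERIV_const du, of l] by simp
    from DERIV_mult[OF this flow(1)]
    have "((\<lambda>s. (l - u (?d s)) * V_sum l ?R (?d s)) has_field_derivative
        (l - u t) * (y 0 * x 1 - y 1 * x 0 + p 0) - r * x 0) (at 0)"
      by (simp add: x_def algebra_simps)
    from DERIV_add[OF DERIV_cmult[OF flow(3)] this]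
    show "((\<lambda>s. - 1 / 2 * V_sum l (fps_D (fps_D ?R)) (?d s) + (l - u (?d s)) * V_sum l ?R (?d s)) has_field_derivative
      - 1 / 2 * (y 1 * x 2 + y 0 * x 3 - y 3 * x 0 - y 2 * x 1 + p 2)
      + ((l - u t) * (y 0 * x 1 - y 1 * x 0 + p 0) - r * x 0)) (at 0)" .
  qed
  let ?M = "eval_mat (commutator ?U ?V) l + eval_mat (\<chi> i j. pderiv (?U $ i $ j)) l"
  have 1: "?M $ 1 $ 1 = - 1 / 2 * (y 0 * x 2 - y 2 * x 0 + p 1)"
    unfolding rhs V U U' by (simp add: field_simps)
  have 2: "?M $ 1 $ 2 = y 0 * x 1 - y 1 * x 0 + p 0"
    unfolding rhs V U U' by (simp add: field_simps)
  have 3: "?M $ 2 $ 2 = - (- 1 / 2 * (y 0 * x 2 - y 2 * x 0 + p 1))"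
    unfolding rhs V U U' by (simp add: field_simps)
  \<comment> \<open>The -2 in \<open>x 3\<close> supplies the summand \<open>y 0\<close>, which in
    U_n' is the derivative of the \<lambda> in \<lambda> - u; the 2 r in \<open>y 3\<close> cancels
    the time derivative of u.\<close>
  have 4: "?M $ 2 $ 1 = - 1 / 2 * (y 1 * x 2 + y 0 * x 3 - y 3 * x 0 - y 2 * x 1 + p 2)
      + ((l - u t) * (y 0 * x 1 - y 1 * x 0 + p 0) - r * x 0)"
    unfolding rhs V U U' flow(4,5) by (simp add: field_simps)
  show ?thesis
    using exhaust_2[of a] exhaust_2[of b]
    by (elim disjE) (simp_all only: 11[folded 1] 12[folded 2] 22[folded 3] 21[folded 4])
qed

end

section \<open>The Hamiltonian vector fields\<close>

text \<open>\<open>coord_partial\<close> rests on \<open>deriv\<close>, whose value is unspecified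
  where no derivative exists, so the sum and Leibniz rules for the second argument of the bracket
  are stated under this condition.\<close>

definition coord_diff :: "nat \<Rightarrow> ('a::real_normed_field phase \<Rightarrow> 'a) \<Rightarrow> 'a phase \<Rightarrow> bool" where
  "coord_diff g F z \<longleftrightarrow> (\<forall>q\<in>coords g. (\<lambda>s. F (z(q := s))) field_differentiable at (z q))"

lemma coord_partial_has_derivative:
  "coord_diff g F z \<Longrightarrow> q \<in> coords g \<Longrightarrow> ((\<lambda>s. F (z(q := s))) has_field_derivative coord_partial q F z) (at (z q))"
  by (simp add: coord_diff_def coord_partial_def DERIV_deriv_iff_field_differentiable)

lemma coord_diff_const: "coord_diff g (\<lambda>z. c) z"
  by (simp add: coord_diff_def)

lemma coord_diff_coord: "coord_diff g (\<lambda>z. z p) z"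
  unfolding coord_diff_def
proof
  fix q show "(\<lambda>s. (z(q := s)) p) field_differentiable at (z q)"
    by (cases "p = q") simp_all
qed

lemma coord_diff_add: "coord_diff g F z \<Longrightarrow> coord_diff g G z \<Longrightarrow> coord_diff g (\<lambda>z. F z + G z) z"
  by (simp add: coord_diff_def field_differentiable_add)

lemma coord_diff_diff: "coord_diff g F z \<Longrightarrow> coord_diff g G z \<Longrightarrow> coord_diff g (\<lambda>z. F z - G z) z"
  by (simp add: coord_diff_def field_differentiable_diff)

lemma coord_diff_mult: "coord_diff g F z \<Longrightarrow> coord_diff g G z \<Longrightarrow> coord_diff g (\<lambda>z. F z * G z) z"
  by (simp add: coord_diff_def field_differentiable_mult)

lemma coord_diff_sum: "(\<And>i. i \<in> A \<Longrightarrow> coord_diff g (F i) z) \<Longrightarrow> coord_diff g (\<lambda>z. \<Sum>i\<in>A. F i z) z"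
  by (induction A rule: infinite_finite_induct) (simp_all add: coord_diff_const coord_diff_add)

lemma bracket_mult_right:
  assumes "coord_diff g G z" "coord_diff g K z"
  shows "bracket g F (\<lambda>z. G z * K z) z = G z * bracket g F K z + bracket g F G z * K z"
proof -
  have "coord_partial q (\<lambda>z. G z * K z) z = coord_partial q G z * K z + coord_partial q K z * G z"
    if "q \<in> coords g" for q
    using DERIV_mult[OF coord_partial_has_derivative[OF assms(1) that] coord_partial_has_derivative[OF assms(2) that]]
    unfolding coord_partial_def[of q "\<lambda>z. G z * K z"] by (intro DERIV_imp_deriv) simp
  then show ?thesis
    unfolding bracket_def sum_distrib_left sum_distrib_right sum.distrib[symmetric]
    by (intro sum.cong refl) (simp add: algebra_simps)
qed

lemma bracket_add_right:
  assumes "coord_diff g G z" "coord_diff g K z"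
  shows "bracket g F (\<lambda>z. G z + K z) z = bracket g F G z + bracket g F K z"
proof -
  have "coord_partial q (\<lambda>z. G z + K z) z = coord_partial q G z + coord_partial q K z"
    if "q \<in> coords g" for q
    using DERIV_add[OF coord_partial_has_derivative[OF assms(1) that] coord_partial_has_derivative[OF assms(2) that]]
    unfolding coord_partial_def[of q "\<lambda>z. G z + K z"] by (intro DERIV_imp_deriv) simp
  then show ?thesis
    unfolding bracket_def sum.distrib[symmetric]
    by (intro sum.cong refl) (simp add: algebra_simps)
qed

lemma bracket_const_right: "bracket g F (\<lambda>z. c) z = 0"
  by (simp add: bracket_def coord_partial_def)

lemma bracket_sum_right:
  assumes "finite A" "\<And>i. i \<in> A \<Longrightarrow> coord_diff g (G i) z"
  shows "bracket g F (\<lambda>z. \<Sum>i\<in>A. c i * G i z) z = (\<Sum>i\<in>A. c i * bracket g F (G i) z)"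
  using assms
proof (induction A rule: finite_induct)
  case (insert i A)
  have "coord_diff g (\<lambda>z. c i * G i z) z" "coord_diff g (\<lambda>z. \<Sum>i\<in>A. c i * G i z) z"
    using insert.prems by (auto intro!: coord_diff_mult coord_diff_sum coord_diff_const)
  then show ?case
    using insert by (simp add: bracket_add_right bracket_mult_right coord_diff_const bracket_const_right)
qed (simp add: bracket_const_right)

section \<open>Brackets with the coefficients of the spectral polynomial\<close>

lemma coord_diff_coeff:
  "coord_diff g (\<lambda>z. coeff (alpha_poly g z) i) z" "coord_diff g (\<lambda>z. coeff (beta_poly g z) i) z"
  "coord_diff g (\<lambda>z. coeff (gamma_poly g z) i) z"
  unfolding coeff_alpha coeff_beta coeff_gamma
  by (cases "i < g"; cases "i < g + 1"; simp add: coord_diff_const coord_diff_coord)+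

abbreviation spectral_poly :: "nat \<Rightarrow> 'a::comm_ring_1 phase \<Rightarrow> 'a poly" where
  "spectral_poly g z \<equiv> alpha_poly g z ^ 2 + beta_poly g z * gamma_poly g z"

lemma coord_diff_coeff_spectral: "coord_diff g (\<lambda>z. coeff (spectral_poly g z) k) z"
  unfolding coeff_add power2_eq_square coeff_mult
  by (intro coord_diff_add coord_diff_sum coord_diff_mult coord_diff_coeff)

lemma degree_spectral_poly:
  fixes z :: "'a::comm_ring_1 phase"
  shows "degree (spectral_poly g z) \<le> 2 * g + 1"
proof -
  have "degree (alpha_poly g z) \<le> g" "degree (beta_poly g z) \<le> g" "degree (gamma_poly g z) \<le> g + 1"
    by (auto intro!: degree_le simp: coeff_alpha coeff_beta coeff_gamma)
  then have "degree (alpha_poly g z * alpha_poly g z) \<le> 2 * g + 1" "degree (beta_poly g z * gamma_poly g z) \<le> 2 * g + 1"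
    using degree_mult_le[of "alpha_poly g z" "alpha_poly g z"] degree_mult_le[of "beta_poly g z" "gamma_poly g z"] by auto
  then show ?thesis unfolding power2_eq_square by (rule degree_add_le)
qed

lemma coord_diff_poly:
  "coord_diff g (\<lambda>z. poly (alpha_poly g z) m) z" "coord_diff g (\<lambda>z. poly (beta_poly g z) m) z"
  "coord_diff g (\<lambda>z. poly (gamma_poly g z) m) z"
  unfolding poly_alpha poly_beta poly_gamma
  by (intro coord_diff_add coord_diff_sum coord_diff_mult coord_diff_const coord_diff_coord)+

lemma bracket_spectral_poly:
  fixes F :: "'a::real_normed_field phase \<Rightarrow> 'a"
  shows "bracket g F (\<lambda>z. poly (spectral_poly g z) m) z =
    2 * poly (alpha_poly g z) m * bracket g F (\<lambda>z. poly (alpha_poly g z) m) z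
    + poly (beta_poly g z) m * bracket g F (\<lambda>z. poly (gamma_poly g z) m) z
    + poly (gamma_poly g z) m * bracket g F (\<lambda>z. poly (beta_poly g z) m) z"
  unfolding poly_add poly_mult power2_eq_square
  by (simp add: bracket_add_right bracket_mult_right coord_diff_mult coord_diff_poly algebra_simps)

text \<open>A polynomial in \<open>m\<close> is determined by its values at \<open>m \<noteq> l\<close>, where the brackets have closed forms.\<close>

lemma bracket_coeff_spectral:
  fixes F :: "'a::real_normed_field phase \<Rightarrow> 'a"
  assumes "\<And>m. m \<noteq> l \<Longrightarrow> bracket g F (\<lambda>z. poly (spectral_poly g z) m) z = poly q m" and k: "k \<le> 2 * g + 1"
  shows "bracket g F (\<lambda>z. coeff (spectral_poly g z) k) z = coeff q k"
proof -
  define b where "b = (\<Sum>k\<le>2 * g + 1. monom (bracket g F (\<lambda>z. coeff (spectral_poly g z) k) z) k)"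
  have "poly b m = bracket g F (\<lambda>z. poly (spectral_poly g z) m) z" for m
  proof -
    have "poly (spectral_poly g z) m = (\<Sum>k\<le>2 * g + 1. m ^ k * coeff (spectral_poly g z) k)" for z
    proof -
      have "poly (spectral_poly g z) m = (\<Sum>k<Suc (2 * g + 1). coeff (spectral_poly g z) k * m ^ k)"
        by (rule poly_lessThan, rule coeff_eq_0) (use degree_spectral_poly[of g z] in linarith)
      then show ?thesis by (simp only: lessThan_Suc_atMost mult.commute)
    qed
    then have eq: "(\<lambda>z. poly (spectral_poly g z) m) = (\<lambda>z. \<Sum>k\<le>2 * g + 1. m ^ k * coeff (spectral_poly g z) k)"
      by (rule ext)
    have "bracket g F (\<lambda>z. poly (spectral_poly g z) m) z
        = (\<Sum>k\<le>2 * g + 1. m ^ k * bracket g F (\<lambda>z. coeff (spectral_poly g z) k) z)"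
      unfolding eq by (rule bracket_sum_right[OF finite_atMost coord_diff_coeff_spectral])
    then show ?thesis unfolding b_def poly_sum poly_monom by (simp only: mult.commute)
  qed
  then have "- {l} \<subseteq> {m. poly (b - q) m = 0}" using assms(1) by auto
  moreover have "infinite (- {l} :: 'a set)"
    using infinite_UNIV_char_0 by (simp add: finite_compl)
  ultimately have "infinite {m. poly (b - q) m = 0}" using finite_subset by blast
  then have "b - q = 0" using poly_roots_finite by blast
  then have "coeff q k = coeff b k" by simp
  also have "\<dots> = bracket g F (\<lambda>z. coeff (spectral_poly g z) k) z"
    unfolding b_def coeff_sum using k by simp
  finally show ?thesis by simp
qed

lemma poly_synthetic_div:
  fixes p :: "'a::field poly"
  assumes "m \<noteq> l"
  shows "poly (synthetic_div p l) m = (poly p m - poly p l) / (m - l)"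
proof -
  have "poly p m = (m - l) * poly (synthetic_div p l) m + poly p l"
    using arg_cong[OF synthetic_div_correct'[of l p], of "\<lambda>f. poly f m"] by (simp add: algebra_simps)
  then show ?thesis using assms by (simp add: field_simps)
qed

text \<open>The coefficient of m^k in (p(m) - p(c))/(m - c) is the polynomial part of p(x)/x^(k+1),
  evaluated at c. This is how truncations of V arise from the bracket.\<close>

lemma coeff_synthetic_div: "coeff (synthetic_div p c) k = poly (poly_shift (Suc k) p) c"
proof (induction p arbitrary: k)
  case 0
  show ?case by (simp add: poly_shift_0)
next
  case (pCons a p)
  have "poly_shift (Suc k) (pCons a p) = poly_shift k p"
    by (rule poly_eqI) (simp add: coeff_poly_shift)
  moreover have "poly_shift 0 p = p" by (rule poly_eqI) (simp add: coeff_poly_shift)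
  ultimately show ?case using pCons.IH by (simp add: coeff_pCons split: nat.split)
qed

text \<open>\<open>A\<close>, \<open>B\<close>, \<open>C\<close> belong to the polynomial part of
  V(\<lambda>)/\<lambda>^(g-n), with the correction in \<open>C\<close> coming from the \<beta> E_21
  term; the right sides are the entries of the commutator with V. The exponent g - n - 1 is
  nonnegative only for n < g, which excludes the top flow.\<close>

lemma bracket_PI_I:
  fixes l :: "'a::real_normed_field" and z :: "'a phase"
  assumes n: "n < g"
  defines "a \<equiv> poly (alpha_poly g z) l" and "b \<equiv> poly (beta_poly g z) l" and "c \<equiv> poly (gamma_poly g z) l"
    and "A \<equiv> poly (poly_shift (g - n) (alpha_poly g z)) l" and "B \<equiv> poly (poly_shift (g - n) (beta_poly g z)) l"
    and "C \<equiv> poly (poly_shift (g - n) (gamma_poly g z)) l - coeff (beta_poly g z) (g - n - 1)"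
  shows "bracket g (\<lambda>w. poly (alpha_poly g w) l) (PI_I g (n + 1)) z = B * c - C * b" (is ?alpha)
    and "bracket g (\<lambda>w. poly (beta_poly g w) l) (PI_I g (n + 1)) z = 2 * (A * b - B * a)" (is ?beta)
    and "bracket g (\<lambda>w. poly (gamma_poly g w) l) (PI_I g (n + 1)) z = 2 * (C * a - A * c)" (is ?gamma)
proof -
  let ?\<alpha> = "alpha_poly g z" and ?\<beta> = "beta_poly g z" and ?\<gamma> = "gamma_poly g z"
  let ?s = "\<lambda>p. synthetic_div p l"
  have I: "PI_I g (n + 1) = (\<lambda>z. coeff (spectral_poly g z) (g - n - 1))"
    by (rule ext) (simp add: PI_I_def)
  have k: "g - n - 1 \<le> 2 * g + 1" "Suc (g - n - 1) = g - n" using n by auto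
  have ba: "bracket g (\<lambda>z. poly (beta_poly g z) l) (\<lambda>z. poly (alpha_poly g z) m) z
      = - ((poly ?\<beta> m - poly ?\<beta> l) / (m - l))" if "m \<noteq> l" for m
    by (subst bracket_antisym, subst bracket_alpha_beta[OF that]) simp
  have ca: "bracket g (\<lambda>z. poly (gamma_poly g z) l) (\<lambda>z. poly (alpha_poly g z) m) z
      = (poly ?\<gamma> m - poly ?\<gamma> l) / (m - l) - poly ?\<beta> m" if "m \<noteq> l" for m
    by (subst bracket_antisym, subst bracket_alpha_gamma[OF that]) simp
  have cb: "bracket g (\<lambda>z. poly (gamma_poly g z) l) (\<lambda>z. poly (beta_poly g z) m) z
      = - (2 * ((poly ?\<alpha> m - poly ?\<alpha> l) / (m - l)))" if "m \<noteq> l" for m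
    by (subst bracket_antisym, subst bracket_beta_gamma[OF that]) simp
  have flip: "(x - y) / (l - m) = (y - x) / (m - l)" for x y m :: 'a
    by (metis minus_diff_eq minus_divide_divide)
  have dd: "poly p m - poly p l = (m - l) * poly (?s p) m" if "m \<noteq> l" for p m
    using that by (simp add: poly_synthetic_div)
  \<comment> \<open>After this expansion at \<open>l\<close> the terms quadratic in the quotients
    cancel, and the bracket becomes visibly a polynomial in \<open>m\<close>.\<close>
  have ev: "poly p m = poly p l + (m - l) * poly (?s p) m" if "m \<noteq> l" for p m
    using dd[OF that, of p] by (simp add: algebra_simps)
  have "bracket g (\<lambda>w. poly (alpha_poly g w) l) (\<lambda>z. coeff (spectral_poly g z) (g - n - 1)) z
      = coeff (smult c (?s ?\<beta>) - smult b (?s ?\<gamma>) + smult b ?\<beta>) (g - n - 1)"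
  proof (rule bracket_coeff_spectral[OF _ k(1)])
    fix m assume m: "m \<noteq> l"
    then have lm: "l \<noteq> m" by simp
    show "bracket g (\<lambda>w. poly (alpha_poly g w) l) (\<lambda>z. poly (spectral_poly g z) m) z
        = poly (smult c (?s ?\<beta>) - smult b (?s ?\<gamma>) + smult b ?\<beta>) m"
      unfolding bracket_spectral_poly
      unfolding bracket_alpha_alpha bracket_alpha_beta[OF lm] bracket_alpha_gamma[OF lm] flip
        poly_synthetic_div[OF m, symmetric] poly_add poly_diff poly_smult
      unfolding ev[OF m, of ?\<alpha>] ev[OF m, of ?\<beta>] ev[OF m, of ?\<gamma>] b_def c_def
      by (simp add: algebra_simps)
  qed
  then show ?alpha unfolding I coeff_add coeff_diff coeff_smult coeff_synthetic_div k(2)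
    by (simp add: B_def C_def algebra_simps)
  have "bracket g (\<lambda>w. poly (beta_poly g w) l) (\<lambda>z. coeff (spectral_poly g z) (g - n - 1)) z
      = coeff (smult (2 * b) (?s ?\<alpha>) - smult (2 * a) (?s ?\<beta>)) (g - n - 1)"
  proof (rule bracket_coeff_spectral[OF _ k(1)])
    fix m assume m: "m \<noteq> l"
    then have lm: "l \<noteq> m" by simp
    show "bracket g (\<lambda>w. poly (beta_poly g w) l) (\<lambda>z. poly (spectral_poly g z) m) z
        = poly (smult (2 * b) (?s ?\<alpha>) - smult (2 * a) (?s ?\<beta>)) m"
      unfolding bracket_spectral_poly
      unfolding ba[OF m] bracket_beta_beta bracket_beta_gamma[OF lm] flip
        poly_synthetic_div[OF m, symmetric] poly_add poly_diff poly_smult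
      unfolding ev[OF m, of ?\<alpha>] ev[OF m, of ?\<beta>] ev[OF m, of ?\<gamma>] a_def b_def
      by (simp add: algebra_simps)
  qed
  then show ?beta unfolding I coeff_add coeff_diff coeff_smult coeff_synthetic_div k(2)
    by (simp add: A_def B_def algebra_simps)
  have "bracket g (\<lambda>w. poly (gamma_poly g w) l) (\<lambda>z. coeff (spectral_poly g z) (g - n - 1)) z
      = coeff (smult (2 * a) (?s ?\<gamma>) - smult (2 * c) (?s ?\<alpha>) - smult (2 * a) ?\<beta>) (g - n - 1)"
  proof (rule bracket_coeff_spectral[OF _ k(1)])
    fix m assume m: "m \<noteq> l"
    then have lm: "l \<noteq> m" by simp
    show "bracket g (\<lambda>w. poly (gamma_poly g w) l) (\<lambda>z. poly (spectral_poly g z) m) z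
        = poly (smult (2 * a) (?s ?\<gamma>) - smult (2 * c) (?s ?\<alpha>) - smult (2 * a) ?\<beta>) m"
      unfolding bracket_spectral_poly
      unfolding ca[OF m] cb[OF m] bracket_gamma_gamma
        poly_synthetic_div[OF m, symmetric] poly_add poly_diff poly_smult
      unfolding ev[OF m, of ?\<alpha>] ev[OF m, of ?\<beta>] ev[OF m, of ?\<gamma>] a_def c_def
      by (simp add: algebra_simps)
  qed
  then show ?gamma unfolding I coeff_add coeff_diff coeff_smult coeff_synthetic_div k(2)
    by (simp add: A_def C_def algebra_simps)
qed

section \<open>Truncations of V and the triangular system\<close>

lemma poly_shift_spec_poly: "n \<le> g \<Longrightarrow> poly_shift (g - n) (spec_poly v g F) = spec_poly v n F"
  by (rule poly_eqI) (auto simp: coeff_poly_shift coeff_spec_poly)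


lemma poly_shift_add: "poly_shift k (p + q) = poly_shift k p + poly_shift k q"
  by (rule poly_eqI) (simp add: coeff_poly_shift)

lemma poly_shift_smult: "poly_shift k (smult c p) = smult c (poly_shift k p)"
  by (rule poly_eqI) (simp add: coeff_poly_shift)

lemma poly_shift_pCons_0:
  assumes "k > 0"
  shows "poly_shift k (pCons 0 p) = pCons (coeff p (k - 1)) (poly_shift k p)"
proof (rule poly_eqI)
  fix i
  show "coeff (poly_shift k (pCons 0 p)) i = coeff (pCons (coeff p (k - 1)) (poly_shift k p)) i"
    using assms by (cases i; cases k) (simp_all add: coeff_poly_shift coeff_pCons)
qed

context PI_hierarchy
begin

lemma PI_U_sum:
  assumes N: "N \<le> g" and t: "t \<in> S"
  defines "cs \<equiv> const_series g (\<lambda>i. PI_c g ix i t)"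
  shows "(\<Sum>i\<le>N. smult (PI_c g ix i t) (PI_U ix u (N - i) t $ 1 $ 1)) = smult (- 1 / 2) (spec_poly (jet t) N (cs * fps_D gd_fps))"
    and "(\<Sum>i\<le>N. smult (PI_c g ix i t) (PI_U ix u (N - i) t $ 1 $ 2)) = spec_poly (jet t) N (cs * gd_fps)"
    and "(\<Sum>i\<le>N. smult (PI_c g ix i t) (PI_U ix u (N - i) t $ 2 $ 1)) =
      smult (- 1 / 2) (spec_poly (jet t) N (cs * fps_D (fps_D gd_fps))) + [:- u t, 1:] * spec_poly (jet t) N (cs * gd_fps)"
proof -
  have "smult a (\<Sum>i\<in>A. f i) = (\<Sum>i\<in>A. smult a (f i))" for a and f :: "nat \<Rightarrow> 'a poly" and A
    by (rule poly_eqI) (simp add: coeff_sum sum_distrib_left)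
  then show "(\<Sum>i\<le>N. smult (PI_c g ix i t) (PI_U ix u (N - i) t $ 1 $ 1)) = smult (- 1 / 2) (spec_poly (jet t) N (cs * fps_D gd_fps))"
    and "(\<Sum>i\<le>N. smult (PI_c g ix i t) (PI_U ix u (N - i) t $ 1 $ 2)) = spec_poly (jet t) N (cs * gd_fps)"
    and "(\<Sum>i\<le>N. smult (PI_c g ix i t) (PI_U ix u (N - i) t $ 2 $ 1)) =
      smult (- 1 / 2) (spec_poly (jet t) N (cs * fps_D (fps_D gd_fps))) + [:- u t, 1:] * spec_poly (jet t) N (cs * gd_fps)"
    unfolding cs_def spec_poly_const_series[OF N, symmetric] PI_U_entries PI_A_eq[OF t] PI_B_eq PI_Gamma_eq[OF t]
    by (simp_all only: sum_distrib_left sum.distrib[symmetric] smult_smult mult.commute smult_add_right mult_smult_right)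
qed

text \<open>Truncation respects the sums that make up V except for the factor \<lambda> in \<gamma>,
  which lifts one more coefficient of \<beta> above the cut. This constant cancels the correction in
  \<open>C\<close> of \<open>bracket_PI_I\<close>, so the truncated matrix is exactly U_n + c_1
  U_(n-1) + ... + c_n U_0.\<close>

lemma PI_V_poly_shift:
  assumes n: "n < g" and t: "t \<in> S"
  defines "V \<equiv> PI_V g ix u t" and "W \<equiv> \<lambda>a b. \<Sum>i\<le>n. smult (PI_c g ix i t) (PI_U ix u (n - i) t $ a $ b)"
  shows "poly_shift (g - n) (V $ 1 $ 1) = W 1 1"
    and "poly_shift (g - n) (V $ 1 $ 2) = W 1 2"
    and "poly_shift (g - n) (V $ 2 $ 1) = W 2 1 + [:coeff (V $ 1 $ 2) (g - n - 1):]"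
proof -
  have k: "g - n > 0" and le: "n \<le> g" using n by auto
  note V = V_def PI_V_def vec_lambda_beta PI_U_sum[OF order.refl t]
  note W = W_def PI_U_sum[OF le t]
  show "poly_shift (g - n) (V $ 1 $ 1) = W 1 1" "poly_shift (g - n) (V $ 1 $ 2) = W 1 2"
    unfolding V W by (simp_all only: poly_shift_smult poly_shift_spec_poly[OF le])
  have X: "[:- u t, 1:] * p = smult (- u t) p + pCons 0 p" for p :: "'a poly" by simp
  have c: "pCons x p = [:x:] + pCons 0 p" for x and p :: "'a poly" by simp
  show "poly_shift (g - n) (V $ 2 $ 1) = W 2 1 + [:coeff (V $ 1 $ 2) (g - n - 1):]"
    unfolding V W X poly_shift_add poly_shift_smult poly_shift_pCons_0[OF k] poly_shift_spec_poly[OF le]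
    by (subst c) (simp only: add_ac)
qed

lemma matrix_bracket_PI_I:
  assumes n: "n < g" and t: "t \<in> S"
  shows "matrix_bracket g l (PI_I g (n + 1)) (phase_point g (PI_V g ix u t)) $ a $ b
    = (\<Sum>i\<le>n. PI_c g ix i t * eval_mat (commutator (PI_U ix u (n - i) t) (PI_V g ix u t)) l $ a $ b)"
proof -
  let ?V = "PI_V g ix u t" and ?z = "phase_point g (PI_V g ix u t)"
  define w where "w a b = (\<Sum>i\<le>n. PI_c g ix i t * poly (PI_U ix u (n - i) t $ a $ b) l)" for a b
  have V: "alpha_poly g ?z = ?V $ 1 $ 1" "beta_poly g ?z = ?V $ 1 $ 2" "gamma_poly g ?z = ?V $ 2 $ 1" "- alpha_poly g ?z = ?V $ 2 $ 2"
    using PI_V_in_phase_space[of g ix u t] by (auto simp: phase_matrix_def mat2_def vec_eq_iff forall_2)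
  have V22: "poly (?V $ 2 $ 2) l = - poly (?V $ 1 $ 1) l" unfolding V(1,4)[symmetric] by simp
  have w: "poly (\<Sum>i\<le>n. smult (PI_c g ix i t) (PI_U ix u (n - i) t $ a $ b)) l = w a b" for a b
    by (simp add: w_def poly_sum)
  have w22: "w 2 2 = - w 1 1"
    unfolding w_def PI_U_entries by (simp add: sum_negf)
  have br: "bracket g (\<lambda>w. poly (alpha_poly g w) l) (PI_I g (n + 1)) ?z = w 1 2 * poly (?V $ 2 $ 1) l - w 2 1 * poly (?V $ 1 $ 2) l"
    "bracket g (\<lambda>w. poly (beta_poly g w) l) (PI_I g (n + 1)) ?z = 2 * (w 1 1 * poly (?V $ 1 $ 2) l - w 1 2 * poly (?V $ 1 $ 1) l)"
    "bracket g (\<lambda>w. poly (gamma_poly g w) l) (PI_I g (n + 1)) ?z = 2 * (w 2 1 * poly (?V $ 1 $ 1) l - w 1 1 * poly (?V $ 2 $ 1) l)"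
    unfolding bracket_PI_I[OF n] V PI_V_poly_shift[OF n t] by (simp_all add: w)
  have R: "(\<Sum>i\<le>n. PI_c g ix i t * eval_mat (commutator (PI_U ix u (n - i) t) ?V) l $ a $ b)
     = w a 1 * poly (?V $ 1 $ b) l + w a 2 * poly (?V $ 2 $ b) l
       - (poly (?V $ a $ 1) l * w 1 b + poly (?V $ a $ 2) l * w 2 b)" for a b
    unfolding w_def eval_mat_def commutator_def matrix_matrix_mult_def sum_2
    by (simp add: sum_distrib_left sum_distrib_right sum.distrib[symmetric] sum_subtractf[symmetric] algebra_simps)
  have m: "matrix_bracket g l F z $ 1 $ 1 = bracket g (\<lambda>w. poly (alpha_poly g w) l) F z"
    "matrix_bracket g l F z $ 1 $ 2 = bracket g (\<lambda>w. poly (beta_poly g w) l) F z"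
    "matrix_bracket g l F z $ 2 $ 1 = bracket g (\<lambda>w. poly (gamma_poly g w) l) F z"
    "matrix_bracket g l F z $ 2 $ 2 = - bracket g (\<lambda>w. poly (alpha_poly g w) l) F z" for F and z :: "'a phase"
    by (simp_all add: matrix_bracket_def phase_matrix_def mat2_def bracket_alpha_neg)
  show ?thesis
    using exhaust_2[of a] exhaust_2[of b] unfolding R
    by (elim disjE) (simp_all add: m br[unfolded Suc_eq_plus1[symmetric]] w22 V22 algebra_simps)
qed

text \<open>The brackets with H_(k+1) and the commutators with U_k satisfy the same triangular
  system with leading coefficient c_0 = 1, hence agree. Solving for \<open>H (n + 1)\<close> also
  shows it to be differentiable, which is needed before the bracket with the sum can be
  split.\<close>

theorem hamiltonian_form:
  fixes H :: "nat \<Rightarrow> 'a phase \<Rightarrow> 'a"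
  assumes t: "t \<in> S" and n: "n < g"
    and H: "\<And>n z. n < g \<Longrightarrow> PI_I g (n + 1) z = (\<Sum>i\<le>n. PI_c g ix i t * H (n + 1 - i) z)"
  shows "matrix_bracket g l (H (n + 1)) (phase_point g (PI_V g ix u t))
    = eval_mat (commutator (PI_U ix u n t) (PI_V g ix u t)) l"
proof -
  let ?z = "phase_point g (PI_V g ix u t)" and ?c = "\<lambda>i. PI_c g ix i t"
  let ?K = "\<lambda>n. eval_mat (commutator (PI_U ix u n t) (PI_V g ix u t)) l"
  have c0: "?c 0 = 1" by (simp add: PI_c_def)
  have split: "(\<Sum>i\<le>n. f i) = f 0 + (\<Sum>i=1..n. f i)" for f :: "nat \<Rightarrow> 'a" and n
    unfolding atMost_atLeast0 by (simp add: sum.atLeast_Suc_atMost)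
  have "coord_diff g (H (n + 1)) ?z \<and> matrix_bracket g l (H (n + 1)) ?z = ?K n"
    using n
  proof (induction n rule: less_induct)
    case (less n)
    have IH: "coord_diff g (H (n + 1 - i)) ?z" "matrix_bracket g l (H (n + 1 - i)) ?z = ?K (n - i)" if "i \<in> {1..n}" for i
    proof -
      have "n + 1 - i = (n - i) + 1" "n - i < n" "n - i < g" using that less.prems by auto
      then show "coord_diff g (H (n + 1 - i)) ?z" "matrix_bracket g l (H (n + 1 - i)) ?z = ?K (n - i)"
        using less.IH[of "n - i"] by simp_all
    qed
    have "H (n + 1) = (\<lambda>z. PI_I g (n + 1) z - (\<Sum>i=1..n. ?c i * H (n + 1 - i) z))"
      using H[OF less.prems] by (auto simp: split c0)
    moreover have "coord_diff g (PI_I g (n + 1)) ?z"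
      using coord_diff_coeff_spectral[of g "g - (n + 1)" ?z] unfolding PI_I_def[abs_def] .
    ultimately have diff: "coord_diff g (H (n + 1)) ?z"
      using IH(1) by (simp only:) (intro coord_diff_diff coord_diff_sum coord_diff_mult coord_diff_const; simp)
    have "coord_diff g (H (n + 1 - i)) ?z" if "i \<in> {..n}" for i
      using that IH(1)[of i] diff by (cases "i = 0") auto
    note sum_right = bracket_sum_right[OF finite_atMost this]
    have "matrix_bracket g l (H (n + 1)) ?z $ a $ b = ?K n $ a $ b" for a b
    proof -
      have "PI_I g (n + 1) = (\<lambda>z. \<Sum>i\<le>n. ?c i * H (n + 1 - i) z)"
        by (rule ext) (rule H[OF less.prems])
      then have "(\<Sum>i\<le>n. ?c i * matrix_bracket g l (H (n + 1 - i)) ?z $ a $ b) = matrix_bracket g l (PI_I g (n + 1)) ?z $ a $ b"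
        by (simp only: matrix_bracket_def vec_lambda_beta sum_right)
      also have "\<dots> = (\<Sum>i\<le>n. ?c i * ?K (n - i) $ a $ b)"
        by (rule matrix_bracket_PI_I[OF less.prems t])
      finally have all: "(\<Sum>i\<le>n. ?c i * matrix_bracket g l (H (n + 1 - i)) ?z $ a $ b) = (\<Sum>i\<le>n. ?c i * ?K (n - i) $ a $ b)" .
      have "matrix_bracket g l (H (n + 1)) ?z $ a $ b + (\<Sum>i=1..n. ?c i * ?K (n - i) $ a $ b)
          = ?K n $ a $ b + (\<Sum>i=1..n. ?c i * ?K (n - i) $ a $ b)"
      proof -
        have "(\<Sum>i=1..n. ?c i * matrix_bracket g l (H (n + 1 - i)) ?z $ a $ b) = (\<Sum>i=1..n. ?c i * ?K (n - i) $ a $ b)"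
          by (intro sum.cong refl) (simp only: IH(2))
        then show ?thesis
          using all unfolding split c0 by (simp only: mult_1 diff_zero)
      qed
      then show ?thesis by simp
    qed
    then show ?case using diff by (simp add: vec_eq_iff)
  qed
  then show ?thesis by simp
qed

end

theorem theorem2:
  fixes g :: nat
    and ix :: "nat \<Rightarrow> 'n::finite"
    and S :: "('a::real_normed_field ^ 'n) set"
    and u :: "'a ^ 'n \<Rightarrow> 'a"
    and H :: "'a ^ 'n \<Rightarrow> nat \<Rightarrow> 'a phase \<Rightarrow> 'a"
  assumes "g \<ge> 1"
    and "bij_betw ix {0..g} UNIV"
    and "PI_solution g ix S u"
    and "\<And>t n z. t \<in> S \<Longrightarrow> n < g \<Longrightarrow>
           PI_I g (n + 1) z = (\<Sum>i\<le>n. PI_c g ix i t * H t (n + 1 - i) z)"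
  shows "\<forall>t\<in>S. \<forall>n<g. \<forall>l.
           eval_mat (commutator (PI_U ix u n t) (PI_V g ix u t)) l
             = matrix_bracket g l (H t (n + 1)) (phase_point g (PI_V g ix u t)) \<and>
           (\<forall>a b. ((\<lambda>s. eval_mat (PI_V g ix u (t + axis (ix n) s)) l $ a $ b) has_field_derivative
               (matrix_bracket g l (H t (n + 1)) (phase_point g (PI_V g ix u t))
                 + eval_mat (\<chi> i j. pderiv (PI_U ix u n t $ i $ j)) l) $ a $ b) (at 0))"
proof (intro ballI allI impI)
  fix t n l assume t: "t \<in> S" and n: "n < g"
  interpret PI_hierarchy g ix S u by unfold_locales (fact assms)+
  have ham: "matrix_bracket g l (H t (n + 1)) (phase_point g (PI_V g ix u t))
      = eval_mat (commutator (PI_U ix u n t) (PI_V g ix u t)) l"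
    by (rule hamiltonian_form[OF t n]) (rule assms(4)[OF t])
  show "eval_mat (commutator (PI_U ix u n t) (PI_V g ix u t)) l
             = matrix_bracket g l (H t (n + 1)) (phase_point g (PI_V g ix u t)) \<and>
           (\<forall>a b. ((\<lambda>s. eval_mat (PI_V g ix u (t + axis (ix n) s)) l $ a $ b) has_field_derivative
               (matrix_bracket g l (H t (n + 1)) (phase_point g (PI_V g ix u t))
                 + eval_mat (\<chi> i j. pderiv (PI_U ix u n t $ i $ j)) l) $ a $ b) (at 0))"
    \<comment> \<open>The Lax equation is available up to n = g; the restriction n < g comes from
      the Hamiltonian side.\<close>
    unfolding ham using lax_equation[OF less_imp_le[OF n] t] by blast
qed

end
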